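(* Let $k\in(0,1)$ and an integer $m\ge0$ be fixed, let $\nu\to\infty$ and $\kappa=k\sqrt{\nu(\nu+1)}$. Let $\mu_1,\mu_2,\dots$ be the constants (depending only on $m$ and $k$) determined by the recursion in the context. Then for every integer $n\ge1$, as $\kappa\to\infty$, $$a_\nu^m=(2m+1)\kappa+2\sum_{s=0}^{n-1}\frac{\mu_{s+1}}{\kappa^s}+\mathcal O(\kappa^{-n}),\qquad b_\nu^{m+1}=(2m+1)\kappa+2\sum_{s=0}^{n-1}\frac{\mu_{s+1}}{\kappa^s}+\mathcal O(\kappa^{-n}).$$ The first two coefficients are $$\mu_1=-\frac{k^2+1}{8}\left(1+2m+2m^2\right),\qquad \mu_2=-\frac{2m+1}{32}\left((k^2-1)^2(1+m+m^2)-2k^2\right).$$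
   Context: **Lamé eigenvalues.** Lamé's equation is $w''(z)+\big(h-\nu(\nu+1)k^2\operatorname{sn}^2(z,k)\big)w(z)=0$, with $0<k<1$, $\nu\ge-\tfrac12$, and $K=K(k)$ the complete elliptic integral of the first kind. For $m=0,1,2,\dots$, $a_\nu^m$ is the value of $h$ for which there is a nontrivial solution with $w'(-K)=w'(K)=0$ having exactly $m$ zeros in $(-K,K)$; $b_\nu^{m+1}$ is the value of $h$ for which there is a nontrivial solution with $w(-K)=w(K)=0$ having exactly $m$ zeros in $(-K,K)$. **Coefficients.** Put $\tilde t=\tfrac14t^2-m-\tfrac12$. Set $A_0(t)=1$, $B_0(t)=0$, and $A_{-1}=B_{-1}=0$. For $s\ge1$, the even polynomial $A_s(t)$ with $A_s(0)=0$, the odd polynomial $B_s(t)$ and the constant $\mu_s$ are determined recursively by the two identities in $t$ $$2A_s'+B_s''-\tfrac{(1+k^2)t}{2}\big(2tA_{s-1}'+A_{s-1}+tB_{s-1}''+B_{s-1}'+\tilde t\,tB_{s-1}\big)+\tfrac{k^2t^3}{4}\big(2tA_{s-2}'+2A_{s-2}+tB_{s-2}''+2B_{s-2}'+\tilde t\,tB_{s-2}\big)+\sum_{j=1}^s\mu_jB_{s-j}=0,$$ $$A_s''+2\tilde t B_s'+\tfrac t2B_s+\sum_{j=1}^s\mu_jA_{s-j}-\tfrac{(1+k^2)t}{2}\Big(tA_{s-1}''+A_{s-1}'+\tfrac{t^2}{2}B_{s-1}+\tilde t\,(tA_{s-1}+2tB_{s-1}'+B_{s-1})\Big)+\tfrac{k^2t^3}{4}\Big(tA_{s-2}''+2A_{s-2}'+\tfrac{t^2}{2}B_{s-2}+\tilde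 t\,(tA_{s-2}+2tB_{s-2}'+2B_{s-2})\Big)=0.$$ (These express that, with $t=\sqrt{2\kappa}\operatorname{sn}(z,k)$ and $h=(2m+1)\kappa+2\sum_{s\ge1}\mu_s\kappa^{1-s}$, the formal series $D_m(t)\sum_sA_s(t)\kappa^{-s}+D_m'(t)\sum_sB_s(t)\kappa^{-s}$, with $D_m$ the parabolic cylinder function $D_m(t)=e^{-t^2/4}\mathrm{He}_m(t)$, formally satisfies Lamé's equation, the coefficients of $D_m$ and $D_m'$ vanishing separately.) *)

theory Defs
  imports
    "HOL-Analysis.Analysis"
    "HOL-Library.Landau_Symbols"
    "HOL-Computational_Algebra.Polynomial"
begin

section \<open>Jacobi's elliptic function sn on the real line\<close>

text \<open>The interval integral is oriented, so \<open>ellF k\<close> is an odd function of the amplitude;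
  for \<open>0 < k < 1\<close> it is a bijection of the real line.\<close>

definition ellF :: "real \<Rightarrow> real \<Rightarrow> real" where
  "ellF k \<phi> = (LBINT \<theta>=ereal 0..ereal \<phi>. 1 / sqrt (1 - k\<^sup>2 * (sin \<theta>)\<^sup>2))"

definition ellK :: "real \<Rightarrow> real" where
  "ellK k = ellF k (pi / 2)"

definition jacobi_am :: "real \<Rightarrow> real \<Rightarrow> real" where
  "jacobi_am k z = (THE \<phi>. ellF k \<phi> = z)"

definition jacobi_sn :: "real \<Rightarrow> real \<Rightarrow> real" where
  "jacobi_sn k z = sin (jacobi_am k z)"


section \<open>Lame's equation and its eigenvalues\<close>

text \<open>\<open>w\<close> is a nontrivial real solution with derivative \<open>w'\<close> on \<open>[-K, K]\<close>
  (one-sided derivatives at the two end points).\<close>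

definition lame_solution ::
  "real \<Rightarrow> real \<Rightarrow> real \<Rightarrow> (real \<Rightarrow> real) \<Rightarrow> (real \<Rightarrow> real) \<Rightarrow> bool" where
  "lame_solution k \<nu> h w w' \<longleftrightarrow>
     (\<forall>z\<in>{- ellK k..ellK k}.
        (w has_real_derivative w' z) (at z within {- ellK k..ellK k}) \<and>
        (\<exists>w''. (w' has_real_derivative w'') (at z within {- ellK k..ellK k}) \<and>
               w'' + (h - \<nu> * (\<nu> + 1) * k\<^sup>2 * (jacobi_sn k z)\<^sup>2) * w z = 0)) \<and>
     (\<exists>z\<in>{- ellK k..ellK k}. w z \<noteq> 0)"

text \<open>The finiteness conjunct is needed because \<open>card\<close> of an infinite set is \<open>0\<close>.\<close>

definition has_zeros :: "real \<Rightarrow> (real \<Rightarrow> real) \<Rightarrow> nat \<Rightarrow> bool" where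
  "has_zeros k w m \<longleftrightarrow>
     finite {z \<in> {- ellK k<..<ellK k}. w z = 0} \<and>
     card {z \<in> {- ellK k<..<ellK k}. w z = 0} = m"

definition lame_a :: "real \<Rightarrow> real \<Rightarrow> nat \<Rightarrow> real" where
  "lame_a k \<nu> m =
     (THE h. \<exists>w w'. lame_solution k \<nu> h w w' \<and>
        w' (- ellK k) = 0 \<and> w' (ellK k) = 0 \<and> has_zeros k w m)"

text \<open>The upper index of \<open>b\<close> starts at \<open>1\<close>: the value at \<open>m + 1\<close> belongs to the
  eigenfunction with \<open>m\<close> interior zeros.\<close>

definition lame_b :: "real \<Rightarrow> real \<Rightarrow> nat \<Rightarrow> real" where
  "lame_b k \<nu> p =
     (THE h. \<exists>w w' m. p = m + 1 \<and> lame_solution k \<nu> h w w' \<and>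
        w (- ellK k) = 0 \<and> w (ellK k) = 0 \<and> has_zeros k w m)"

definition lame_kappa :: "real \<Rightarrow> real \<Rightarrow> real" where
  "lame_kappa k \<nu> = k * sqrt (\<nu> * (\<nu> + 1))"


section \<open>The coefficients of the expansion\<close>

text \<open>\<open>prev_term A s j\<close> is the term with index \<open>s - j\<close>, terms with a negative index being zero.\<close>

definition prev_term :: "(nat \<Rightarrow> real poly) \<Rightarrow> nat \<Rightarrow> nat \<Rightarrow> real poly" where
  "prev_term A s j = (if j \<le> s then A (s - j) else 0)"

definition ttilde :: "nat \<Rightarrow> real \<Rightarrow> real" where
  "ttilde m t = t\<^sup>2 / 4 - real m - 1 / 2"

text \<open>The coefficient of \<open>D\<^sub>m'\<close> at order \<open>s\<close>.\<close>

definition lame_identity1 ::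
  "real \<Rightarrow> nat \<Rightarrow> (nat \<Rightarrow> real poly) \<Rightarrow> (nat \<Rightarrow> real poly) \<Rightarrow> (nat \<Rightarrow> real) \<Rightarrow> nat \<Rightarrow> bool" where
  "lame_identity1 k m A B \<mu> s \<longleftrightarrow> (\<forall>t.
     let a' = poly (pderiv (A s));
         b'' = poly (pderiv (pderiv (B s)));
         a1 = poly (prev_term A s 1); a1' = poly (pderiv (prev_term A s 1));
         b1 = poly (prev_term B s 1); b1' = poly (pderiv (prev_term B s 1));
         b1'' = poly (pderiv (pderiv (prev_term B s 1)));
         a2 = poly (prev_term A s 2); a2' = poly (pderiv (prev_term A s 2));
         b2 = poly (prev_term B s 2); b2' = poly (pderiv (prev_term B s 2));
         b2'' = poly (pderiv (pderiv (prev_term B s 2)))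
     in 2 * a' t + b'' t
        - (1 + k\<^sup>2) * t / 2 *
            (2 * t * a1' t + a1 t + t * b1'' t + b1' t + ttilde m t * t * b1 t)
        + k\<^sup>2 * t ^ 3 / 4 *
            (2 * t * a2' t + 2 * a2 t + t * b2'' t + 2 * b2' t + ttilde m t * t * b2 t)
        + (\<Sum>j=1..s. \<mu> j * poly (B (s - j)) t) = 0)"

text \<open>The coefficient of \<open>D\<^sub>m\<close> at order \<open>s\<close>.\<close>

definition lame_identity2 ::
  "real \<Rightarrow> nat \<Rightarrow> (nat \<Rightarrow> real poly) \<Rightarrow> (nat \<Rightarrow> real poly) \<Rightarrow> (nat \<Rightarrow> real) \<Rightarrow> nat \<Rightarrow> bool" where
  "lame_identity2 k m A B \<mu> s \<longleftrightarrow> (\<forall>t.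
     let a'' = poly (pderiv (pderiv (A s)));
         b = poly (B s); b' = poly (pderiv (B s));
         a1 = poly (prev_term A s 1); a1' = poly (pderiv (prev_term A s 1));
         a1'' = poly (pderiv (pderiv (prev_term A s 1)));
         b1 = poly (prev_term B s 1); b1' = poly (pderiv (prev_term B s 1));
         a2 = poly (prev_term A s 2); a2' = poly (pderiv (prev_term A s 2));
         a2'' = poly (pderiv (pderiv (prev_term A s 2)));
         b2 = poly (prev_term B s 2); b2' = poly (pderiv (prev_term B s 2))
     in a'' t + 2 * ttilde m t * b' t + t / 2 * b t
        + (\<Sum>j=1..s. \<mu> j * poly (A (s - j)) t)
        - (1 + k\<^sup>2) * t / 2 *
            (t * a1'' t + a1' t + t\<^sup>2 / 2 * b1 t
             + ttilde m t * (t * a1 t + 2 * t * b1' t + b1 t))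
        + k\<^sup>2 * t ^ 3 / 4 *
            (t * a2'' t + 2 * a2' t + t\<^sup>2 / 2 * b2 t
             + ttilde m t * (t * a2 t + 2 * t * b2' t + 2 * b2 t)) = 0)"

definition lame_recursion ::
  "real \<Rightarrow> nat \<Rightarrow> (nat \<Rightarrow> real poly) \<Rightarrow> (nat \<Rightarrow> real poly) \<Rightarrow> (nat \<Rightarrow> real) \<Rightarrow> bool" where
  "lame_recursion k m A B \<mu> \<longleftrightarrow>
     A 0 = 1 \<and> B 0 = 0 \<and>
     (\<forall>s\<ge>1.
        (\<forall>t. poly (A s) (- t) = poly (A s) t) \<and> poly (A s) 0 = 0 \<and>
        (\<forall>t. poly (B s) (- t) = - poly (B s) t) \<and>
        lame_identity1 k m A B \<mu> s \<and> lame_identity2 k m A B \<mu> s)"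

text \<open>Meaningful for \<open>s \<ge> 1\<close> only: the recursion does not mention \<open>\<mu> 0\<close>.\<close>

definition lame_mu :: "real \<Rightarrow> nat \<Rightarrow> nat \<Rightarrow> real" where
  "lame_mu k m s = (THE c. \<exists>A B \<mu>. lame_recursion k m A B \<mu> \<and> \<mu> s = c)"

end

theory Submission
  imports Defs "HOL-Real_Asymp.Real_Asymp"
begin

text \<open>Put \<open>\<epsilon> = 1 / \<kappa>\<close>, \<open>x = sqrt (2 \<kappa>) z\<close>, \<open>t(x) = sqrt (2 \<kappa>) sn z\<close> and
  \<open>l = h / (2 \<kappa>)\<close>; Lame's equation becomes \<open>y'' = (t(x)\<^sup>2 / 4 - l) y\<close>, which tends to the equation
  of the parabolic cylinder function \<open>D\<^sub>m\<close>. Truncating the formal series gives a quasimode \<open>W\<close> at level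
  \<open>l\<^sub>0\<close> whose residual is \<open>\<epsilon>\<^bsup>n+2\<^esup>\<close> times a polynomial in \<open>t\<close> times \<open>exp (- t\<^sup>2 / 4)\<close>.
  Shoot from \<open>x = 0\<close> with the initial data of \<open>D\<^sub>m\<close>. At \<open>l = l\<^sub>0 \<plusminus> \<epsilon>\<^bsup>n+1\<^esup>\<close> the Wronskian of the
  solution \<open>y\<close> with \<open>W\<close> has a definite sign, and as \<open>1 / W\<^sup>2\<close> is huge at \<open>t = ln \<kappa>\<close>, this forces
  \<open>y\<close> and \<open>y'\<close> at the end point to be both negative for the upper sign and both positive for the lower one.
  The intermediate value theorem in \<open>l\<close> yields a Dirichlet and a Neumann eigenvalue in between. The
  eigenfunction is close to \<open>D\<^sub>m\<close> in the oscillatory region and has no zeros outside it, so it has \<open>m\<close>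
  zeros; by Sturm comparison this identifies the eigenvalue. The constants \<open>\<mu>\<^sub>s\<close> are unique
  because eliminating \<open>A\<^sub>s\<close> from the recursion leaves an operator on \<open>B\<^sub>s\<close> that raises degrees by one.\<close>

section \<open>Jacobi's elliptic sine\<close>

text \<open>The quasimode is trusted only up to t = ln \<kappa>: farther out t grows to sqrt (2
  \<kappa>), the terms \<epsilon>^s A_s(t) are no longer under control, and nothing keeps W
  positive. The point ln \<kappa> meets two demands. A polynomial in t is still below \<kappa>
  there, so the spare factor \<epsilon> in the residual makes it smaller than \<epsilon>^(n+1) W,
  the drift produced by moving l; and exp (t^2 / 4) already exceeds every power of \<kappa>, in
  particular 1 / \<epsilon>^(n+1). Beyond that point only t^2 / 4 > l is used: a solution entering
  with value and slope of one sign keeps both up to the end. Controlling both signs at once is what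
  lets one argument serve the Dirichlet and the Neumann problem, and why their expansions coincide.
  Starting at the centre with the data of \<open>D_m\<close> fixes the parity of the solution, so
  the condition at the right end implies the one at the left end. A gap \<epsilon>^(n+1) in l is an
  error 2 \<kappa>^(-n) in h = 2 \<kappa> l. The quasimode is therefore truncated at order n + 1,
  one term beyond the claimed expansion, and that last term is absorbed in the error.\<close>

definition jacobi_dn :: "real \<Rightarrow> real \<Rightarrow> real" where
  "jacobi_dn k \<phi> = sqrt (1 - k\<^sup>2 * (sin \<phi>)\<^sup>2)"

definition jacobi_sn' :: "real \<Rightarrow> real \<Rightarrow> real" where
  "jacobi_sn' k z = cos (jacobi_am k z) * jacobi_dn k (jacobi_am k z)"

lemma one_minus_k_sin_pos:
  fixes k :: real
  assumes "0 < k" "k < 1"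
  shows "0 < 1 - k\<^sup>2 * (sin \<phi>)\<^sup>2" "1 - k\<^sup>2 * (sin \<phi>)\<^sup>2 \<le> 1"
proof -
  have "k\<^sup>2 < 1" using assms by (simp add: abs_square_less_1)
  moreover have "k\<^sup>2 * (sin \<phi>)\<^sup>2 \<le> k\<^sup>2 * 1"
    by (rule mult_left_mono) (simp_all add: abs_square_le_1)
  ultimately show "0 < 1 - k\<^sup>2 * (sin \<phi>)\<^sup>2" by linarith
qed simp

lemma jacobi_dn_pos:
  assumes "0 < k" "k < 1"
  shows "0 < jacobi_dn k \<phi>" "jacobi_dn k \<phi> \<le> 1"
  using one_minus_k_sin_pos[OF assms, of \<phi>] by (auto simp: jacobi_dn_def)

lemma ellF_has_derivative:
  assumes "0 < k" "k < 1"
  shows "(ellF k has_real_derivative 1 / jacobi_dn k \<phi>) (at \<phi>)"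
proof -
  define r where "r = \<bar>\<phi>\<bar> + 1"
  have "continuous_on {-r..r} (\<lambda>\<theta>. 1 / sqrt (1 - k\<^sup>2 * (sin \<theta>)\<^sup>2))"
    using one_minus_k_sin_pos(1)[OF assms]
    by (intro continuous_intros) (auto simp: less_imp_neq[symmetric])
  then have "((\<lambda>u. LBINT y=ereal 0..ereal u. 1 / sqrt (1 - k\<^sup>2 * (sin y)\<^sup>2))
      has_vector_derivative 1 / sqrt (1 - k\<^sup>2 * (sin \<phi>)\<^sup>2)) (at \<phi> within {-r..r})"
    by (rule interval_integral_FTC2[rotated 2]) (auto simp: r_def)
  moreover have "at \<phi> within {-r..r} = at \<phi>"
    by (rule at_within_interior) (simp add: r_def interior_atLeastAtMost_real, linarith)
  moreover have "ellF k = (\<lambda>u. LBINT y=ereal 0..ereal u. 1 / sqrt (1 - k\<^sup>2 * (sin y)\<^sup>2))"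
    by (simp add: ellF_def fun_eq_iff)
  ultimately show ?thesis
    by (simp add: has_real_derivative_iff_has_vector_derivative jacobi_dn_def)
qed

lemma ellF_0: "ellF k 0 = 0"
  by (simp add: ellF_def)

text \<open>The integrand is at least 1, so \<open>ellF k\<close> expands distances. Injectivity
  and, through the linear growth, surjectivity follow, which gives the \<open>THE\<close> in
  \<open>jacobi_am\<close> its meaning.\<close>

lemma ellF_strict_mono:
  assumes "0 < k" "k < 1" "a < b"
  shows "b - a \<le> ellF k b - ellF k a"
proof -
  obtain c where "ellF k b - ellF k a = (b - a) * (1 / jacobi_dn k c)"
    using MVT2[OF assms(3), of "ellF k" "\<lambda>\<phi>. 1 / jacobi_dn k \<phi>"] ellF_has_derivative[OF assms(1,2)] by blast
  moreover have "1 \<le> 1 / jacobi_dn k c"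
    using jacobi_dn_pos[OF assms(1,2), of c] by simp
  ultimately show ?thesis using assms(3)
    by (metis diff_gt_0_iff_gt less_eq_real_def mult_left_mono mult.right_neutral)
qed

lemma ellF_cont: "0 < k \<Longrightarrow> k < 1 \<Longrightarrow> isCont (ellF k) x"
  using DERIV_isCont ellF_has_derivative by blast

lemma ellF_inj: "0 < k \<Longrightarrow> k < 1 \<Longrightarrow> ellF k a = ellF k b \<Longrightarrow> a = b"
  using ellF_strict_mono[of k a b] ellF_strict_mono[of k b a] by (cases a b rule: linorder_cases) auto

lemma ellF_surj:
  assumes "0 < k" "k < 1"
  shows "\<exists>\<phi>. ellF k \<phi> = z"
proof -
  define r where "r = \<bar>z\<bar> + 1"
  have "ellF k (-r) \<le> z"
    using ellF_strict_mono[OF assms, of "-r" 0] by (simp add: r_def ellF_0, linarith)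
  moreover have "z \<le> ellF k r"
    using ellF_strict_mono[OF assms, of 0 r] by (simp add: r_def ellF_0, linarith)
  ultimately show ?thesis
    using IVT[of "ellF k" "-r" z r] ellF_cont[OF assms] by (auto simp: r_def)
qed

lemma ellF_am: "0 < k \<Longrightarrow> k < 1 \<Longrightarrow> ellF k (jacobi_am k z) = z"
  unfolding jacobi_am_def
  by (rule theI') (metis ellF_surj ellF_inj)

lemma am_ellF: "0 < k \<Longrightarrow> k < 1 \<Longrightarrow> jacobi_am k (ellF k \<phi>) = \<phi>"
  using ellF_am ellF_inj by blast

lemma am_has_derivative:
  assumes "0 < k" "k < 1"
  shows "(jacobi_am k has_real_derivative jacobi_dn k (jacobi_am k z)) (at z)"
proof -
  let ?p = "jacobi_am k z"
  have c: "isCont (jacobi_am k) (ellF k ?p)"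
    by (rule isCont_inverse_function[where d = 1])
      (auto simp: am_ellF[OF assms] ellF_cont[OF assms])
  have "(jacobi_am k has_real_derivative inverse (1 / jacobi_dn k ?p)) (at z)"
    using ellF_has_derivative[OF assms, of ?p] jacobi_dn_pos(1)[OF assms, of ?p] c
    by (intro DERIV_inverse_function[where f = "ellF k" and a = "z - 1" and b = "z + 1"])
      (auto simp: ellF_am[OF assms])
  then show ?thesis by simp
qed

lemma sn_has_derivative:
  assumes "0 < k" "k < 1"
  shows "(jacobi_sn k has_real_derivative jacobi_sn' k z) (at z)"
  unfolding jacobi_sn_def[abs_def] jacobi_sn'_def
  by (rule DERIV_chain2[OF DERIV_sin am_has_derivative[OF assms]])

text \<open>The second derivative of sn and, by \<open>sn'_squared\<close>, the square of the first
  are polynomials in sn. This is why the chain rule turns Lame's equation into one with polynomial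
  coefficients in t.\<close>

lemma sn'_has_derivative:
  assumes "0 < k" "k < 1"
  shows "(jacobi_sn' k has_real_derivative
           - (1 + k\<^sup>2) * jacobi_sn k z + 2 * k\<^sup>2 * jacobi_sn k z ^ 3) (at z)"
proof -
  let ?p = "jacobi_am k z"
  note pos = one_minus_k_sin_pos(1)[OF assms, of ?p]
  have s: "sqrt (1 - k\<^sup>2 * (sin ?p)\<^sup>2) * sqrt (1 - k\<^sup>2 * (sin ?p)\<^sup>2) = 1 - k\<^sup>2 * (sin ?p)\<^sup>2"
    using pos by simp
  have "((\<lambda>\<phi>. cos \<phi> * jacobi_dn k \<phi>) has_real_derivative
      - sin ?p * jacobi_dn k ?p - cos ?p * (k\<^sup>2 * sin ?p * cos ?p / jacobi_dn k ?p)) (at ?p)"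
    unfolding jacobi_dn_def using pos
    by (auto intro!: derivative_eq_intros simp: field_simps)
  from DERIV_chain2[OF this am_has_derivative[OF assms]]
  have "(jacobi_sn' k has_real_derivative
      (- sin ?p * jacobi_dn k ?p - cos ?p * (k\<^sup>2 * sin ?p * cos ?p / jacobi_dn k ?p)) * jacobi_dn k ?p) (at z)"
    unfolding jacobi_sn'_def[abs_def] .
  also have "(- sin ?p * jacobi_dn k ?p - cos ?p * (k\<^sup>2 * sin ?p * cos ?p / jacobi_dn k ?p)) * jacobi_dn k ?p
     = - sin ?p * (jacobi_dn k ?p * jacobi_dn k ?p) - k\<^sup>2 * sin ?p * (cos ?p)\<^sup>2"
    using jacobi_dn_pos(1)[OF assms, of ?p] by (simp add: field_simps power2_eq_square)
  also have "\<dots> = - (1 + k\<^sup>2) * sin ?p + 2 * k\<^sup>2 * sin ?p ^ 3"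
    unfolding jacobi_dn_def s cos_squared_eq by (simp add: algebra_simps power3_eq_cube power2_eq_square)
  finally show ?thesis by (simp add: jacobi_sn_def)
qed

lemma sn'_squared:
  assumes "0 < k" "k < 1"
  shows "(jacobi_sn' k z)\<^sup>2 = (1 - (jacobi_sn k z)\<^sup>2) * (1 - k\<^sup>2 * (jacobi_sn k z)\<^sup>2)"
  using one_minus_k_sin_pos(1)[OF assms, of "jacobi_am k z"]
  by (simp add: jacobi_sn'_def jacobi_dn_def jacobi_sn_def power_mult_distrib cos_squared_eq)

lemma abs_sn'_le_1:
  assumes "0 < k" "k < 1"
  shows "\<bar>jacobi_sn' k z\<bar> \<le> 1"
  using jacobi_dn_pos[OF assms, of "jacobi_am k z"] abs_cos_le_one[of "jacobi_am k z"]
  by (simp add: jacobi_sn'_def abs_mult mult_le_one)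

lemma ellF_minus:
  assumes "0 < k" "k < 1"
  shows "ellF k (- \<phi>) = - ellF k \<phi>"
proof -
  have "((\<lambda>u. ellF k (- u) + ellF k u) has_real_derivative 0) (at u)" for u
  proof -
    have "((\<lambda>u. ellF k (- u)) has_real_derivative (1 / jacobi_dn k (- u)) * (- 1)) (at u)"
      by (rule DERIV_chain2[OF ellF_has_derivative[OF assms]]) (auto intro!: derivative_eq_intros)
    from DERIV_add[OF this ellF_has_derivative[OF assms, of u]]
    show ?thesis by (simp add: jacobi_dn_def)
  qed
  from DERIV_isconst_all[of "\<lambda>u. ellF k (- u) + ellF k u", OF allI[OF this], of \<phi> 0] show ?thesis
    by (simp add: ellF_0)
qed

lemma am_minus: "0 < k \<Longrightarrow> k < 1 \<Longrightarrow> jacobi_am k (- z) = - jacobi_am k z"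
  by (metis am_ellF ellF_am ellF_minus)

lemma sn_minus: "0 < k \<Longrightarrow> k < 1 \<Longrightarrow> jacobi_sn k (- z) = - jacobi_sn k z"
  by (simp add: jacobi_sn_def am_minus)

lemma am_0: "0 < k \<Longrightarrow> k < 1 \<Longrightarrow> jacobi_am k 0 = 0"
  by (metis am_ellF ellF_0)

lemma sn_0: "0 < k \<Longrightarrow> k < 1 \<Longrightarrow> jacobi_sn k 0 = 0"
  by (simp add: jacobi_sn_def am_0)

lemma sn'_0: "0 < k \<Longrightarrow> k < 1 \<Longrightarrow> jacobi_sn' k 0 = 1"
  by (simp add: jacobi_sn'_def am_0 jacobi_dn_def)

lemma sn_ellK: "0 < k \<Longrightarrow> k < 1 \<Longrightarrow> jacobi_sn k (ellK k) = 1"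
  by (simp add: jacobi_sn_def ellK_def am_ellF)

lemma ellK_pos:
  assumes "0 < k" "k < 1" shows "0 < ellK k"
  using ellF_strict_mono[OF assms, of 0 "pi/2"] pi_gt_zero unfolding ellK_def ellF_0 by linarith

lemma sn_mono:
  assumes "0 < k" "k < 1" "0 \<le> a" "a \<le> b" "b \<le> ellK k"
  shows "jacobi_sn k a \<le> jacobi_sn k b"
proof -
  have mono: "jacobi_am k a \<le> jacobi_am k b" if "a \<le> b" for a b
    by (rule DERIV_nonneg_imp_nondecreasing[OF that])
      (use am_has_derivative[OF assms(1,2)] jacobi_dn_pos[OF assms(1,2)] less_imp_le in blast)
  have "0 \<le> jacobi_am k a" using mono[of 0 a] assms by (simp add: am_0)
  moreover have "jacobi_am k b \<le> pi/2" using mono[of b "ellK k"] assms by (simp add: ellK_def am_ellF)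
  ultimately show ?thesis
    unfolding jacobi_sn_def using mono[OF assms(4)] by (intro sin_monotone_2pi_le) auto
qed

section \<open>The recursion for the coefficients\<close>

definition even_poly :: "real poly \<Rightarrow> bool" where
  "even_poly p \<longleftrightarrow> (\<forall>t. poly p (- t) = poly p t)"

definition odd_poly :: "real poly \<Rightarrow> bool" where
  "odd_poly p \<longleftrightarrow> (\<forall>t. poly p (- t) = - poly p t)"

lemma real_poly_eqI: "(\<And>t. poly p t = poly q t) \<Longrightarrow> p = (q :: real poly)"
  using poly_eq_poly_eq_iff by blast

text \<open>The derivative of p(-t) is computed once by the chain rule and once from the parity of
  p.\<close>

lemma parity_pderiv:
  shows "even_poly p \<Longrightarrow> odd_poly (pderiv p)" "odd_poly p \<Longrightarrow> even_poly (pderiv p)"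
proof -
  have d: "((\<lambda>t. poly p (- t)) has_real_derivative - poly (pderiv p) (- t)) (at t)" for t
    using DERIV_chain'[of uminus "- 1" t UNIV "poly p" "poly (pderiv p) (- t)"] poly_DERIV[of p "- t"]
    by (auto intro!: derivative_eq_intros)
  { assume "even_poly p"
    then have "(\<lambda>t. poly p (- t)) = poly p" by (auto simp: even_poly_def)
    with d show "odd_poly (pderiv p)"
      unfolding odd_poly_def by (metis DERIV_unique poly_DERIV minus_minus) }
  { assume "odd_poly p"
    then have "(\<lambda>t. poly p (- t)) = (\<lambda>t. - poly p t)" by (auto simp: odd_poly_def)
    with d have "- poly (pderiv p) (- t) = - poly (pderiv p) t" for t
      by (metis DERIV_unique poly_DERIV DERIV_minus)
    then show "even_poly (pderiv p)" by (auto simp: even_poly_def) }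
qed

lemma parity_simps:
  "even_poly p \<Longrightarrow> even_poly q \<Longrightarrow> even_poly (p + q)"
  "odd_poly p \<Longrightarrow> odd_poly q \<Longrightarrow> odd_poly (p + q)"
  "even_poly p \<Longrightarrow> even_poly q \<Longrightarrow> even_poly (p - q)"
  "odd_poly p \<Longrightarrow> odd_poly q \<Longrightarrow> odd_poly (p - q)"
  "even_poly p \<Longrightarrow> even_poly (- p)" "odd_poly p \<Longrightarrow> odd_poly (- p)"
  "even_poly p \<Longrightarrow> even_poly (smult c p)" "odd_poly p \<Longrightarrow> odd_poly (smult c p)"
  "even_poly p \<Longrightarrow> even_poly q \<Longrightarrow> even_poly (p * q)"
  "even_poly p \<Longrightarrow> odd_poly q \<Longrightarrow> odd_poly (p * q)"
  "odd_poly p \<Longrightarrow> even_poly q \<Longrightarrow> odd_poly (p * q)"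
  "odd_poly p \<Longrightarrow> odd_poly q \<Longrightarrow> even_poly (p * q)"
  "even_poly 0" "odd_poly 0" "even_poly 1" "even_poly [:c:]" "odd_poly [:0, 1:]"
  by (auto simp: even_poly_def odd_poly_def)

lemma parity_sum:
  "(\<And>i. i \<in> S \<Longrightarrow> even_poly (f i)) \<Longrightarrow> even_poly (\<Sum>i\<in>S. f i)"
  "(\<And>i. i \<in> S \<Longrightarrow> odd_poly (f i)) \<Longrightarrow> odd_poly (\<Sum>i\<in>S. f i)"
  by (auto simp: even_poly_def odd_poly_def poly_sum sum_negf[symmetric])

lemma parity_monom:
  "even n \<Longrightarrow> even_poly (monom c n)" "odd n \<Longrightarrow> odd_poly (monom c n)"
  by (auto simp: even_poly_def odd_poly_def poly_monom)

lemma even_poly_coeff: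
  assumes "even_poly p" "odd n" shows "coeff p n = 0"
proof -
  have "pcompose p [:0, -1:] = p"
    using assms(1) by (intro real_poly_eqI) (simp add: poly_pcompose even_poly_def)
  then have "coeff p n = coeff (pcompose p [:0, -1:]) n" by simp
  also have "\<dots> = (- 1) ^ n * coeff p n"
    by (simp add: coeff_pcompose_linear)
  finally show ?thesis using assms(2) by simp
qed

lemma pderiv_sum: "pderiv (\<Sum>i\<in>S. f i) = (\<Sum>i\<in>S. pderiv (f i))"
  by (induction S rule: infinite_finite_induct) (simp_all add: pderiv_add)

lemma poly_antiderivative_exists:
  fixes p :: "real poly" shows "\<exists>q. pderiv q = p \<and> poly q 0 = 0"
proof -
  define r where "r = (\<Sum>i\<le>degree (p). monom (coeff (p) i / real (Suc i)) (Suc i))"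
  have "pderiv r = (\<Sum>i\<le>degree (p). monom (coeff (p) i) i)"
    unfolding r_def by (simp add: higher_pderiv_sum pderiv_sum pderiv_monom del: of_nat_Suc coeff_pCons_Suc)
  also have "\<dots> = p" by (rule poly_as_sum_of_monoms)
  finally show ?thesis by (intro exI[of _ r]) (simp add: r_def poly_sum poly_monom)
qed

definition ttilde_poly :: "nat \<Rightarrow> real poly" where
  "ttilde_poly m = [:- real m - 1 / 2, 0, 1 / 4:]"

lemma poly_ttilde: "poly (ttilde_poly m) t = ttilde m t"
  by (simp add: ttilde_poly_def ttilde_def power2_eq_square)

lemma even_ttilde: "even_poly (ttilde_poly m)"
  by (simp add: even_poly_def poly_ttilde ttilde_def)

text \<open>Eliminating \<open>A\<^sub>s\<close> between the two identities of order \<open>s\<close> leaves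
  \<open>elim_op m B\<^sub>s + \<mu>\<^sub>s\<close> on the left-hand side.\<close>

definition elim_op :: "nat \<Rightarrow> real poly \<Rightarrow> real poly" where
  "elim_op m B = smult (- 1/2) (pderiv (pderiv (pderiv B)))
     + 2 * ttilde_poly m * pderiv B + smult (1/2) ([:0, 1:] * B)"

lemma elim_op_add: "elim_op m (p + q) = elim_op m p + elim_op m q"
  by (simp add: elim_op_def pderiv_add smult_add_right algebra_simps)

lemma elim_op_smult: "elim_op m (smult c p) = smult c (elim_op m p)"
  unfolding elim_op_def
  by (rule real_poly_eqI) (simp add: pderiv_smult algebra_simps)

lemma elim_op_0: "elim_op m 0 = 0"
  by (simp add: elim_op_def)

text \<open>Only two terms raise the degree n of \<open>p\<close>: t^2 / 2 times the derivative
  contributes n / 2 and t / 2 times \<open>p\<close> contributes 1 / 2 of the leading coefficient.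
  The sum (n + 1) / 2 never vanishes, so the degree goes up by exactly one.\<close>

lemma coeff_elim_op:
  "coeff (elim_op m p) (Suc (degree p)) = (real (degree p) + 1) / 2 * lead_coeff p"
proof -
  let ?n = "degree p"
  have 1: "coeff (pderiv (pderiv (pderiv p))) (Suc ?n) = 0"
    by (intro coeff_eq_0) (simp add: degree_pderiv)
  have "2 * ttilde_poly m * pderiv p = pCons 0 (pCons 0 (smult (1/2) (pderiv p))) + smult (- 2 * real m - 1) (pderiv p)"
    by (rule real_poly_eqI) (simp add: poly_ttilde ttilde_def power2_eq_square algebra_simps)
  then have 2: "coeff (2 * ttilde_poly m * pderiv p) (Suc ?n) = real ?n / 2 * lead_coeff p"
    by (cases ?n) (auto simp: coeff_pderiv coeff_pCons coeff_eq_0 degree_pderiv split: nat.split)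
  have 3: "coeff ([:0, 1:] * p) (Suc ?n) = lead_coeff p" by simp
  show ?thesis unfolding elim_op_def coeff_add coeff_smult 1 2 3 by (simp add: algebra_simps)
qed

text \<open>A nonzero \<open>B\<close> would have an image of degree at least 1. Thus nonzero
  constants are missed by \<open>elim_op m\<close>, and this is what pins down \<mu> at each
  order.\<close>

lemma elim_op_const_imp_0:
  assumes "elim_op m B = [:c:]"
  shows "B = 0" "c = 0"
proof -
  have "(real (degree B) + 1) / 2 * lead_coeff B = 0"
    using coeff_elim_op[of m B] assms by simp
  then show "B = 0" by (simp add: add_nonneg_eq_0_iff)
  with assms show "c = 0" by (simp add: elim_op_0)
qed

text \<open>At \<open>i = 0\<close> the truncated exponent \<open>2 * i - 2\<close> does no harm,
  because its coefficient contains the factor \<open>real i\<close>.\<close>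

lemma elim_op_monom:
  "elim_op m (monom 1 (2 * i + 1)) = monom (real i + 1) (2 * i + 2)
     + monom (- (2 * real m + 1) * (2 * real i + 1)) (2 * i)
     + monom (- (2 * real i + 1) * real i * (2 * real i - 1)) (2 * i - 2)"
proof (cases i)
  case 0
  show ?thesis unfolding elim_op_def 0
    by (rule real_poly_eqI) (simp add: pderiv_monom poly_monom poly_ttilde ttilde_def power2_eq_square algebra_simps)
next
  case (Suc j)
  show ?thesis unfolding elim_op_def Suc
    by (rule real_poly_eqI) (simp add: pderiv_monom poly_monom poly_ttilde ttilde_def power2_eq_square field_simps)
qed

text \<open>A positive even power is the leading term of the image of an odd power, and the two
  lower terms are removed by induction. The power 0 is not reached; it goes into the free constant
  \<open>c\<close>, the source of -\<mu>.\<close>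

lemma elim_op_solvable_monom: "\<exists>B c. odd_poly B \<and> elim_op m B = monom a (2 * i) + [:c:]"
proof (induction i arbitrary: a rule: less_induct)
  case (less i)
  show ?case
  proof (cases i)
    case 0
    then show ?thesis
      by (intro exI[of _ 0] exI[of _ "- a"]) (auto simp: parity_simps elim_op_0 monom_0)
  next
    case (Suc j)
    \<comment> \<open>With \<open>i = Suc j\<close>, the image of t^(2j+1) has leading coefficient j
      + 1 = i.\<close>
    let ?c = "a / real i"
    define u where "u = ?c * (- (2 * real m + 1) * (2 * real j + 1))"
    define v where "v = ?c * (- (2 * real j + 1) * real j * (2 * real j - 1))"
    have "elim_op m (smult ?c (monom 1 (2 * j + 1))) = smult ?c (monom (real j + 1) (2 * j + 2)
        + monom (- (2 * real m + 1) * (2 * real j + 1)) (2 * j)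
        + monom (- (2 * real j + 1) * real j * (2 * real j - 1)) (2 * j - 2))"
      by (simp only: elim_op_smult elim_op_monom)
    also have "\<dots> = monom a (2 * i) + monom u (2 * j) + monom v (2 * (j - 1))"
      using Suc by (simp add: smult_add_right smult_monom u_def v_def diff_mult_distrib2 del: of_nat_Suc) (simp add: field_simps)
    finally have 1: "elim_op m (smult ?c (monom 1 (2 * j + 1))) = \<dots>" .
    obtain B1 c1 where 2: "odd_poly B1" "elim_op m B1 = monom (- u) (2 * j) + [:c1:]"
      using less.IH[of j "- u"] Suc by auto
    obtain B2 c2 where 3: "odd_poly B2" "elim_op m B2 = monom (- v) (2 * (j - 1)) + [:c2:]"
      using less.IH[of "j - 1" "- v"] Suc by (metis diff_le_self le_imp_less_Suc)
    have "elim_op m (smult ?c (monom 1 (2 * j + 1)) + B1 + B2) = monom a (2 * i) + [:c1 + c2:]"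
      unfolding elim_op_add 1 2 3 by (rule real_poly_eqI) (simp add: poly_monom)
    moreover have "odd_poly (smult ?c (monom 1 (2 * j + 1)) + B1 + B2)"
      by (intro parity_simps 2 3 parity_monom) simp
    ultimately show ?thesis by blast
  qed
qed

lemma elim_op_solvable:
  assumes "even_poly E"
  shows "\<exists>B c. odd_poly B \<and> elim_op m B = E + [:c:]"
proof -
  have *: "\<exists>B c. odd_poly B \<and> elim_op m B = (\<Sum>i<n. monom (coeff E i) i) + [:c:]" for n
  proof (induction n)
    case 0
    show ?case by (intro exI[of _ 0] exI[of _ "0"]) (auto simp: parity_simps elim_op_0)
  next
    case (Suc n)
    then obtain B c where 1: "odd_poly B" "elim_op m B = (\<Sum>i<n. monom (coeff E i) i) + [:c:]" by blast
    obtain B' c' where 2: "odd_poly B'" "elim_op m B' = monom (coeff E n) n + [:c':]"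
    proof (cases "even n")
      case True
      then show ?thesis using elim_op_solvable_monom[of m "coeff E n" "n div 2"] that by auto
    next
      case False
      then show ?thesis using elim_op_solvable_monom[of m 0 0] that even_poly_coeff[OF assms False] by auto
    qed
    have "elim_op m (B + B') = (\<Sum>i<Suc n. monom (coeff E i) i) + [:c + c':]"
      unfolding elim_op_add 1 2 by (rule real_poly_eqI) (simp add: poly_sum)
    then show ?case using parity_simps(2)[OF 1(1) 2(1)] by blast
  qed
  show ?thesis using *[of "Suc (degree E)"] poly_as_sum_of_monoms[of E] unfolding lessThan_Suc_atMost by simp
qed

section \<open>One order of the recursion\<close>

definition lower_terms1 where
  "lower_terms1 k m A B \<mu> s = 
     - smult ((1 + k\<^sup>2) / 2) ([:0, 1:] * (2 * [:0, 1:] * pderiv (prev_term A s 1) + prev_term A s 1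
         + [:0, 1:] * pderiv (pderiv (prev_term B s 1)) + pderiv (prev_term B s 1)
         + ttilde_poly m * [:0, 1:] * prev_term B s 1))
     + smult (k\<^sup>2 / 4) ([:0, 1:] ^ 3 * (2 * [:0, 1:] * pderiv (prev_term A s 2) + 2 * prev_term A s 2
         + [:0, 1:] * pderiv (pderiv (prev_term B s 2)) + 2 * pderiv (prev_term B s 2)
         + ttilde_poly m * [:0, 1:] * prev_term B s 2))
     + (\<Sum>j=1..<s. smult (\<mu> j) (B (s - j)))"

text \<open>In both collections of lower terms the \<mu>-sum stops before \<open>j = s\<close>. In
  the first identity that term is a multiple of \<open>B 0 = 0\<close>; in the second it is
  \<open>\<mu> s * A 0 = \<mu> s\<close>, the new unknown, which is kept apart.\<close>

definition lower_terms2 where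
  "lower_terms2 k m A B \<mu> s = 
     (\<Sum>j=1..<s. smult (\<mu> j) (A (s - j)))
     - smult ((1 + k\<^sup>2) / 2) ([:0, 1:] * ([:0, 1:] * pderiv (pderiv (prev_term A s 1)) + pderiv (prev_term A s 1)
         + smult (1/2) ([:0, 1:] ^ 2 * prev_term B s 1)
         + ttilde_poly m * ([:0, 1:] * prev_term A s 1 + 2 * [:0, 1:] * pderiv (prev_term B s 1) + prev_term B s 1)))
     + smult (k\<^sup>2 / 4) ([:0, 1:] ^ 3 * ([:0, 1:] * pderiv (pderiv (prev_term A s 2)) + 2 * pderiv (prev_term A s 2)
         + smult (1/2) ([:0, 1:] ^ 2 * prev_term B s 2)
         + ttilde_poly m * ([:0, 1:] * prev_term A s 2 + 2 * [:0, 1:] * pderiv (prev_term B s 2) + 2 * prev_term B s 2)))"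

lemma sum_1_split: "1 \<le> s \<Longrightarrow> (\<Sum>j=1..s. f j) = f s + (\<Sum>j=1..<s. f j)" for s :: nat and f :: "nat \<Rightarrow> real"
  using sum.last_plus[of 1 s f] by simp

lemma identity1_iff:
  assumes "s \<ge> 1" "B 0 = 0"
  shows "lame_identity1 k m A B \<mu> s \<longleftrightarrow> 2 * pderiv (A s) + pderiv (pderiv (B s)) + lower_terms1 k m A B \<mu> s = 0"
  unfolding poly_eq_poly_eq_iff[symmetric] fun_eq_iff lame_identity1_def lower_terms1_def Let_def sum_1_split[OF assms(1)]
  using assms by (simp add: poly_ttilde poly_sum algebra_simps)

lemma identity2_iff:
  assumes "s \<ge> 1" "A 0 = 1"
  shows "lame_identity2 k m A B \<mu> s \<longleftrightarrow>
    pderiv (pderiv (A s)) + 2 * ttilde_poly m * pderiv (B s) + smult (1/2) ([:0, 1:] * B s) + [:\<mu> s:] + lower_terms2 k m A B \<mu> s = 0"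
  unfolding poly_eq_poly_eq_iff[symmetric] fun_eq_iff lame_identity2_def lower_terms2_def Let_def sum_1_split[OF assms(1)]
  using assms by (simp add: poly_ttilde poly_sum algebra_simps)

lemma prev_term_parity:
  assumes "\<And>j. j < s \<Longrightarrow> even_poly (A j)" "\<And>j. j < s \<Longrightarrow> odd_poly (B j)" "i \<ge> 1" "s \<ge> 1"
  shows "even_poly (prev_term A s i)" "odd_poly (prev_term B s i)"
  using assms by (auto simp: prev_term_def parity_simps)

text \<open>The parities reproduce themselves from order to order; evenness of the right-hand side
  is what \<open>elim_op_solvable\<close> asks for.\<close>

lemma lower_terms_parity:
  assumes "\<And>j. j < s \<Longrightarrow> even_poly (A j)" "\<And>j. j < s \<Longrightarrow> odd_poly (B j)" "s \<ge> 1"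
  shows "odd_poly (lower_terms1 k m A B \<mu> s)" "even_poly (lower_terms2 k m A B \<mu> s)"
proof -
  note p = prev_term_parity[OF assms(1,2) _ assms(3)]
  have q: "odd_poly ([:0, 1:] ^ 3)" "even_poly ([:0, 1:] ^ 2)" "even_poly 2"
    by (auto simp: odd_poly_def even_poly_def)
  show "odd_poly (lower_terms1 k m A B \<mu> s)"
    unfolding lower_terms1_def mult.assoc
    by (rule parity_simps parity_sum parity_pderiv q p even_ttilde assms | simp)+
  show "even_poly (lower_terms2 k m A B \<mu> s)"
    unfolding lower_terms2_def mult.assoc
    by (rule parity_simps parity_sum parity_pderiv q p even_ttilde assms | simp)+
qed

text \<open>The first identity gives A' = -(B'' + F) / 2. Inserted into the second it leaves
  \<open>elim_op m B\<close> = F' / 2 - G - \<mu>, an even right-hand side up to a constant to be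
  chosen. A is then the antiderivative vanishing at 0, even because A' is odd.\<close>

lemma recursion_step_exists:
  assumes "odd_poly F" "even_poly G"
  shows "\<exists>A B \<mu>. even_poly A \<and> poly A 0 = 0 \<and> odd_poly B \<and> 2 * pderiv A + pderiv (pderiv B) + F = 0
    \<and> pderiv (pderiv A) + 2 * ttilde_poly m * pderiv B + smult (1/2) ([:0, 1:] * B) + [:\<mu>:] + G = 0"
proof -
  have "even_poly (smult (1/2) (pderiv F) - G)"
    by (intro parity_simps parity_pderiv assms)
  from elim_op_solvable[OF this] obtain B c where B: "odd_poly B" "elim_op m B = smult (1/2) (pderiv F) - G + [:c:]"
    by blast
  obtain A where A: "pderiv A = smult (- 1/2) (pderiv (pderiv B) + F)" "poly A 0 = 0"
    using poly_antiderivative_exists by blast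
  have odd: "odd_poly (pderiv A)"
    unfolding A by (intro parity_simps parity_pderiv B assms)
  have d: "((\<lambda>t. poly A (- t)) has_real_derivative - poly (pderiv A) (- t)) (at t)" for t
    using DERIV_chain'[of uminus "- 1" t UNIV "poly A" "poly (pderiv A) (- t)"] poly_DERIV[of A "- t"]
    by (auto intro!: derivative_eq_intros)
  have "((\<lambda>t. poly A (- t) - poly A t) has_real_derivative 0) (at t)" for t
    using DERIV_diff[OF d[of t] poly_DERIV[of A t]] odd by (simp add: odd_poly_def)
  then have "poly A (- t) - poly A t = poly A (- 0) - poly A 0" for t
    using DERIV_isconst_all[of "\<lambda>t. poly A (- t) - poly A t"] by blast
  then have "even_poly A" by (simp add: even_poly_def)
  moreover have "2 * pderiv A + pderiv (pderiv B) + F = 0"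
    unfolding A by (rule real_poly_eqI) (simp add: field_simps)
  moreover have "pderiv (pderiv A) + 2 * ttilde_poly m * pderiv B + smult (1/2) ([:0, 1:] * B) + [:- c:] + G = 0"
  proof -
    have "pderiv (pderiv A) + 2 * ttilde_poly m * pderiv B + smult (1/2) ([:0, 1:] * B) + [:- c:] + G
        = elim_op m B - (smult (1/2) (pderiv F) - G + [:c:])"
      unfolding A elim_op_def by (rule real_poly_eqI) (simp add: pderiv_smult pderiv_add pderiv_minus field_simps)
    then show ?thesis using B(2) by simp
  qed
  ultimately show ?thesis using A(2) B(1) by blast
qed

text \<open>F and G cancel in the difference of two solutions, so \<open>elim_op m\<close> maps B -
  B' to the constant \<mu>' - \<mu>. Both therefore vanish, and A is fixed by its derivative and its
  value at 0.\<close>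

lemma recursion_step_unique:
  assumes "2 * pderiv A + pderiv (pderiv B) + F = 0" "2 * pderiv A' + pderiv (pderiv B') + F = 0"
    "pderiv (pderiv A) + 2 * ttilde_poly m * pderiv B + smult (1/2) ([:0, 1:] * B) + [:\<mu>:] + G = 0"
    "pderiv (pderiv A') + 2 * ttilde_poly m * pderiv B' + smult (1/2) ([:0, 1:] * B') + [:\<mu>':] + G = 0"
    "poly A 0 = 0" "poly A' 0 = 0"
  shows "A = A' \<and> B = B' \<and> \<mu> = \<mu>'"
proof -
  have *: "pderiv A = smult (- 1/2) (pderiv (pderiv B) + F)" if "2 * pderiv A + pderiv (pderiv B) + F = 0" for A B
  proof (rule real_poly_eqI)
    fix t
    have "poly (2 * pderiv A + pderiv (pderiv B) + F) t = 0" using that by simp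
    then show "poly (pderiv A) t = poly (smult (- 1/2) (pderiv (pderiv B) + F)) t" by (simp add: field_simps)
  qed
  note e = *[OF assms(1)] *[OF assms(2)]
  have "elim_op m (B - B') = [:\<mu>' - \<mu>:]"
  proof (rule real_poly_eqI)
    fix t :: real
    have "poly (pderiv (pderiv A) + 2 * ttilde_poly m * pderiv B + smult (1/2) ([:0, 1:] * B) + [:\<mu>:] + G) t = 0"
      "poly (pderiv (pderiv A') + 2 * ttilde_poly m * pderiv B' + smult (1/2) ([:0, 1:] * B') + [:\<mu>':] + G) t = 0"
      using assms(3,4) by simp_all
    then show "poly (elim_op m (B - B')) t = poly [:\<mu>' - \<mu>:] t"
      unfolding e elim_op_def by (simp add: pderiv_smult pderiv_add pderiv_diff pderiv_minus field_simps)
  qed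
  from elim_op_const_imp_0[OF this] have "B = B'" "\<mu> = \<mu>'" by auto
  then have "pderiv (A - A') = 0" using e by (simp add: pderiv_diff)
  then obtain c where "A - A' = [:c:]" using pderiv_iszero by blast
  moreover have "poly (A - A') 0 = 0" using assms(5,6) by simp
  ultimately have "A = A'" by simp
  then show ?thesis using \<open>B = B'\<close> \<open>\<mu> = \<mu>'\<close> by simp
qed

lemma lower_terms_cong:
  assumes "\<And>j. j < s \<Longrightarrow> A j = A' j" "\<And>j. j < s \<Longrightarrow> B j = B' j" "\<And>j. 1 \<le> j \<Longrightarrow> j < s \<Longrightarrow> \<mu> j = \<mu>' j" "s \<ge> 1"
  shows "lower_terms1 k m A B \<mu> s = lower_terms1 k m A' B' \<mu>' s" "lower_terms2 k m A B \<mu> s = lower_terms2 k m A' B' \<mu>' s"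
proof -
  have "prev_term A s i = prev_term A' s i" "prev_term B s i = prev_term B' s i" if "i \<ge> 1" for i
    using assms that by (auto simp: prev_term_def)
  moreover have "(\<Sum>j=1..<s. smult (\<mu> j) (A (s - j))) = (\<Sum>j=1..<s. smult (\<mu>' j) (A' (s - j)))"
    "(\<Sum>j=1..<s. smult (\<mu> j) (B (s - j))) = (\<Sum>j=1..<s. smult (\<mu>' j) (B' (s - j)))"
    by (rule sum.cong; use assms in simp)+
  ultimately show "lower_terms1 k m A B \<mu> s = lower_terms1 k m A' B' \<mu>' s" "lower_terms2 k m A B \<mu> s = lower_terms2 k m A' B' \<mu>' s"
    by (simp_all add: lower_terms1_def lower_terms2_def)
qed

lemma lame_recursion_exists: "\<exists>A B \<mu>. lame_recursion k m A B \<mu>"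
proof -
  \<comment> \<open>\<open>P f s r\<close> says that the triple \<open>r\<close> of A, B and \<mu>
    is admissible at order \<open>s\<close> after the choices \<open>f\<close>. It looks at
    \<open>f\<close> only below \<open>s\<close>, as well-founded dependent choice requires, and
    carries the parities along as part of the induction.\<close>
  define P :: "(nat \<Rightarrow> real poly \<times> real poly \<times> real) \<Rightarrow> nat \<Rightarrow> real poly \<times> real poly \<times> real \<Rightarrow> bool"
    where "P f s r = (let A = fst \<circ> f; B = fst \<circ> snd \<circ> f; \<mu> = snd \<circ> snd \<circ> f; a = fst r; b = fst (snd r); c = snd (snd r) in
      even_poly a \<and> odd_poly b \<and> 
      (if s = 0 then a = 1 \<and> b = 0 else poly a 0 = 0 \<and> 2 * pderiv a + pderiv (pderiv b) + lower_terms1 k m A B \<mu> s = 0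
      \<and> pderiv (pderiv a) + 2 * ttilde_poly m * pderiv b + smult (1/2) ([:0, 1:] * b) + [:c:] + lower_terms2 k m A B \<mu> s = 0))" for f s r
  have "\<exists>f. \<forall>s. P f s (f s)"
  proof (rule dependent_wellorder_choice)
    fix r f g s
    assume fg: "\<And>y. y < s \<Longrightarrow> (f :: nat \<Rightarrow> real poly \<times> real poly \<times> real) y = g y"
    show "P f s r = P g s r"
    proof (cases "s = 0")
      case False
      then have "lower_terms1 k m (fst \<circ> f) (fst \<circ> snd \<circ> f) (snd \<circ> snd \<circ> f) s = lower_terms1 k m (fst \<circ> g) (fst \<circ> snd \<circ> g) (snd \<circ> snd \<circ> g) s"
        "lower_terms2 k m (fst \<circ> f) (fst \<circ> snd \<circ> f) (snd \<circ> snd \<circ> f) s = lower_terms2 k m (fst \<circ> g) (fst \<circ> snd \<circ> g) (snd \<circ> snd \<circ> g) s"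
        by (intro lower_terms_cong; use fg in simp)+
      then show ?thesis by (simp add: P_def Let_def)
    qed (simp add: P_def)
  next
    fix s f assume IH: "\<And>y. y < s \<Longrightarrow> P f y (f y)"
    show "\<exists>r. P f s r"
    proof (cases "s = 0")
      case True
      then show ?thesis by (intro exI[of _ "(1, 0, 0)"]) (simp add: P_def parity_simps)
    next
      case False
      have p: "even_poly ((fst \<circ> f) j)" "odd_poly ((fst \<circ> snd \<circ> f) j)" if "j < s" for j
        using IH[OF that] by (simp_all add: P_def Let_def)
      from False have s: "1 \<le> s" by simp
      have "odd_poly (lower_terms1 k m (fst \<circ> f) (fst \<circ> snd \<circ> f) (snd \<circ> snd \<circ> f) s)"
        "even_poly (lower_terms2 k m (fst \<circ> f) (fst \<circ> snd \<circ> f) (snd \<circ> snd \<circ> f) s)"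
        by (intro lower_terms_parity p s; assumption)+
      from recursion_step_exists[OF this, of m] obtain a b c where "even_poly a" "poly a 0 = 0" "odd_poly b"
          "2 * pderiv a + pderiv (pderiv b) + lower_terms1 k m (fst \<circ> f) (fst \<circ> snd \<circ> f) (snd \<circ> snd \<circ> f) s = 0"
          "pderiv (pderiv a) + 2 * ttilde_poly m * pderiv b + smult (1/2) ([:0, 1:] * b) + [:c:] 
            + lower_terms2 k m (fst \<circ> f) (fst \<circ> snd \<circ> f) (snd \<circ> snd \<circ> f) s = 0"
        by (elim exE conjE) (rule that)
      then show ?thesis using False by (intro exI[of _ "(a, b, c)"]) (simp add: P_def)
    qed
  qed
  then obtain f where f: "\<And>s. P f s (f s)" by blast
  define A where "A = fst \<circ> f" 
  define B where "B = fst \<circ> snd \<circ> f"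
  define \<mu> where "\<mu> = snd \<circ> snd \<circ> f"
  have 0: "A 0 = 1" "B 0 = 0" using f[of 0] by (simp_all add: P_def Let_def A_def B_def)
  have "even_poly (A s)" "odd_poly (B s)" "poly (A s) 0 = 0" "lame_identity1 k m A B \<mu> s" "lame_identity2 k m A B \<mu> s" if "s \<ge> 1" for s
    unfolding identity1_iff[of _ B, OF that 0(2)] identity2_iff[of _ A, OF that 0(1)]
    using f[of s] that by (simp_all add: P_def Let_def A_def B_def \<mu>_def)
  then have "lame_recursion k m A B \<mu>"
    using 0 by (simp add: lame_recursion_def even_poly_def odd_poly_def)
  then show ?thesis by blast
qed

lemma lame_recursion_unique:
  assumes "lame_recursion k m A B \<mu>" "lame_recursion k m A' B' \<mu>'"
  shows "A s = A' s \<and> B s = B' s \<and> (s \<ge> 1 \<longrightarrow> \<mu> s = \<mu>' s)"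
proof (induction s rule: less_induct)
  case (less s)
  show ?case
  proof (cases "s = 0")
    case True
    then show ?thesis using assms by (simp add: lame_recursion_def)
  next
    case False
    then have s: "s \<ge> 1" by simp
    have 0: "B 0 = 0" "A 0 = 1" "B' 0 = 0" "A' 0 = 1" using assms by (simp_all add: lame_recursion_def)
    have c: "lower_terms1 k m A B \<mu> s = lower_terms1 k m A' B' \<mu>' s" "lower_terms2 k m A B \<mu> s = lower_terms2 k m A' B' \<mu>' s"
      using less s by (auto intro!: lower_terms_cong)
    have "lame_identity1 k m A B \<mu> s" "lame_identity1 k m A' B' \<mu>' s" 
      "lame_identity2 k m A B \<mu> s" "lame_identity2 k m A' B' \<mu>' s" 
      and z: "poly (A s) 0 = 0" "poly (A' s) 0 = 0"
      using assms s by (simp_all add: lame_recursion_def)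
    then show ?thesis
      using recursion_step_unique[of "A s" "B s" "lower_terms1 k m A B \<mu> s" "A' s" "B' s" m "\<mu> s" "lower_terms2 k m A B \<mu> s" "\<mu>' s"]
      unfolding identity1_iff[of _ B, OF s 0(1)] identity1_iff[of _ B', OF s 0(3)] identity2_iff[of _ A, OF s 0(2)] identity2_iff[of _ A', OF s 0(4)] c[symmetric]
      by blast
  qed
qed

lemma lame_mu_eq:
  assumes "lame_recursion k m A B \<mu>" "s \<ge> 1"
  shows "lame_mu k m s = \<mu> s"
  unfolding lame_mu_def
proof (rule the_equality)
  show "\<exists>A B \<mu>'. lame_recursion k m A B \<mu>' \<and> \<mu>' s = \<mu> s" using assms(1) by blast
  show "c = \<mu> s" if "\<exists>A B \<mu>'. lame_recursion k m A B \<mu>' \<and> \<mu>' s = c" for c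
    using that lame_recursion_unique[OF assms(1)] assms(2) by metis
qed

text \<open>It suffices to exhibit one solution at orders 1 and 2, since
  \<open>recursion_step_unique\<close> identifies it with the solution given. Everything is written
  in N = 2m + 1, because \<open>ttilde\<close> is t^2 / 4 - N / 2.\<close>

lemma lame_mu_1_2:
  defines "M \<equiv> \<lambda>m. 2 * real m + 1"
  shows "lame_mu k m 1 = - (1 + k\<^sup>2) * (1 + (M m)\<^sup>2) / 16"
    "lame_mu k m 2 = M m * k\<^sup>2 / 16 - M m * ((M m)\<^sup>2 + 3) * (1 - k\<^sup>2)\<^sup>2 / 128"
proof -
  obtain A B \<mu> where r: "lame_recursion k m A B \<mu>" using lame_recursion_exists by blast
  have 0: "A 0 = 1" "B 0 = 0" and z: "\<And>s. s \<ge> 1 \<Longrightarrow> poly (A s) 0 = 0" 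
    and i1: "\<And>s. s \<ge> 1 \<Longrightarrow> lame_identity1 k m A B \<mu> s" and i2: "\<And>s. s \<ge> 1 \<Longrightarrow> lame_identity2 k m A B \<mu> s" 
    using r by (auto simp: lame_recursion_def)
  have e: "2 * pderiv (A s) + pderiv (pderiv (B s)) + lower_terms1 k m A B \<mu> s = 0"
    "pderiv (pderiv (A s)) + 2 * ttilde_poly m * pderiv (B s) + smult (1/2) ([:0, 1:] * B s) + [:\<mu> s:] + lower_terms2 k m A B \<mu> s = 0"
    if "s \<ge> 1" for s
    using i1[OF that] i2[OF that] unfolding identity1_iff[of _ B, OF that 0(2)] identity2_iff[of _ A, OF that 0(1)] by auto
  define c where "c = 1 + k\<^sup>2"
  define N where "N = M m"
  have tt: "ttilde_poly m = [:- N / 2, 0, 1/4:]" by (simp add: ttilde_poly_def N_def M_def)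
  (* The coefficients of B are solved for from the top degree downwards. *)
  define A1 where "A1 = [:0, 0, c / 32:]"
  define B1 where "B1 = [:0, - c * N / 16, 0, c / 16:]"
  define \<mu>1 where "\<mu>1 = - c * (1 + N\<^sup>2) / 16"
  have "A 1 = A1 \<and> B 1 = B1 \<and> \<mu> 1 = \<mu>1"
  proof (rule recursion_step_unique[OF e(1)[OF order.refl] _ e(2)[OF order.refl]])
    show "2 * pderiv A1 + pderiv (pderiv B1) + lower_terms1 k m A B \<mu> 1 = 0"
      by (rule real_poly_eqI) (simp add: A1_def B1_def lower_terms1_def prev_term_def 0 tt pderiv_pCons field_simps c_def)
    show "pderiv (pderiv A1) + 2 * ttilde_poly m * pderiv B1 + smult (1/2) ([:0, 1:] * B1) + [:\<mu>1:] + lower_terms2 k m A B \<mu> 1 = 0"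
      by (simp add: A1_def B1_def \<mu>1_def lower_terms2_def prev_term_def 0 tt pderiv_pCons field_simps c_def numeral_poly power2_eq_square)
  qed (use z in \<open>auto simp: A1_def\<close>)
  then have 1: "A 1 = A1" "B 1 = B1" "\<mu> 1 = \<mu>1" by auto
  show "lame_mu k m 1 = - (1 + k\<^sup>2) * (1 + (M m)\<^sup>2) / 16"
    using lame_mu_eq[OF r order.refl] 1 by (simp add: \<mu>1_def c_def N_def)
  define q where "q = k\<^sup>2"
  \<comment> \<open>\<open>A2\<close> comes from \<open>B2\<close> by integrating the first identity
    from 0; \<open>\<mu>2\<close> is what then remains of the second identity at t = 0.\<close>
  define A2 where "A2 = [:0, 0, (3 - 2 * q + 3 * q\<^sup>2) * N / 512 - c\<^sup>2 * N ^ 3 / 1024, 0,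
     (39 + 14 * q + 39 * q\<^sup>2) / 6144 + 5 * c\<^sup>2 * N\<^sup>2 / 2048, 0, - c\<^sup>2 * N / 512, 0, c\<^sup>2 / 2048:]"
  define B2 where "B2 = [:0, (- 3 + 26 * q - 3 * q\<^sup>2) / 256 + (- 5 + 6 * q - 5 * q\<^sup>2) * N\<^sup>2 / 512, 0,
     - (15 + 14 * q + 15 * q\<^sup>2) * N / 1536, 0, (3 + 2 * q + 3 * q\<^sup>2) / 192:]"
  define \<mu>2 where "\<mu>2 = N * q / 16 - N * (N\<^sup>2 + 3) * (1 - q)\<^sup>2 / 128"
  have p: "prev_term X 2 1 = X 1" "prev_term X 2 2 = X 0" for X :: "nat \<Rightarrow> real poly"
    by (simp_all add: prev_term_def)
  have sm: "(\<Sum>j=1..<2::nat. f j) = (f 1 :: real poly)" for f by (simp add: numeral_2_eq_2)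
  have cq: "c = 1 + q" by (simp add: c_def q_def)
  have d21: "2 - 1 = (1 :: nat)" by simp
  have "A 2 = A2 \<and> B 2 = B2 \<and> \<mu> 2 = \<mu>2"
  proof (rule recursion_step_unique[OF e(1) _ e(2)])
    show "2 * pderiv A2 + pderiv (pderiv B2) + lower_terms1 k m A B \<mu> 2 = 0"
      unfolding lower_terms1_def p sm d21 0 1 q_def[symmetric]
      by (rule real_poly_eqI)
       (simp add: A1_def B1_def \<mu>1_def A2_def B2_def tt pderiv_pCons field_simps cq power2_eq_square power3_eq_cube)
    show "pderiv (pderiv A2) + 2 * ttilde_poly m * pderiv B2 + smult (1/2) ([:0, 1:] * B2) + [:\<mu>2:] + lower_terms2 k m A B \<mu> 2 = 0"
      unfolding lower_terms2_def p sm d21 0 1 q_def[symmetric]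
      by (rule real_poly_eqI)
       (simp add: A1_def B1_def \<mu>1_def A2_def B2_def \<mu>2_def tt pderiv_pCons field_simps cq power2_eq_square power3_eq_cube)
  qed (use z in \<open>auto simp: A2_def\<close>)
  then show "lame_mu k m 2 = M m * k\<^sup>2 / 16 - M m * ((M m)\<^sup>2 + 3) * (1 - k\<^sup>2)\<^sup>2 / 128"
    using lame_mu_eq[OF r, of 2] by (simp add: \<mu>2_def N_def q_def)
qed

section \<open>Linear second-order equations\<close>

lemma ex_antiderivative:
  fixes f :: "real \<Rightarrow> real"
  assumes "\<And>x. isCont f x"
  shows "\<exists>F. F 0 = c \<and> (\<forall>x. (F has_real_derivative f x) (at x))"
proof -
  obtain F where F: "\<And>x. (F has_vector_derivative f x) (at x)"
    using einterval_antiderivative[of "-\<infinity>" \<infinity> f] assms by auto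
  have "((\<lambda>x. F x - F 0 + c) has_real_derivative f x) (at x)" for x
    using F[of x] by (auto simp: has_real_derivative_iff_has_vector_derivative intro!: derivative_eq_intros)
  then show ?thesis by (intro exI[of _ "\<lambda>x. F x - F 0 + c"]) auto
qed

definition primitive :: "(real \<Rightarrow> real) \<Rightarrow> real \<Rightarrow> real" where
  "primitive f = (SOME F. F 0 = 0 \<and> (\<forall>x. (F has_real_derivative f x) (at x)))"

lemma primitive:
  assumes "\<And>x. isCont f x"
  shows "primitive f 0 = 0" "(primitive f has_real_derivative f x) (at x)"
  using someI_ex[OF ex_antiderivative[OF assms, of 0]] by (auto simp: primitive_def)

text \<open>On the positive side, C u^(n+1) / (n + 1) plus or minus the primitive has a nonnegative
  derivative; the negative side follows by reflection. Iterating this bound produces the factorials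
  that make the Picard series converge.\<close>

lemma primitive_bound:
  assumes c: "\<And>x. isCont f x" and b: "\<And>x. \<bar>x\<bar> \<le> X \<Longrightarrow> \<bar>f x\<bar> \<le> C * \<bar>x\<bar> ^ n" and x: "\<bar>x\<bar> \<le> X"
  shows "\<bar>primitive f x\<bar> \<le> C * \<bar>x\<bar> ^ Suc n / real (Suc n)"
proof -
  have pos: "\<bar>F x\<bar> \<le> C * x ^ Suc n / real (Suc n)"
    if "0 \<le> x" "x \<le> X" "F 0 = 0" and F: "\<And>u. 0 \<le> u \<Longrightarrow> u \<le> X \<Longrightarrow> (F has_real_derivative g u) (at u)"
      and g: "\<And>u. 0 \<le> u \<Longrightarrow> u \<le> X \<Longrightarrow> \<bar>g u\<bar> \<le> C * u ^ n" for F g :: "real \<Rightarrow> real" and x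
  proof -
    have P: "((\<lambda>u. C * u ^ Suc n / real (Suc n)) has_real_derivative C * u ^ n) (at u)" for u
      using DERIV_cdivide[OF DERIV_cmult[OF DERIV_pow[of "Suc n" u UNIV]], of C "real (Suc n)"] by simp
    have "C * 0 ^ Suc n / real (Suc n) - F 0 \<le> C * x ^ Suc n / real (Suc n) - F x"
    proof (rule DERIV_nonneg_imp_nondecreasing[OF that(1)])
      fix u assume "0 \<le> u" "u \<le> x"
      then show "\<exists>y. ((\<lambda>a. C * a ^ Suc n / real (Suc n) - F a) has_real_derivative y) (at u) \<and> 0 \<le> y"
        using DERIV_diff[OF P F, of u] g[of u] that(2) by (intro exI[of _ "C * u ^ n - g u"]) auto
    qed
    moreover have "C * 0 ^ Suc n / real (Suc n) + F 0 \<le> C * x ^ Suc n / real (Suc n) + F x"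
    proof (rule DERIV_nonneg_imp_nondecreasing[OF that(1)])
      fix u assume "0 \<le> u" "u \<le> x"
      then show "\<exists>y. ((\<lambda>a. C * a ^ Suc n / real (Suc n) + F a) has_real_derivative y) (at u) \<and> 0 \<le> y"
        using DERIV_add[OF P F, of u] g[of u] that(2) by (intro exI[of _ "C * u ^ n + g u"]) auto
    qed
    ultimately show ?thesis using that(3) by auto
  qed
  show ?thesis
  proof (cases "0 \<le> x")
    case True
    have "\<bar>f u\<bar> \<le> C * u ^ n" if "0 \<le> u" "u \<le> X" for u using b[of u] that by simp
    then show ?thesis using pos[of x "primitive f" f, OF True _ primitive(1)[OF c] primitive(2)[OF c]] x True by simp
  next
    case False
    have "((\<lambda>u. primitive f (- u)) has_real_derivative f (- u) * (- 1)) (at u)" for u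
      by (rule DERIV_chain2[OF primitive(2)[OF c]]) (auto intro!: derivative_eq_intros)
    moreover have "\<bar>f (- u)\<bar> \<le> C * u ^ n" if "0 \<le> u" "u \<le> X" for u using b[of "- u"] that by simp
    ultimately show ?thesis
      using pos[of "- x" "\<lambda>u. primitive f (- u)" "\<lambda>u. - f (- u)"] x primitive(1)[OF c] False by simp
  qed
qed

context
  fixes p :: "real \<Rightarrow> real" and a b :: real
  assumes p_cont: "\<And>x. isCont p x"
begin

text \<open>For the system y' = v, v' = p y these are not the Picard iterates but their increments;
  the solution is their sum over \<open>n\<close>.\<close>

fun picard :: "nat \<Rightarrow> (real \<Rightarrow> real) \<times> (real \<Rightarrow> real)" where
  "picard 0 = ((\<lambda>_. a), (\<lambda>_. b))"
| "picard (Suc n) = (primitive (snd (picard n)), primitive (\<lambda>x. p x * fst (picard n) x))"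

lemma picard_cont: "isCont (fst (picard n)) x" "isCont (snd (picard n)) x"
proof (induction n arbitrary: x)
  case (Suc n)
  { case 1 show ?case using DERIV_isCont[OF primitive(2)[of "snd (picard n)" x]] Suc by simp }
  { case 2 show ?case using DERIV_isCont[OF primitive(2)[of "\<lambda>x. p x * fst (picard n) x" x]] Suc p_cont
      by (simp add: isCont_mult) }
qed auto

lemma picard_Suc_deriv:
  "(fst (picard (Suc n)) has_real_derivative snd (picard n) x) (at x)"
  "(snd (picard (Suc n)) has_real_derivative p x * fst (picard n) x) (at x)"
  using primitive(2)[of "snd (picard n)" x] primitive(2)[of "\<lambda>x. p x * fst (picard n) x" x]
  by (auto intro!: isCont_mult simp: picard_cont p_cont)

text \<open>Requiring \<open>1 \<le> M\<close> lets one constant dominate both coefficients of the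
  system, 1 and p, so that the two components share a bound.\<close>

lemma picard_bound:
  assumes M: "\<And>x. \<bar>x\<bar> \<le> X \<Longrightarrow> \<bar>p x\<bar> \<le> M" "1 \<le> M" and x: "\<bar>x\<bar> \<le> X"
  shows "\<bar>fst (picard n) x\<bar> \<le> (\<bar>a\<bar> + \<bar>b\<bar>) * M ^ n / fact n * \<bar>x\<bar> ^ n"
    "\<bar>snd (picard n) x\<bar> \<le> (\<bar>a\<bar> + \<bar>b\<bar>) * M ^ n / fact n * \<bar>x\<bar> ^ n"
  using x
proof (induction n arbitrary: x)
  case (Suc n)
  let ?C = "(\<bar>a\<bar> + \<bar>b\<bar>) * M ^ n / fact n"
  have C: "0 \<le> ?C" using M(2) by simp
  have *: "M * ?C * \<bar>x\<bar> ^ Suc n / real (Suc n) = (\<bar>a\<bar> + \<bar>b\<bar>) * M ^ Suc n / fact (Suc n) * \<bar>x\<bar> ^ Suc n" for x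
    by (simp add: field_simps)
  { case 1
    have "\<bar>snd (picard n) u\<bar> \<le> M * ?C * \<bar>u\<bar> ^ n" if "\<bar>u\<bar> \<le> X" for u
      using Suc.IH(2)[OF that] mult_right_mono[OF M(2), of "?C * \<bar>u\<bar> ^ n"] mult_nonneg_nonneg[OF C, of "\<bar>u\<bar> ^ n"]
      unfolding mult.assoc[of M] by linarith
    then show ?case unfolding *[symmetric] picard.simps fst_conv
      by (intro primitive_bound[where X = X] picard_cont 1) }
  { case 2
    have "\<bar>p u * fst (picard n) u\<bar> \<le> M * ?C * \<bar>u\<bar> ^ n" if "\<bar>u\<bar> \<le> X" for u
      unfolding abs_mult mult.assoc
      by (rule mult_mono[OF M(1)[OF that] Suc.IH(1)[OF that]]) (use M(2) in auto)
    then show ?case unfolding *[symmetric] picard.simps snd_conv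
      by (intro primitive_bound[where X = X] isCont_mult p_cont picard_cont 2) }
qed auto

text \<open>On each bounded interval both series and their derivative series are dominated by an
  exponential series, so they may be differentiated term by term.\<close>

lemma linear_ode_exists:
  "\<exists>y v. (\<forall>x. (y has_real_derivative v x) (at x)) \<and> (\<forall>x. (v has_real_derivative p x * y x) (at x))
     \<and> y 0 = a \<and> v 0 = b"
proof -
  let ?y = "\<lambda>n. fst (picard n)" and ?v = "\<lambda>n. snd (picard n)"
  let ?Y = "\<lambda>x. \<Sum>n. ?y n x" and ?V = "\<lambda>x. \<Sum>n. ?v n x"
  have z: "?y (Suc n) 0 = 0" "?v (Suc n) 0 = 0" for n
    using primitive(1)[of "?v n"] primitive(1)[of "\<lambda>x. p x * ?y n x"]
    by (auto intro!: isCont_mult simp: picard_cont p_cont)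
  have y0: "(\<lambda>n. ?y n 0) sums a" "(\<lambda>n. ?v n 0) sums b"
    using sums_Suc_iff[of "\<lambda>n. ?y n 0" 0] sums_Suc_iff[of "\<lambda>n. ?v n 0" 0]
    by (simp_all only: z sums_zero picard.simps(1)) simp_all
  \<comment> \<open>The increment of index n + 1 has the n-th increment of the other component as
    its derivative, up to the factor p. The derivative series are thus the original ones shifted by
    one place behind a leading zero.\<close>
  define y' where "y' n = (case n of 0 \<Rightarrow> (\<lambda>_. 0) | Suc n \<Rightarrow> ?v n)" for n
  define v' where "v' n = (case n of 0 \<Rightarrow> (\<lambda>_. 0) | Suc n \<Rightarrow> (\<lambda>x. p x * ?y n x))" for n
  have d: "(?y n has_real_derivative y' n x) (at x within S)" "(?v n has_real_derivative v' n x) (at x within S)" for n x S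
    by (cases n; use picard_Suc_deriv in \<open>auto simp: y'_def v'_def simp del: picard.simps(2) intro: has_field_derivative_at_within\<close>)+
  have main: "(?Y has_real_derivative ?V x) (at x)" "(?V has_real_derivative p x * ?Y x) (at x)" for x
  proof -
    define X where "X = \<bar>x\<bar> + 1"
    have "compact (p ` {-X..X})" 
      by (intro compact_continuous_image continuous_at_imp_continuous_on) (auto simp: p_cont)
    then obtain M0 where M0: "\<And>x. x \<in> {-X..X} \<Longrightarrow> \<bar>p x\<bar> \<le> M0"
      using compact_imp_bounded bounded_iff by (metis image_eqI real_norm_def)
    define M where "M = max 1 M0"
    have M: "\<And>x. \<bar>x\<bar> \<le> X \<Longrightarrow> \<bar>p x\<bar> \<le> M" "1 \<le> M" 
      using M0 by (auto simp: M_def abs_le_iff le_max_iff_disj)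
    define B where "B n = (\<bar>a\<bar> + \<bar>b\<bar>) * ((M * X) ^ n / fact n)" for n
    have X: "0 \<le> X" by (simp add: X_def)
    have sB: "summable B"
      unfolding B_def using summable_exp_generic[of "M * X"] by (intro summable_mult) (simp add: divide_inverse mult.commute)
    have Bb: "\<bar>?y n u\<bar> \<le> B n" "\<bar>?v n u\<bar> \<le> B n" if "u \<in> {-X..X}" for n u
    proof -
      have u: "\<bar>u\<bar> \<le> X" using that by auto
      have "(\<bar>a\<bar> + \<bar>b\<bar>) * M ^ n / fact n * \<bar>u\<bar> ^ n \<le> (\<bar>a\<bar> + \<bar>b\<bar>) * M ^ n / fact n * X ^ n"
        by (intro mult_left_mono power_mono u) (use M in auto)
      also have "\<dots> = B n" by (simp add: B_def power_mult_distrib)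
      finally show "\<bar>?y n u\<bar> \<le> B n" "\<bar>?v n u\<bar> \<le> B n"
        using picard_bound[OF M u, of n] by auto
    qed
    define B' where "B' n = (case n of 0 \<Rightarrow> 0 | Suc n \<Rightarrow> M * B n)" for n
    have sB': "summable B'"
      unfolding B'_def by (subst summable_Suc_iff[symmetric]) (simp add: sB summable_mult)
    have "M * B n \<ge> 0" for n using M(2) X by (simp add: B_def)
    have b': "norm (y' n u) \<le> B' n" "norm (v' n u) \<le> B' n" if "u \<in> {-X..X}" for n u
    proof -
      have "\<bar>?v i u\<bar> \<le> M * B i" "\<bar>p u * ?y i u\<bar> \<le> M * B i" for i
      proof -
        have "0 \<le> B i" using X M(2) by (simp add: B_def)
        then show "\<bar>?v i u\<bar> \<le> M * B i"
          using Bb(2)[OF that, of i] mult_right_mono[OF M(2), of "B i"] by simp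
        show "\<bar>p u * ?y i u\<bar> \<le> M * B i"
          unfolding abs_mult using that M(2) by (intro mult_mono M(1) Bb(1)) auto
      qed
      then show "norm (y' n u) \<le> B' n" "norm (v' n u) \<le> B' n"
        by (auto simp: y'_def v'_def B'_def split: nat.split)
    qed
    have x: "x \<in> interior {-X..X}" by (auto simp: X_def interior_atLeastAtMost_real)
    have S: "x \<in> {-X..X}" "0 \<in> {-X..X}" "convex {-X..X}" by (auto simp: X_def)
    have u: "uniformly_convergent_on {-X..X} (\<lambda>n x. \<Sum>i<n. y' i x)"
       "uniformly_convergent_on {-X..X} (\<lambda>n x. \<Sum>i<n. v' i x)"
      using Weierstrass_m_test'[OF _ sB', of "{-X..X}"] b' by blast+
    have sy: "summable (\<lambda>n. ?y n x)" "summable (\<lambda>n. ?v n x)"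
      by (rule summable_comparison_test'[OF sB, of 0], use Bb[OF S(1)] in simp)+
    have "(\<lambda>n. y' (Suc n) x) sums ?V x" using sy(2) by (simp add: y'_def summable_sums)
    then have Y: "(\<Sum>n. y' n x) = ?V x" 
      using sums_Suc_iff[of "\<lambda>n. y' n x" "?V x"] by (simp add: sums_iff y'_def)
    have "(\<lambda>n. v' (Suc n) x) sums (p x * ?Y x)" using sy(1) by (simp add: v'_def summable_sums sums_mult)
    then have V: "(\<Sum>n. v' n x) = p x * ?Y x" 
      using sums_Suc_iff[of "\<lambda>n. v' n x" "p x * ?Y x"] by (simp add: sums_iff v'_def)
    show "(?Y has_real_derivative ?V x) (at x)"
      using has_field_derivative_series'(2)[OF S(3) d(1) u(1) S(2) sums_summable[OF y0(1)] x] by (simp only: Y)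
    show "(?V has_real_derivative p x * ?Y x) (at x)"
      using has_field_derivative_series'(2)[OF S(3) d(2) u(2) S(2) sums_summable[OF y0(2)] x] by (simp only: V)
  qed
  show ?thesis using main y0 by (intro exI[of _ ?Y] exI[of _ ?V]) (auto simp: sums_iff)
qed

end

text \<open>The energy d^2 + e^2 + \<rho>^2, damped by exp (- (M + 2) (x - a)), does not increase.
  Keeping \<rho>^2 inside the energy absorbs the forcing through 2 e r \<le> e^2 + \<rho>^2. Of the
  rate M + 2, the term 2 d e uses 1, the coefficient p uses M and the forcing uses 1.\<close>

lemma gronwall_second_order:
  fixes d e p r :: "real \<Rightarrow> real"
  assumes "\<And>x. a \<le> x \<Longrightarrow> x \<le> b \<Longrightarrow> (d has_real_derivative e x) (at x)"
    and "\<And>x. a \<le> x \<Longrightarrow> x \<le> b \<Longrightarrow> (e has_real_derivative p x * d x + r x) (at x)"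
    and "\<And>x. a \<le> x \<Longrightarrow> x \<le> b \<Longrightarrow> \<bar>p x\<bar> \<le> M"
    and "\<And>x. a \<le> x \<Longrightarrow> x \<le> b \<Longrightarrow> \<bar>r x\<bar> \<le> \<rho>"
    and x: "a \<le> x" "x \<le> b"
  shows "(d x)\<^sup>2 + (e x)\<^sup>2 \<le> ((d a)\<^sup>2 + (e a)\<^sup>2 + \<rho>\<^sup>2) * exp ((M + 2) * (x - a))"
proof -
  let ?E = "\<lambda>x. ((d x)\<^sup>2 + (e x)\<^sup>2 + \<rho>\<^sup>2) * exp (- (M + 2) * (x - a))"
  have "?E x \<le> ?E a"
  proof (rule DERIV_nonpos_imp_nonincreasing[OF x(1)])
    fix u assume u: "a \<le> u" "u \<le> x"
    then have u': "u \<le> b" using x by simp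
    let ?y = "(2 * d u * e u + 2 * e u * (p u * d u + r u)) * exp (- (M + 2) * (u - a))
       + ((d u)\<^sup>2 + (e u)\<^sup>2 + \<rho>\<^sup>2) * (exp (- (M + 2) * (u - a)) * (- (M + 2)))"
    have "(?E has_real_derivative ?y) (at u)"
      by (rule derivative_eq_intros assms(1)[OF u(1) u'] assms(2)[OF u(1) u'] refl | simp)+
    moreover have "?y \<le> 0"
    proof -
      have am: "2 * s * t \<le> s\<^sup>2 + t\<^sup>2" for s t :: real
        using sum_squares_bound[of s t] by simp
      have 1: "2 * d u * e u \<le> (d u)\<^sup>2 + (e u)\<^sup>2" by (rule am)
      have M: "0 \<le> M" using assms(3)[OF u(1) u'] by linarith
      have "p u * (2 * d u * e u) \<le> \<bar>p u\<bar> * \<bar>2 * d u * e u\<bar>"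
        unfolding abs_mult[symmetric] by (rule abs_ge_self)
      also have "\<dots> \<le> M * ((d u)\<^sup>2 + (e u)\<^sup>2)"
        using assms(3)[OF u(1) u'] am[of "d u" "e u"] am[of "- d u" "e u"] M
        by (intro mult_mono) (auto simp: abs_le_iff)
      finally have 2: "p u * (2 * d u * e u) \<le> M * ((d u)\<^sup>2 + (e u)\<^sup>2)" .
      have "2 * e u * r u \<le> (e u)\<^sup>2 + (r u)\<^sup>2" by (rule am)
      moreover have "(r u)\<^sup>2 \<le> \<rho>\<^sup>2"
        using assms(4)[OF u(1) u'] by (simp add: abs_le_square_iff[symmetric])
      ultimately have 3: "2 * e u * r u \<le> (e u)\<^sup>2 + \<rho>\<^sup>2" by linarith
      have "0 \<le> M * \<rho>\<^sup>2" using M by simp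
      then have "2 * d u * e u + 2 * e u * (p u * d u + r u) - (M + 2) * ((d u)\<^sup>2 + (e u)\<^sup>2 + \<rho>\<^sup>2) \<le> 0"
        using 1 2 3 zero_le_power2[of "d u"] zero_le_power2[of "e u"] zero_le_power2[of \<rho>] by (simp only: algebra_simps)
      then have "(2 * d u * e u + 2 * e u * (p u * d u + r u) - (M + 2) * ((d u)\<^sup>2 + (e u)\<^sup>2 + \<rho>\<^sup>2)) * exp (- (M + 2) * (u - a)) \<le> 0"
        by (rule mult_nonpos_nonneg) simp
      moreover have "A * ex + B * (ex * - c) = (A - c * B) * ex" for A B c ex :: real
        by (simp add: algebra_simps)
      ultimately show ?thesis by metis
    qed
    ultimately show "\<exists>y. (?E has_real_derivative y) (at u) \<and> y \<le> 0" by (intro exI[of _ ?y] conjI)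
  qed
  then have "(d x)\<^sup>2 + (e x)\<^sup>2 + \<rho>\<^sup>2 \<le> ((d a)\<^sup>2 + (e a)\<^sup>2 + \<rho>\<^sup>2) * exp ((M + 2) * (x - a))"
    by (simp only: mult_minus_left exp_minus) (simp add: divide_simps)
  then show ?thesis using zero_le_power2[of \<rho>] by linarith
qed

section \<open>Hermite polynomials and their zeros\<close>

text \<open>The recursion expresses that the derivative of exp (- t^2 / 2) He_n is - exp (- t^2 / 2)
  He_(n+1), the form in which Rolle's theorem counts zeros below.\<close>

fun hermite :: "nat \<Rightarrow> real poly" where
  "hermite 0 = 1"
| "hermite (Suc n) = [:0, 1:] * hermite n - pderiv (hermite n)"

lemma pderiv_hermite_Suc: "pderiv (hermite (Suc n)) = smult (real (Suc n)) (hermite n)"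
proof (induction n)
  case (Suc n)
  have "pderiv (hermite (Suc (Suc n))) = hermite (Suc n) + [:0, 1:] * pderiv (hermite (Suc n)) - pderiv (pderiv (hermite (Suc n)))"
    by (simp only: hermite.simps(2)[of "Suc n"] pderiv_diff pderiv_mult) (simp add: pderiv_pCons)
  also have "\<dots> = hermite (Suc n) + smult (real (Suc n)) ([:0, 1:] * hermite n - pderiv (hermite n))"
    unfolding Suc pderiv_smult by (simp add: smult_diff_right algebra_simps)
  also have "\<dots> = smult (real (Suc (Suc n))) (hermite (Suc n))"
    by (simp only: hermite.simps(2)[symmetric]) (rule real_poly_eqI, simp add: algebra_simps)
  finally show ?case .
qed (simp add: pderiv_pCons)

lemma hermite_ode:
  "pderiv (pderiv (hermite n)) - [:0, 1:] * pderiv (hermite n) + smult (real n) (hermite n) = 0"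
proof (cases n)
  case (Suc j)
  show ?thesis unfolding Suc pderiv_hermite_Suc pderiv_smult
    by (rule real_poly_eqI) (simp add: algebra_simps)
qed simp

lemma hermite_parity: "poly (hermite n) (- t) = (- 1) ^ n * poly (hermite n) t"
proof -
  have "(even n \<longrightarrow> even_poly (hermite n)) \<and> (odd n \<longrightarrow> odd_poly (hermite n))"
    by (induction n) (auto intro!: parity_simps parity_pderiv simp del: mult_pCons_left)
  then show ?thesis by (cases "even n") (auto simp: even_poly_def odd_poly_def)
qed

lemma degree_hermite: "degree (hermite n) = n \<and> lead_coeff (hermite n) = 1"
proof (induction n)
  case (Suc n)
  have c: "coeff (hermite (Suc n)) (Suc n) = 1"
    using Suc by (auto simp: coeff_pderiv coeff_eq_0)
  moreover have "degree (hermite (Suc n)) \<le> Suc n"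
    using Suc degree_mult_le[of "[:0, 1:]" "hermite n"]
    by (auto intro!: degree_diff_le simp: degree_pderiv degree_pCons_eq_if)
  ultimately have "degree (hermite (Suc n)) = Suc n"
    by (intro antisym le_degree) auto
  with c show ?case by simp
qed simp

lemma hermite_nonzero: "hermite n \<noteq> 0"
  using degree_hermite[of n] by auto

text \<open>A double zero of He_(n+1) is a zero of He_n, since the derivative is (n + 1) He_n. By
  the induction hypothesis the derivative of He_n is nonzero there, but it equals z He_n - He_(n+1),
  which vanishes.\<close>

lemma hermite_simple_zero: "poly (hermite n) z = 0 \<Longrightarrow> poly (pderiv (hermite n)) z \<noteq> 0"
proof (induction n)
  case (Suc n)
  show ?case
  proof
    assume "poly (pderiv (hermite (Suc n))) z = 0"
    then have "poly (hermite n) z = 0" unfolding pderiv_hermite_Suc by simp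
    then show False using Suc by simp
  qed
qed simp

lemma gauss_poly_tendsto_0:
  assumes "c > 0"
  shows "((\<lambda>t::real. exp (- (c * t\<^sup>2)) * poly p t) \<longlongrightarrow> 0) at_top"
proof -
  have "((\<lambda>t::real. \<Sum>i\<le>degree p. coeff p i * (exp (- (c * t\<^sup>2)) * t ^ i)) \<longlongrightarrow> (\<Sum>i\<le>degree p. coeff p i * 0)) at_top"
  proof (intro tendsto_sum tendsto_mult tendsto_const)
    fix i show "((\<lambda>t::real. exp (- (c * t\<^sup>2)) * t ^ i) \<longlongrightarrow> 0) at_top"
      using assms by real_asymp
  qed
  then show ?thesis by (simp add: poly_altdef sum_distrib_left mult_ac)
qed

text \<open>Each left end of a gap, that is \<open>a\<close> or a point of \<open>Z\<close>, is sent
  to a point of \<open>V\<close> before the next point of \<open>Z\<close>; this map is injective.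
  The count serves both Rolle's argument for Hermite polynomials and Sturm's comparison.\<close>

lemma card_gaps_le:
  fixes Z V :: "real set"
  assumes "finite Z" "finite V" "a < b" "\<And>z. z \<in> Z \<Longrightarrow> a < z \<and> z < b"
    and gap: "\<And>p q. p \<in> insert a Z \<Longrightarrow> q \<in> insert b Z \<Longrightarrow> p < q \<Longrightarrow> Z \<inter> {p<..<q} = {} \<Longrightarrow> \<exists>v\<in>V. p < v \<and> v < q"
  shows "Suc (card Z) \<le> card V"
proof -
  define nx where "nx p = Min {r \<in> insert b Z. p < r}" for p
  have nx: "nx p \<in> insert b Z" "p < nx p" "\<And>r. r \<in> insert b Z \<Longrightarrow> p < r \<Longrightarrow> nx p \<le> r"
    if "p \<in> insert a Z" for p
  proof -
    have f: "finite {r \<in> insert b Z. p < r}" using assms(1) by simp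
    have "b \<in> {r \<in> insert b Z. p < r}" using that assms(3,4) by auto
    then have "nx p \<in> {r \<in> insert b Z. p < r}" unfolding nx_def using Min_in[OF f] by blast
    then show "nx p \<in> insert b Z" "p < nx p" by auto
    show "nx p \<le> r" if "r \<in> insert b Z" "p < r" for r
      unfolding nx_def using f that by (intro Min_le) auto
  qed
  have "\<exists>v\<in>V. p < v \<and> v < nx p" if "p \<in> insert a Z" for p
    by (rule gap[OF that nx(1,2)[OF that]]) (use nx(3)[OF that] in force)
  then obtain f where f: "\<And>p. p \<in> insert a Z \<Longrightarrow> f p \<in> V \<and> p < f p \<and> f p < nx p" by metis
  have "inj_on f (insert a Z)"
  proof (rule linorder_inj_onI)
    fix p p' assume *: "p < p'" "p \<in> insert a Z" "p' \<in> insert a Z"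
    then have "p' \<in> insert b Z" using assms(4) by force
    then show "f p \<noteq> f p'" using nx(3)[OF *(2) _ *(1)] f[OF *(2)] f[OF *(3)] by force
  qed auto
  then have "card (insert a Z) \<le> card V"
    by (rule card_inj_on_le) (use f assms(2) in auto)
  moreover have "a \<notin> Z" using assms(4) by blast
  ultimately show ?thesis using assms(1) by simp
qed

text \<open>The maximum of |f| on the interval is attained inside. Phrased with |f| small at the
  ends, it also covers Rolle's theorem on unbounded gaps where f decays.\<close>

lemma interior_critical_point:
  fixes f :: "real \<Rightarrow> real"
  assumes d: "\<And>x. (f has_real_derivative f' x) (at x)"
    and "a < c" "c < b" "\<bar>f a\<bar> < \<bar>f c\<bar>" "\<bar>f b\<bar> < \<bar>f c\<bar>"
  shows "\<exists>x. a < x \<and> x < b \<and> f' x = 0"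
proof -
  have "continuous_on {a..b} (\<lambda>x. \<bar>f x\<bar>)"
    using d by (intro continuous_intros continuous_at_imp_continuous_on) (auto intro: DERIV_isCont)
  moreover have "{a..b} \<noteq> {}" using assms(2,3) by simp
  ultimately obtain x where x: "x \<in> {a..b}" "\<And>y. y \<in> {a..b} \<Longrightarrow> \<bar>f y\<bar> \<le> \<bar>f x\<bar>"
    using continuous_attains_sup[OF compact_Icc, of a b "\<lambda>x. \<bar>f x\<bar>"] by blast
  have "\<bar>f c\<bar> \<le> \<bar>f x\<bar>" using x(2)[of c] assms(2,3) by simp
  then have "x \<noteq> a" "x \<noteq> b" using assms(4,5) by force+
  then have ab: "a < x" "x < b" using x(1) by auto
  have near: "\<bar>f y\<bar> \<le> \<bar>f x\<bar>" if "\<bar>x - y\<bar> < min (x - a) (b - x)" for y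
  proof -
    have "x - y < x - a" "y - x < b - x" using that by auto
    then show ?thesis by (intro x(2)) auto
  qed
  have m: "0 < min (x - a) (b - x)" using ab by simp
  have "f' x = 0"
  proof (cases "0 \<le> f x")
    case True
    show ?thesis by (rule DERIV_local_max[OF d m]) (use near True in force)
  next
    case False
    show ?thesis by (rule DERIV_local_min[OF d m]) (use near False in force)
  qed
  with ab show ?thesis by blast
qed

text \<open>The function exp (- t^2 / 2) He_n vanishes at n points and at both infinities, so its
  derivative, up to sign exp (- t^2 / 2) He_(n+1), has at least n + 1 zeros. The degree bounds the
  number from above.\<close>

lemma hermite_zeros: "finite {t. poly (hermite n) t = 0} \<and> card {t. poly (hermite n) t = 0} = n"
proof -
  let ?Z = "\<lambda>n. {t. poly (hermite n) t = 0}"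
  have fin: "finite (?Z n)" for n using poly_roots_finite[OF hermite_nonzero] .
  have "n \<le> card (?Z n)"
  proof (induction n)
    case (Suc n)
    define f where "f t = exp (- (1/2 * t\<^sup>2)) * poly (hermite n) t" for t
    have d: "(f has_real_derivative - exp (- (1/2 * t\<^sup>2)) * poly (hermite (Suc n)) t) (at t)" for t
    proof -
      have "((\<lambda>t. exp (- (1/2 * t\<^sup>2))) has_real_derivative - t * exp (- (1/2 * t\<^sup>2))) (at t)"
        by (auto intro!: derivative_eq_intros)
      from DERIV_mult[OF this poly_DERIV[of "hermite n" t]] show ?thesis
        unfolding f_def by (simp add: algebra_simps)
    qed
    have lim: "(f \<longlongrightarrow> 0) at_top" unfolding f_def by (rule gauss_poly_tendsto_0) simp
    have f_minus: "\<bar>f (- t)\<bar> = \<bar>f t\<bar>" for t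
      by (simp add: f_def hermite_parity abs_mult power_abs)
    have far: "\<exists>t>c. \<bar>f t\<bar> < e" if "e > 0" for c e
    proof -
      have "eventually (\<lambda>t. c < t \<and> \<bar>f t\<bar> < e) at_top"
        using tendstoD[OF lim that] by (intro eventually_conj eventually_gt_at_top) (simp add: dist_real_def)
      then show ?thesis using eventually_happens'[OF trivial_limit_at_top_linorder] by blast
    qed
    let ?U = "?Z n \<union> ?Z (Suc n)"
    have "bounded ?U" using fin by (intro finite_imp_bounded) blast
    then obtain b0 where b0: "\<And>u. u \<in> ?U \<Longrightarrow> \<bar>u\<bar> \<le> b0"
      unfolding bounded_iff real_norm_def by blast
    \<comment> \<open>\<open>b\<close> exceeds all zeros of both polynomials, so a critical point
      found on an enlarged outer interval still lies between \<open>- b\<close> and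
      \<open>b\<close>.\<close>
    define b where "b = \<bar>b0\<bar> + 1"
    have b: "- b < u \<and> u < b" if "u \<in> ?U" for u using b0[OF that] by (auto simp: b_def)
    have "Suc (card (?Z n)) \<le> card (?Z (Suc n))"
    proof (rule card_gaps_le[OF fin fin, of "- b" b])
      show "- b < b" by (simp add: b_def)
      show "- b < z \<and> z < b" if "z \<in> ?Z n" for z using b that by blast
      fix p q assume pq: "p \<in> insert (- b) (?Z n)" "q \<in> insert b (?Z n)" "p < q" "?Z n \<inter> {p<..<q} = {}"
      define c where "c = (p + q) / 2"
      have c: "p < c" "c < q" using pq(3) by (auto simp: c_def)
      then have "f c \<noteq> 0" using pq(4) by (auto simp: f_def)
      then have fc: "0 < \<bar>f c\<bar>" by simp
      \<comment> \<open>In an outer gap \<open>f\<close> does not vanish at the artificial end. A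
        distant point, where |f| has decayed below |f c|, takes its place.\<close>
      obtain a' where a': "a' < c" "\<bar>f a'\<bar> < \<bar>f c\<bar>" "p \<in> ?Z n \<Longrightarrow> a' = p"
      proof (cases "p \<in> ?Z n")
        case True
        then show ?thesis using that[of p] c fc by (auto simp: f_def)
      next
        case False
        obtain t where "t > - c" "\<bar>f t\<bar> < \<bar>f c\<bar>" using far[OF fc] by blast
        then show ?thesis using that[of "- t"] False f_minus by auto
      qed
      obtain b' where b': "b' > c" "\<bar>f b'\<bar> < \<bar>f c\<bar>" "q \<in> ?Z n \<Longrightarrow> b' = q"
      proof (cases "q \<in> ?Z n")
        case True
        then show ?thesis using that[of q] c fc by (auto simp: f_def)
      next
        case False
        then show ?thesis using far[OF fc, of c] that by auto
      qed
      obtain x where x: "a' < x" "x < b'" "- exp (- (1/2 * x\<^sup>2)) * poly (hermite (Suc n)) x = 0"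
        using interior_critical_point[OF d a'(1) b'(1) a'(2) b'(2)] by blast
      then have xZ: "x \<in> ?Z (Suc n)" by simp
      then have "- b < x \<and> x < b" using b by blast
      then show "\<exists>v\<in>?Z (Suc n). p < v \<and> v < q"
        using xZ x(1,2) a'(3) b'(3) pq(1,2) by (intro bexI[of _ x]) auto
    qed
    then show ?case using Suc by linarith
  qed simp
  moreover have "card (?Z n) \<le> n"
    using card_poly_roots_bound[OF hermite_nonzero, of n] degree_hermite[of n] by simp
  ultimately show ?thesis using fin by simp
qed

section \<open>The parabolic cylinder function\<close>

definition pcf :: "nat \<Rightarrow> real \<Rightarrow> real" where
  "pcf m t = exp (- t\<^sup>2 / 4) * poly (hermite m) t"

definition pcf' :: "nat \<Rightarrow> real \<Rightarrow> real" where
  "pcf' m t = exp (- t\<^sup>2 / 4) * poly (pderiv (hermite m) - smult (1/2) ([:0, 1:] * hermite m)) t"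

lemma pcf_has_derivative: "(pcf m has_real_derivative pcf' m t) (at t)"
  unfolding pcf_def pcf'_def by (auto intro!: derivative_eq_intros simp: algebra_simps)

lemma pcf'_has_derivative: "(pcf' m has_real_derivative ttilde m t * pcf m t) (at t)"
proof -
  have "poly (pderiv (pderiv (hermite m)) - [:0, 1:] * pderiv (hermite m) + smult (real m) (hermite m)) t = 0"
    by (simp only: hermite_ode poly_0)
  then have *: "poly (pderiv (pderiv (hermite m))) t = t * poly (pderiv (hermite m)) t - real m * poly (hermite m) t"
    by simp
  show ?thesis
    unfolding pcf_def pcf'_def
    by (auto intro!: derivative_eq_intros simp: * pderiv_diff pderiv_smult pderiv_mult pderiv_pCons ttilde_def power2_eq_square field_simps)
qed

lemma pcf_simple_zero: "pcf m t = 0 \<Longrightarrow> pcf' m t \<noteq> 0"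
  using hermite_simple_zero[of m t] by (auto simp: pcf_def pcf'_def)

lemma pcf_minus: "pcf m (- t) = (- 1) ^ m * pcf m t"
  by (simp add: pcf_def hermite_parity)

section \<open>Comparison and oscillation\<close>

lemma first_nonpos:
  fixes f :: "real \<Rightarrow> real"
  assumes "continuous_on {a..b} f" "0 < f a" "x \<in> {a..b}" "f x \<le> 0"
  obtains c where "a < c" "c \<le> x" "f c = 0" "\<And>y. a \<le> y \<Longrightarrow> y < c \<Longrightarrow> 0 < f y"
proof -
  let ?S = "{a..x} \<inter> f -` {..0}"
  have c0: "continuous_on {a..x} f" using assms(1,3) by (auto intro: continuous_on_subset)
  have "compact ?S"
    using continuous_closed_preimage[OF c0 closed_atLeastAtMost closed_atMost]
    by (intro compact_eq_bounded_closed[THEN iffD2] conjI bounded_subset[OF bounded_closed_interval[of a x]]) auto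
  moreover have "x \<in> ?S" using assms by auto
  ultimately obtain c where c: "c \<in> ?S" "\<And>y. y \<in> ?S \<Longrightarrow> c \<le> y"
    using compact_attains_inf[of ?S] by blast
  have pos: "0 < f y" if "a \<le> y" "y < c" for y
    using c(2)[of y] that c(1) by force
  have ac: "a < c" using c(1) assms(2) by (cases "a = c") auto
  have "f c = 0"
  proof (rule ccontr)
    assume "f c \<noteq> 0"
    then have "f c < 0" using c(1) by auto
    have "continuous_on {a..c} f" using c0 c(1) by (auto intro: continuous_on_subset)
    then obtain z where z: "a \<le> z" "z \<le> c" "f z = 0"
      using IVT2'[of f c 0 a, OF less_imp_le[OF \<open>f c < 0\<close>] less_imp_le[OF assms(2)] less_imp_le[OF ac]] by blast
    then have "z < c" using \<open>f c < 0\<close> by (cases "z = c") simp_all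
    then show False using pos[OF z(1)] z(3) by simp
  qed
  then show thesis using that[of c] ac c(1) pos by auto
qed

text \<open>Up to a first zero of \<open>y'\<close> the function y increases from a nonnegative
  value, so y'' = p y is nonnegative and \<open>y'\<close> cannot have come down to zero.\<close>

lemma convex_growth:
  fixes y y' p :: "real \<Rightarrow> real"
  assumes d: "\<And>x. a \<le> x \<Longrightarrow> x \<le> b \<Longrightarrow> (y has_real_derivative y' x) (at x)"
    "\<And>x. a \<le> x \<Longrightarrow> x \<le> b \<Longrightarrow> (y' has_real_derivative p x * y x) (at x)"
    and p: "\<And>x. a \<le> x \<Longrightarrow> x \<le> b \<Longrightarrow> 0 \<le> p x"
    and "0 \<le> y a" "0 < y' a" "a < b"
  shows "0 < y b \<and> 0 < y' b"
proof -
  have c: "continuous_on {a..b} y'"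
    by (rule continuous_at_imp_continuous_on, rule ballI, rule DERIV_isCont, rule d(2)) auto
  have pos: "0 < y' x" if x: "x \<in> {a..b}" for x
  proof (rule ccontr)
    assume "\<not> 0 < y' x"
    then have "y' x \<le> 0" by simp
    obtain u where u: "a < u" "u \<le> x" "y' u = 0" "\<And>z. a \<le> z \<Longrightarrow> z < u \<Longrightarrow> 0 < y' z"
      by (rule first_nonpos[OF c assms(5) x \<open>y' x \<le> 0\<close>]) blast
    have ub: "u \<le> b" using u(2) x by auto
    have y'nn: "0 \<le> y' z" if "a \<le> z" "z \<le> u" for z
      using u(3,4) that by (cases "z = u") (auto intro: less_imp_le)
    have y: "0 \<le> y z" if "a \<le> z" "z \<le> u" for z
    proof -
      have "y a \<le> y z"
        by (rule DERIV_nonneg_imp_nondecreasing[OF that(1)])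
          (use d(1) y'nn that ub in \<open>meson order_trans\<close>)
      then show ?thesis using assms(4) by simp
    qed
    have "y' a \<le> y' u"
    proof (rule DERIV_nonneg_imp_nondecreasing[of a u y'])
      fix z assume "a \<le> z" "z \<le> u"
      then show "\<exists>D. (y' has_real_derivative D) (at z) \<and> 0 \<le> D"
        using d(2)[of z] p[of z] y[of z] ub by (intro exI[of _ "p z * y z"]) auto
    qed (use u in simp)
    then show False using u(3) assms(5) by simp
  qed
  have "y a < y b"
    by (rule DERIV_pos_imp_increasing[OF assms(6)]) (use d(1) pos in auto)
  then show ?thesis using assms(4,6) pos[of b] by auto
qed

section \<open>Sturm comparison\<close>

lemma zero_in_gap_pos:
  fixes u v u' v' q :: "real \<Rightarrow> real"
  assumes u: "\<And>z. z \<in> {a..b} \<Longrightarrow> (u has_real_derivative u' z) (at z within {a..b})"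
    "\<And>z. z \<in> {a..b} \<Longrightarrow> (u' has_real_derivative (q z - h1) * u z) (at z within {a..b})"
    and v: "\<And>z. z \<in> {a..b} \<Longrightarrow> (v has_real_derivative v' z) (at z within {a..b})"
    "\<And>z. z \<in> {a..b} \<Longrightarrow> (v' has_real_derivative (q z - h2) * v z) (at z within {a..b})"
    and "a < b" "h1 < h2"
    and pos: "\<And>z. a < z \<Longrightarrow> z < b \<Longrightarrow> 0 < u z" "\<And>z. a < z \<Longrightarrow> z < b \<Longrightarrow> 0 < v z"
    and bc: "u a = 0 \<or> (u' a = 0 \<and> v' a = 0)" "u b = 0 \<or> (u' b = 0 \<and> v' b = 0)"
  shows False
proof -
  \<comment> \<open>The Wronskian strictly decreases, as its derivative is (h1 - h2) u v. Yet the
    boundary conditions give G a \<le> 0 \<le> G b: where u vanishes at an end, positivity inside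
    fixes the sign of \<open>u'\<close> there.\<close>
  define G where "G z = u z * v' z - u' z * v z" for z
  have dG: "(G has_real_derivative (h1 - h2) * (u z * v z)) (at z within {a..b})" if "z \<in> {a..b}" for z
    unfolding G_def using u[OF that] v[OF that]
    by (auto intro!: derivative_eq_intros simp: algebra_simps)
  have contG: "continuous_on {a..b} G"
    using dG by (meson DERIV_continuous continuous_on_eq_continuous_within)
  have "G b < G a"
  proof (rule DERIV_neg_imp_decreasing_open[OF assms(5)])
    fix z assume z: "a < z" "z < b"
    then have "(G has_real_derivative (h1 - h2) * (u z * v z)) (at z)"
      using dG[of z] by (simp add: at_within_Icc_at)
    moreover have "(h1 - h2) * (u z * v z) < 0"
      using z assms(6) by (intro mult_neg_pos mult_pos_pos pos) simp_all
    ultimately show "\<exists>y. (G has_real_derivative y) (at z) \<and> y < 0" by blast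
  qed (rule contG)
  have cu: "continuous_on {a..b} u" "continuous_on {a..b} v"
    using u(1) v(1) by (meson DERIV_continuous continuous_on_eq_continuous_within)+
  have lim: "(f \<longlongrightarrow> f a) (at_right a)" "(f \<longlongrightarrow> f b) (at_left b)" if "continuous_on {a..b} f" for f :: "real \<Rightarrow> real"
    using that \<open>a < b\<close> by (auto simp: continuous_on_Icc_at_rightD continuous_on_Icc_at_leftD)
  have "0 \<le> v a" 
    by (rule tendsto_lowerbound[OF lim(1)[OF cu(2)]])
      (use pos(2) assms(5) in \<open>auto simp: eventually_at_right_field intro!: exI[of _ b] less_imp_le\<close>)
  have "0 \<le> v b" 
    by (rule tendsto_lowerbound[OF lim(2)[OF cu(2)]])
      (use pos(2) assms(5) in \<open>auto simp: eventually_at_left_field intro!: exI[of _ a] less_imp_le\<close>)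
  have ua: "0 \<le> u' a" if "u a = 0"
  proof (rule ccontr)
    assume "\<not> 0 \<le> u' a"
    then have "u' a < 0" by simp
    moreover have "a \<in> {a..b}" using assms(5) by simp
    ultimately obtain d where d: "d > 0" "\<And>h. 0 < h \<Longrightarrow> a + h \<in> {a..b} \<Longrightarrow> h < d \<Longrightarrow> u (a + h) < u a"
      using has_real_derivative_neg_dec_right[OF u(1)] by meson
    define h where "h = min (d/2) ((b - a)/2)"
    have "0 < h" "h < d" "a + h < b" using d(1) assms(5) by (auto simp: h_def min_def field_simps)
    then have "u (a + h) < u a" "0 < u (a + h)" by (intro d(2) pos(1); simp)+
    then show False using that by simp
  qed
  have ub: "u' b \<le> 0" if "u b = 0"
  proof (rule ccontr)
    assume "\<not> u' b \<le> 0"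
    then have "u' b > 0" by simp
    moreover have "b \<in> {a..b}" using assms(5) by simp
    ultimately obtain d where d: "d > 0" "\<And>h. 0 < h \<Longrightarrow> b - h \<in> {a..b} \<Longrightarrow> h < d \<Longrightarrow> u (b - h) < u b"
      using has_real_derivative_pos_inc_left[OF u(1)] by meson
    define h where "h = min (d/2) ((b - a)/2)"
    have "0 < h" "h < d" "a < b - h" using d(1) assms(5) by (auto simp: h_def min_def field_simps)
    then have "u (b - h) < u b" "0 < u (b - h)" by (intro d(2) pos(1); simp)+
    then show False using that by simp
  qed
  have "G a \<le> 0" using bc(1) ua \<open>0 \<le> v a\<close> by (auto simp: G_def)
  moreover have "0 \<le> G b" using bc(2) ub \<open>0 \<le> v b\<close> by (auto simp: G_def mult_nonpos_nonneg)
  ultimately show False using \<open>G b < G a\<close> by simp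
qed

lemma constant_sign:
  fixes f :: "real \<Rightarrow> real"
  assumes "continuous_on {a..b} f" "\<And>z. a < z \<Longrightarrow> z < b \<Longrightarrow> f z \<noteq> 0"
  obtains s where "s \<in> {1, - 1 :: real}" "\<And>z. a < z \<Longrightarrow> z < b \<Longrightarrow> 0 < s * f z"
proof (cases "\<exists>z. a < z \<and> z < b \<and> 0 < f z")
  case True
  then obtain z0 where z0: "a < z0" "z0 < b" "0 < f z0" by blast
  have "0 < f z" if "a < z" "z < b" for z
  proof (rule ccontr)
    assume "\<not> 0 < f z"
    have "continuous_on {a<..<b} f" 
      by (rule continuous_on_subset[OF assms(1)]) auto
    then have "connected (f ` {a<..<b})"
      by (intro connected_continuous_image connected_Ioo)
    then have "{f z..f z0} \<subseteq> f ` {a<..<b}"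
      by (rule connected_contains_Icc) (use z0 that in simp_all)
    moreover have "0 \<in> {f z..f z0}" using \<open>\<not> 0 < f z\<close> z0(3) by simp
    ultimately obtain x where "x \<in> {a<..<b}" "f x = 0" by (metis (no_types) imageE subsetD)
    then show False using assms(2)[of x] by simp
  qed
  then show thesis using that[of 1] by auto
next
  case False
  then have "0 < - 1 * f z" if "a < z" "z < b" for z
    using assms(2)[OF that] that by force
  then show thesis using that[of "- 1"] by auto
qed

lemma zero_in_gap:
  fixes u v u' v' q :: "real \<Rightarrow> real"
  assumes u: "\<And>z. z \<in> {a..b} \<Longrightarrow> (u has_real_derivative u' z) (at z within {a..b})"
    "\<And>z. z \<in> {a..b} \<Longrightarrow> (u' has_real_derivative (q z - h1) * u z) (at z within {a..b})"
    and v: "\<And>z. z \<in> {a..b} \<Longrightarrow> (v has_real_derivative v' z) (at z within {a..b})"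
    "\<And>z. z \<in> {a..b} \<Longrightarrow> (v' has_real_derivative (q z - h2) * v z) (at z within {a..b})"
    and ab: "a < b" and h: "h1 < h2"
    and nz: "\<And>z. a < z \<Longrightarrow> z < b \<Longrightarrow> u z \<noteq> 0"
    and bc: "u a = 0 \<or> (u' a = 0 \<and> v' a = 0)" "u b = 0 \<or> (u' b = 0 \<and> v' b = 0)"
  shows "\<exists>z. a < z \<and> z < b \<and> v z = 0"
proof (rule ccontr)
  assume "\<not> (\<exists>z. a < z \<and> z < b \<and> v z = 0)"
  then have nv: "v z \<noteq> 0" if "a < z" "z < b" for z using that by blast
  have c: "continuous_on {a..b} u" "continuous_on {a..b} v"
    using u(1) v(1) by (meson DERIV_continuous continuous_on_eq_continuous_within)+
  obtain s where s: "s \<in> {1, - 1 :: real}" "\<And>z. a < z \<Longrightarrow> z < b \<Longrightarrow> 0 < s * u z"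
    using constant_sign[OF c(1) nz] by blast
  obtain r where r: "r \<in> {1, - 1 :: real}" "\<And>z. a < z \<Longrightarrow> z < b \<Longrightarrow> 0 < r * v z"
    using constant_sign[OF c(2) nv] by blast
  show False
  proof (rule zero_in_gap_pos)
    fix z assume z: "z \<in> {a..b}"
    show "((\<lambda>z. s * u z) has_real_derivative s * u' z) (at z within {a..b})"
      by (rule DERIV_cmult[OF u(1)[OF z]])
    show "((\<lambda>z. s * u' z) has_real_derivative (q z - h1) * (s * u z)) (at z within {a..b})"
      using DERIV_cmult[OF u(2)[OF z], of s] by (simp add: mult.left_commute)
    show "((\<lambda>z. r * v z) has_real_derivative r * v' z) (at z within {a..b})"
      by (rule DERIV_cmult[OF v(1)[OF z]])
    show "((\<lambda>z. r * v' z) has_real_derivative (q z - h2) * (r * v z)) (at z within {a..b})"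
      using DERIV_cmult[OF v(2)[OF z], of r] by (simp add: mult.left_commute)
  qed (use ab h s(2) r(2) bc in auto)
qed

text \<open>The zeros of \<open>u\<close> cut the interval into one gap more than there are zeros,
  and \<open>v\<close> has a zero in each. At an end of the interval a common Neumann condition does
  the duty of a zero of \<open>u\<close>.\<close>

lemma sturm_more_zeros:
  fixes u v u' v' q :: "real \<Rightarrow> real"
  assumes u: "\<And>z. z \<in> {a..b} \<Longrightarrow> (u has_real_derivative u' z) (at z within {a..b})"
    "\<And>z. z \<in> {a..b} \<Longrightarrow> (u' has_real_derivative (q z - h1) * u z) (at z within {a..b})"
    and v: "\<And>z. z \<in> {a..b} \<Longrightarrow> (v has_real_derivative v' z) (at z within {a..b})"
    "\<And>z. z \<in> {a..b} \<Longrightarrow> (v' has_real_derivative (q z - h2) * v z) (at z within {a..b})"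
    and ab: "a < b" and h: "h1 < h2"
    and fin: "finite {z \<in> {a<..<b}. u z = 0}" "finite {z \<in> {a<..<b}. v z = 0}"
    and bc: "u a = 0 \<or> (u' a = 0 \<and> v' a = 0)" "u b = 0 \<or> (u' b = 0 \<and> v' b = 0)"
  shows "card {z \<in> {a<..<b}. u z = 0} < card {z \<in> {a<..<b}. v z = 0}"
proof -
  have "Suc (card {z \<in> {a<..<b}. u z = 0}) \<le> card {z \<in> {a<..<b}. v z = 0}"
  proof (rule card_gaps_le[OF fin ab])
    fix p r assume pr: "p \<in> insert a {z \<in> {a<..<b}. u z = 0}" "r \<in> insert b {z \<in> {a<..<b}. u z = 0}"
      "p < r" "{z \<in> {a<..<b}. u z = 0} \<inter> {p<..<r} = {}"
    then have sub: "a \<le> p" "r \<le> b" "{p..r} \<subseteq> {a..b}" by auto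
    have "\<exists>z. p < z \<and> z < r \<and> v z = 0"
    proof (rule zero_in_gap[where u = u and u' = u' and v = v and v' = v' and q = q and ?h1.0 = h1 and ?h2.0 = h2])
      show "u z \<noteq> 0" if "p < z" "z < r" for z
      proof
        assume "u z = 0"
        then have "z \<in> {z \<in> {a<..<b}. u z = 0} \<inter> {p<..<r}" using sub(1,2) that by simp
        then show False using pr(4) by blast
      qed
      show "u p = 0 \<or> u' p = 0 \<and> v' p = 0" using pr(1) bc(1) by auto
      show "u r = 0 \<or> u' r = 0 \<and> v' r = 0" using pr(2) bc(2) by auto
        show "p < r" "h1 < h2" by fact+
    next
      fix z assume "z \<in> {p..r}"
      then have z: "z \<in> {a..b}" using sub(3) by blast
      show "(u has_real_derivative u' z) (at z within {p..r})"
        "(u' has_real_derivative (q z - h1) * u z) (at z within {p..r})"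
        "(v has_real_derivative v' z) (at z within {p..r})"
        "(v' has_real_derivative (q z - h2) * v z) (at z within {p..r})"
        by (rule DERIV_subset[OF u(1)[OF z] sub(3)] DERIV_subset[OF u(2)[OF z] sub(3)]
          DERIV_subset[OF v(1)[OF z] sub(3)] DERIV_subset[OF v(2)[OF z] sub(3)])+
    qed
    then show "\<exists>v'\<in>{z \<in> {a<..<b}. v z = 0}. p < v' \<and> v' < r" using sub by force
  qed auto
  then show ?thesis by simp
qed

section \<open>Zeros under small perturbations\<close>

lemma finite_common_radius:
  assumes "finite Z" and ex: "\<forall>z\<in>Z. \<exists>r>0. P z (r :: real)"
    and mono: "\<forall>z r r'. P z r \<longrightarrow> 0 < r' \<longrightarrow> r' \<le> r \<longrightarrow> P z r'"
  shows "\<exists>r>0. \<forall>z\<in>Z. P z r"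
  using assms(1) ex
proof (induction Z rule: finite_induct)
  case empty
  show ?case by (auto intro: exI[of _ 1])
next
  case (insert z Z)
  then obtain r where r: "r > 0" "\<forall>z\<in>Z. P z r" by auto
  obtain s where s: "s > 0" "P z s" using insert.prems by auto
  have "P x (min r s)" if "x \<in> insert z Z" for x
    using that r s mono[rule_format, of x r "min r s"] mono[rule_format, of z s "min r s"] by auto
  then show ?case using r(1) s(1) by (intro exI[of _ "min r s"]) simp
qed

lemma compact_abs_lower_bound:
  fixes f :: "real \<Rightarrow> real"
  assumes "compact K" "continuous_on K f" "\<And>x. x \<in> K \<Longrightarrow> f x \<noteq> 0"
  shows "\<exists>e>0. \<forall>x\<in>K. e \<le> \<bar>f x\<bar>"
proof (cases "K = {}")
  case False
  have "continuous_on K (\<lambda>x. \<bar>f x\<bar>)" using assms(2) by (intro continuous_intros)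
  then obtain x where "x \<in> K" "\<And>y. y \<in> K \<Longrightarrow> \<bar>f x\<bar> \<le> \<bar>f y\<bar>"
    using continuous_attains_inf[OF assms(1) False] by blast
  then show ?thesis using assms(3)[of x] by (intro exI[of _ "\<bar>f x\<bar>"]) simp
qed (auto intro: exI[of _ 1])

text \<open>Near each simple zero the sign change survives and produces a zero of g, while the
  nonvanishing derivative allows only one. Away from the zeros |f| is bounded below, which leaves no
  room for further zeros.\<close>

lemma zero_count_stable:
  fixes f f' :: "real \<Rightarrow> real" and a b :: real
  defines "Z \<equiv> {x \<in> {a..b}. f x = 0}"
  assumes d: "\<And>x. (f has_real_derivative f' x) (at x)" and c: "\<And>x. isCont f' x"
    and fin: "finite Z" and ab: "a \<le> b" "f a \<noteq> 0" "f b \<noteq> 0" and simple: "\<And>x. x \<in> Z \<Longrightarrow> f' x \<noteq> 0"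
  shows "\<exists>e>0. \<forall>g g'. (\<forall>x\<in>{a..b}. (g has_real_derivative g' x) (at x) \<and> \<bar>g x - f x\<bar> < e \<and> \<bar>g' x - f' x\<bar> < e) \<longrightarrow>
     finite {x \<in> {a..b}. g x = 0} \<and> card {x \<in> {a..b}. g x = 0} = card Z"
proof -
  \<comment> \<open>The radius must keep the neighbourhood inside the interval, keep f' of one sign
    on it, and separate it from the neighbourhoods of the other zeros.\<close>
  define P where "P z r \<longleftrightarrow> (\<forall>x. \<bar>x - z\<bar> \<le> r \<longrightarrow> 0 < f' x * f' z \<and> a \<le> x \<and> x \<le> b) \<and>
     (\<forall>z'\<in>Z. z' \<noteq> z \<longrightarrow> 2 * r < \<bar>z' - z\<bar>)" for z r
  have exr: "\<exists>r>0. P z r" if z: "z \<in> Z" for z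
  proof -
    have zab: "a < z" "z < b" using z ab unfolding Z_def by (auto simp: less_le)
    have "isCont (\<lambda>x. f' x * f' z) z" using c by (intro continuous_intros)
    then have lim: "((\<lambda>x. f' x * f' z) \<longlongrightarrow> f' z * f' z) (nhds z)" 
      unfolding isCont_def using tendsto_at_iff_tendsto_nhds[of "\<lambda>x. f' x * f' z" z] by blast
    have "0 < f' z * f' z" using simple[OF z] by (metis not_real_square_gt_zero)
    from order_tendstoD(1)[OF lim this] obtain r1 where r1: "r1 > 0" "\<And>x. \<bar>x - z\<bar> < r1 \<Longrightarrow> 0 < f' x * f' z"
      unfolding eventually_nhds_metric dist_real_def by blast
    obtain r2 where r2: "r2 > 0" "\<And>x. x \<in> Z \<Longrightarrow> x \<noteq> z \<Longrightarrow> r2 \<le> \<bar>z - x\<bar>"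
      using finite_set_avoid[OF fin, of z] unfolding dist_real_def by blast
    define r where "r = min (min (r1 / 2) (r2 / 3)) (min (z - a) (b - z))"
    have r: "r \<le> r1 / 2" "r \<le> r2 / 3" "r \<le> z - a" "r \<le> b - z" "0 < r"
      using r1(1) r2(1) zab unfolding r_def by linarith+
    have "P z r"
      unfolding P_def
    proof (intro conjI allI impI ballI)
      fix x assume x: "\<bar>x - z\<bar> \<le> r"
      show "0 < f' x * f' z" using x r(1) r1(1) by (intro r1(2)) linarith
      show "a \<le> x" "x \<le> b" using x r(3,4) by linarith+
    next
      fix z' assume "z' \<in> Z" "z' \<noteq> z"
      then show "2 * r < \<bar>z' - z\<bar>" using r2(2)[of z'] r2(1) r(2) by linarith
    qed
    then show ?thesis using r(5) by blast
  qed
  have mono: "P z r'" if "P z r" "0 < r'" "r' \<le> r" for z r r'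
    using that unfolding P_def by (meson le_less_trans mult_left_mono order_trans zero_le_numeral)
  obtain r where r: "r > 0" "\<And>z. z \<in> Z \<Longrightarrow> P z r"
    using finite_common_radius[OF fin, of P] exr mono by blast
  have P1: "0 < f' x * f' z" "a \<le> x" "x \<le> b" if "z \<in> Z" "\<bar>x - z\<bar> \<le> r" for x z
    using r(2)[OF that(1)] that(2) unfolding P_def by auto
  have P2: "2 * r < \<bar>z' - z\<bar>" if "z \<in> Z" "z' \<in> Z" "z' \<noteq> z" for z z'
    using r(2)[OF that(1)] that unfolding P_def by auto
  \<comment> \<open>Open neighbourhoods are removed from \<open>K\<close> and closed ones make up
    \<open>L\<close>. Both sets are thus compact, and the points \<open>z - r\<close> and
    \<open>z + r\<close>, where the sign of g is read off, belong to \<open>K\<close>.\<close>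
  define K where "K = {a..b} - (\<Union>z\<in>Z. {z - r<..<z + r})"
  define L where "L = (\<Union>z\<in>Z. {z - r..z + r})"
  have "compact K" unfolding K_def by (intro compact_diff compact_Icc open_UN ballI open_greaterThanLessThan)
  moreover have "continuous_on K f" using d by (intro continuous_at_imp_continuous_on) (blast intro: DERIV_isCont)
  moreover have "f x \<noteq> 0" if "x \<in> K" for x
  proof
    assume "f x = 0"
    then have "x \<in> Z" using that by (simp add: K_def Z_def)
    moreover have "x \<in> {x - r<..<x + r}" using r(1) by simp
    ultimately show False using that unfolding K_def by blast
  qed
  ultimately have "\<exists>e>0. \<forall>x\<in>K. e \<le> \<bar>f x\<bar>" by (rule compact_abs_lower_bound)
  then obtain e1 where e1: "e1 > 0" "\<And>x. x \<in> K \<Longrightarrow> e1 \<le> \<bar>f x\<bar>" by blast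
  have "compact L" unfolding L_def by (intro compact_UN fin ballI compact_Icc)
  moreover have "continuous_on L f'" using c by (intro continuous_at_imp_continuous_on) blast
  moreover have "f' x \<noteq> 0" if "x \<in> L" for x
  proof -
    obtain z where "z \<in> Z" "z - r \<le> x" "x \<le> z + r" using \<open>x \<in> L\<close> unfolding L_def by auto
    then have "0 < f' x * f' z" by (intro P1(1)) auto
    then show ?thesis by auto
  qed
  ultimately have "\<exists>e>0. \<forall>x\<in>L. e \<le> \<bar>f' x\<bar>" by (rule compact_abs_lower_bound)
  then obtain e2 where e2: "e2 > 0" "\<And>x. x \<in> L \<Longrightarrow> e2 \<le> \<bar>f' x\<bar>" by blast
  have endK: "z - r \<in> K" "z + r \<in> K" if "z \<in> Z" for z
  proof -
    have "\<not> \<bar>z - r - z'\<bar> < r" "\<not> \<bar>z + r - z'\<bar> < r" if "z' \<in> Z" for z'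
      using P2[OF \<open>z \<in> Z\<close> that] r(1) by (cases "z' = z"; linarith)+
    moreover have "\<bar>z - r - z\<bar> \<le> r" "\<bar>z + r - z\<bar> \<le> r" using r(1) by auto
    ultimately show "z - r \<in> K" "z + r \<in> K"
      using P1(2,3)[OF that] unfolding K_def by (fastforce simp: abs_less_iff)+
  qed
  have fsign: "0 < f (z + r) * f' z" "f (z - r) * f' z < 0" if z: "z \<in> Z" for z
  proof -
    have fz: "f z = 0" using z by (simp add: Z_def)
    obtain x where x: "z < x" "x < z + r" "f (z + r) - f z = (z + r - z) * f' x"
      using MVT2[of z "z + r" f f'] d r(1) by auto
    have "0 < r * (f' x * f' z)" using P1(1)[OF z, of x] x r(1) by simp
    then show "0 < f (z + r) * f' z" using x(3) fz by (simp add: mult.assoc)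
    obtain x where x: "z - r < x" "x < z" "f z - f (z - r) = (z - (z - r)) * f' x"
      using MVT2[of "z - r" z f f'] d r(1) by auto
    have "0 < r * (f' x * f' z)" using P1(1)[OF z, of x] x r(1) by simp
    moreover have "f (z - r) = - (r * f' x)" using x(3) fz by simp
    ultimately show "f (z - r) * f' z < 0" by (simp add: mult.assoc)
  qed
  have "finite {x \<in> {a..b}. g x = 0} \<and> card {x \<in> {a..b}. g x = 0} = card Z"
    if g: "\<forall>x\<in>{a..b}. (g has_real_derivative g' x) (at x) \<and> \<bar>g x - f x\<bar> < min e1 e2 \<and> \<bar>g' x - f' x\<bar> < min e1 e2" for g g'
  proof -
    have near: "\<exists>z\<in>Z. \<bar>x - z\<bar> < r" if "x \<in> {a..b}" "g x = 0" for x
    proof (rule ccontr)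
      assume *: "\<not> (\<exists>z\<in>Z. \<bar>x - z\<bar> < r)"
      then have "x \<in> K" using that(1) unfolding K_def by (fastforce simp: abs_less_iff)
      then show False using e1(2)[of x] g that by fastforce
    qed
    have ex: "\<exists>x. \<bar>x - z\<bar> < r \<and> g x = 0" if z: "z \<in> Z" for z
    proof -
      have same: "0 < g x * s" if "x \<in> K" "0 < f x * s" for x s
      proof -
        have "e1 \<le> \<bar>f x\<bar>" "\<bar>g x - f x\<bar> < e1" using e1(2)[OF that(1)] g that(1) by (auto simp: K_def)
        then show ?thesis using that(2) by (auto simp: zero_less_mult_iff)
      qed
      have 1: "0 < g (z + r) * f' z" by (rule same[OF endK(2)[OF z] fsign(1)[OF z]])
      have 2: "g (z - r) * f' z < 0" using same[OF endK(1)[OF z], of "- f' z"] fsign(2)[OF z] by simp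
      have sub: "{z - r..z + r} \<subseteq> {a..b}"
        using endK[OF z] by (auto simp: K_def)
      have "continuous_on {z - r..z + r} (\<lambda>x. g x * f' z)"
        using g sub by (intro continuous_intros continuous_at_imp_continuous_on) (blast intro: DERIV_isCont)
      then obtain x where x: "z - r \<le> x" "x \<le> z + r" "g x * f' z = 0"
        using IVT'[of "\<lambda>x. g x * f' z" "z - r" 0 "z + r"] 1 2 r(1) by auto
      moreover have "x \<noteq> z - r" "x \<noteq> z + r" using x(3) 1 2 by auto
      ultimately show ?thesis using simple[OF z] by (intro exI[of _ x]) auto
    qed
    have uniq: "x = y" if "z \<in> Z" "\<bar>x - z\<bar> < r" "\<bar>y - z\<bar> < r" "g x = 0" "g y = 0" for x y z
    proof -
      have False if xy: "x < y" and "\<bar>x - z\<bar> < r" "\<bar>y - z\<bar> < r" "g x = 0" "g y = 0" for x y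
      proof -
        have sub: "{x..y} \<subseteq> {a..b}" "{x..y} \<subseteq> L"
          using endK[OF \<open>z \<in> Z\<close>] that(2,3) \<open>z \<in> Z\<close> by (auto simp: K_def L_def intro!: bexI[of _ z])
        then obtain u where u: "x < u" "u < y" "g y - g x = (y - x) * g' u"
          using MVT2[OF xy, of g g'] g by (auto simp: subset_iff)
        then have "g' u = 0" using that by simp
        moreover have "u \<in> L" "u \<in> {a..b}" using u sub by auto
        ultimately show False using e2(2)[of u] g by fastforce
      qed
      from this[of x y] this[of y x] show ?thesis using that by (cases x y rule: linorder_cases) auto
    qed
    obtain h where h: "\<And>z. z \<in> Z \<Longrightarrow> \<bar>h z - z\<bar> < r \<and> g (h z) = 0" using ex by metis
    have "{x \<in> {a..b}. g x = 0} = h ` Z"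
    proof (intro equalityI subsetI)
      fix x assume x: "x \<in> {x \<in> {a..b}. g x = 0}"
      then obtain z where z: "z \<in> Z" "\<bar>x - z\<bar> < r" using near by blast
      then have "x = h z" using uniq[of z x "h z"] h[OF z(1)] x by blast
      then show "x \<in> h ` Z" using z(1) by blast
    next
      fix x assume "x \<in> h ` Z"
      then obtain z where z: "z \<in> Z" "x = h z" by blast
      then show "x \<in> {x \<in> {a..b}. g x = 0}" using h[OF z(1)] P1(2,3)[OF z(1), of x] by auto
    qed
    moreover have "inj_on h Z"
    proof (rule inj_onI)
      fix z z' assume "z \<in> Z" "z' \<in> Z" "h z = h z'"
      then show "z = z'" using h[of z] h[of z'] P2[of z z'] by (cases "z' = z") (auto simp: abs_less_iff)
    qed
    ultimately show ?thesis using fin by (simp add: card_image)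
  qed
  moreover have "0 < min e1 e2" using e1(1) e2(1) by simp
  ultimately show ?thesis by blast
qed

section \<open>The formal solution as a quasimode\<close>

lemma poly_growth:
  fixes p :: "real poly"
  shows "\<exists>C d. 0 \<le> C \<and> (\<forall>t. \<bar>poly p t\<bar> \<le> C * (1 + \<bar>t\<bar>) ^ d)"
proof (induction p)
  case (pCons a p)
  then obtain C d where C: "0 \<le> C" "\<And>t. \<bar>poly p t\<bar> \<le> C * (1 + \<bar>t\<bar>) ^ d" by blast
  have "\<bar>poly (pCons a p) t\<bar> \<le> (\<bar>a\<bar> + C) * (1 + \<bar>t\<bar>) ^ Suc d" for t
  proof -
    have "\<bar>poly (pCons a p) t\<bar> \<le> \<bar>a\<bar> * 1 + \<bar>t\<bar> * \<bar>poly p t\<bar>" by (simp add: abs_mult[symmetric])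
    also have "\<dots> \<le> \<bar>a\<bar> * (1 + \<bar>t\<bar>) ^ Suc d + (1 + \<bar>t\<bar>) * (C * (1 + \<bar>t\<bar>) ^ d)"
      by (intro add_mono mult_left_mono mult_mono C one_le_power) auto
    finally show ?thesis by (simp add: algebra_simps)
  qed
  then show ?case using C(1) by (intro exI[of _ "\<bar>a\<bar> + C"] exI[of _ "Suc d"]) auto
qed (auto intro: exI[of _ 0])

lemma growth_combine:
  fixes C1 C2 :: real
  assumes "0 \<le> C1" "0 \<le> C2" "1 \<le> u"
  shows "C1 * u ^ d1 + C2 * u ^ d2 \<le> (C1 + C2) * u ^ max d1 d2"
proof -
  have "u ^ d1 \<le> u ^ max d1 d2" "u ^ d2 \<le> u ^ max d1 d2"
    using assms(3) by (intro power_increasing; simp)+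
  then show ?thesis using assms(1,2) by (simp add: distrib_right add_mono mult_left_mono)
qed

text \<open>In \<open>real poly poly\<close> the outer variable stands for \<epsilon> and the inner
  one for t. The bound is uniform in \<epsilon>, so that the constants of the quasimode do not
  depend on \<kappa>.\<close>

lemma bivariate_growth:
  fixes p :: "real poly poly"
  shows "\<exists>C d. 0 \<le> C \<and> (\<forall>e t. 0 \<le> e \<longrightarrow> e \<le> 1 \<longrightarrow> \<bar>poly (poly p [:e:]) t\<bar> \<le> C * (1 + \<bar>t\<bar>) ^ d)"
proof (induction p)
  case (pCons a p)
  then obtain C d where C: "0 \<le> C" "\<And>e t. 0 \<le> e \<Longrightarrow> e \<le> 1 \<Longrightarrow> \<bar>poly (poly p [:e:]) t\<bar> \<le> C * (1 + \<bar>t\<bar>) ^ d" by blast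
  obtain C' d' where C': "0 \<le> C'" "\<And>t. \<bar>poly a t\<bar> \<le> C' * (1 + \<bar>t\<bar>) ^ d'" using poly_growth by blast
  have "\<bar>poly (poly (pCons a p) [:e:]) t\<bar> \<le> (C' + C) * (1 + \<bar>t\<bar>) ^ max d' d" if "0 \<le> e" "e \<le> 1" for e t
  proof -
    have "\<bar>poly (poly (pCons a p) [:e:]) t\<bar> \<le> \<bar>poly a t\<bar> + \<bar>e\<bar> * \<bar>poly (poly p [:e:]) t\<bar>"
      by (simp add: abs_mult[symmetric])
    also have "\<dots> \<le> C' * (1 + \<bar>t\<bar>) ^ d' + 1 * (C * (1 + \<bar>t\<bar>) ^ d)"
      using that by (intro add_mono mult_mono C C') auto
    also have "\<dots> \<le> (C' + C) * (1 + \<bar>t\<bar>) ^ max d' d"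
      using growth_combine[OF C'(1) C(1), of "1 + \<bar>t\<bar>" d' d] by simp
    finally show ?thesis .
  qed
  then show ?case using C(1) C'(1) by (intro exI[of _ "C' + C"] exI[of _ "max d' d"]) auto
qed (auto intro: exI[of _ 0])

lemma bivariate_small:
  fixes p :: "real poly poly"
  assumes "\<And>s. s < n \<Longrightarrow> coeff p s = 0"
  shows "\<exists>C d. 0 \<le> C \<and> (\<forall>e t. 0 \<le> e \<longrightarrow> e \<le> 1 \<longrightarrow> \<bar>poly (poly p [:e:]) t\<bar> \<le> e ^ n * (C * (1 + \<bar>t\<bar>) ^ d))"
proof -
  have p: "p = monom 1 n * poly_shift n p"
    by (rule poly_eqI) (use assms in \<open>auto simp: coeff_monom_mult coeff_poly_shift\<close>)
  obtain C d where C: "0 \<le> C" "\<And>e t. 0 \<le> e \<Longrightarrow> e \<le> 1 \<Longrightarrow> \<bar>poly (poly (poly_shift n p) [:e:]) t\<bar> \<le> C * (1 + \<bar>t\<bar>) ^ d"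
    using bivariate_growth by blast
  have "\<bar>poly (poly p [:e:]) t\<bar> \<le> e ^ n * (C * (1 + \<bar>t\<bar>) ^ d)" if "0 \<le> e" "e \<le> 1" for e t
  proof -
    have "\<bar>poly (poly p [:e:]) t\<bar> = e ^ n * \<bar>poly (poly (poly_shift n p) [:e:]) t\<bar>"
      using that by (subst p) (simp add: poly_monom abs_mult power_abs)
    also have "\<dots> \<le> e ^ n * (C * (1 + \<bar>t\<bar>) ^ d)" using that by (intro mult_left_mono C) auto
    finally show ?thesis .
  qed
  then show ?thesis using C(1) by blast
qed

lemma poly_map_pderiv: "poly (map_poly pderiv p) [:e:] = pderiv (poly p [:e:])" for p :: "real poly poly"
  by (induction p) (simp_all add: map_poly_pCons pderiv_add pderiv_smult)

lemma coeff_truncated_sum: "coeff (\<Sum>s\<le>N. monom (A s) s) i = (if i \<le> N then A i else 0)"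
  by (simp add: coeff_sum)

text \<open>With \<epsilon> as outer variable, \<open>resid1\<close> and \<open>resid2\<close> are
  the coefficients of D_m' and D_m left over when the truncated series is inserted into Lame's
  equation. \<open>pCons 0\<close> is multiplication by \<epsilon>, and the products with
  \<open>pM\<close> contain the convolutions with \<mu>.\<close>

definition resid1 where
  "resid1 k m pA pB pM = smult 2 (map_poly pderiv pA) + map_poly pderiv (map_poly pderiv pB)
    - smult (smult ((1 + k\<^sup>2) / 2) [:0, 1:]) (pCons 0 (smult (2 * [:0, 1:]) (map_poly pderiv pA) + pA
        + smult [:0, 1:] (map_poly pderiv (map_poly pderiv pB)) + map_poly pderiv pB + smult (ttilde_poly m * [:0, 1:]) pB))
    + smult (smult (k\<^sup>2 / 4) ([:0, 1:] ^ 3)) (pCons 0 (pCons 0 (smult (2 * [:0, 1:]) (map_poly pderiv pA) + smult 2 pA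
        + smult [:0, 1:] (map_poly pderiv (map_poly pderiv pB)) + smult 2 (map_poly pderiv pB) + smult (ttilde_poly m * [:0, 1:]) pB)))
    + pM * pB"

definition resid2 where
  "resid2 k m pA pB pM = map_poly pderiv (map_poly pderiv pA) + smult (2 * ttilde_poly m) (map_poly pderiv pB)
    + smult (smult (1/2) [:0, 1:]) pB + pM * pA
    - smult (smult ((1 + k\<^sup>2) / 2) [:0, 1:]) (pCons 0 (smult [:0, 1:] (map_poly pderiv (map_poly pderiv pA)) + map_poly pderiv pA
        + smult (smult (1/2) ([:0, 1:] ^ 2)) pB
        + smult (ttilde_poly m) (smult [:0, 1:] pA + smult (2 * [:0, 1:]) (map_poly pderiv pB) + pB)))
    + smult (smult (k\<^sup>2 / 4) ([:0, 1:] ^ 3)) (pCons 0 (pCons 0 (smult [:0, 1:] (map_poly pderiv (map_poly pderiv pA)) + smult 2 (map_poly pderiv pA)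
        + smult (smult (1/2) ([:0, 1:] ^ 2)) pB
        + smult (ttilde_poly m) (smult [:0, 1:] pA + smult (2 * [:0, 1:]) (map_poly pderiv pB) + smult 2 pB))))"

lemma sum_atMost_1:
  fixes f :: "nat \<Rightarrow> real poly"
  assumes "f 0 = 0" "1 \<le> s" shows "(\<Sum>i\<le>s. f i) = (\<Sum>i=1..<s. f i) + f s"
proof -
  have "{..s} = insert 0 (insert s {1..<s})" using assms(2) by auto
  then show ?thesis using assms by (simp add: add.commute)
qed

text \<open>The coefficient of \<epsilon>^s is the left-hand side of the identity of order s. It
  involves only indices up to s, so truncation at N is not noticed while s \<le> N.\<close>

lemma resid_coeff_0:
  assumes rec: "lame_recursion k m A B \<mu>" and s: "s \<le> N"
    and pA: "pA = (\<Sum>s\<le>N. monom (A s) s)" and pB: "pB = (\<Sum>s\<le>N. monom (B s) s)"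
    and pM: "pM = (\<Sum>s\<le>N. monom (if s = 0 then 0 else [:\<mu> s:]) s)"
  shows "coeff (resid1 k m pA pB pM) s = 0" "coeff (resid2 k m pA pB pM) s = 0"
proof -
  have 0: "A 0 = 1" "B 0 = 0" using rec by (simp_all add: lame_recursion_def)
  have cA: "coeff pA i = A i" and cB: "coeff pB i = B i" and cM: "coeff pM i = (if i = 0 then 0 else [:\<mu> i:])"
    if "i \<le> N" for i
    using that unfolding pA pB pM coeff_truncated_sum by simp_all
  have dA: "coeff (map_poly pderiv pA) i = pderiv (A i)" "coeff (map_poly pderiv (map_poly pderiv pA)) i = pderiv (pderiv (A i))"
    and dB: "coeff (map_poly pderiv pB) i = pderiv (B i)" "coeff (map_poly pderiv (map_poly pderiv pB)) i = pderiv (pderiv (B i))"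
    if "i \<le> N" for i
    using cA[OF that] cB[OF that] by (simp_all add: coeff_map_poly)
  show "coeff (resid1 k m pA pB pM) s = 0" "coeff (resid2 k m pA pB pM) s = 0"
  proof (atomize (full), cases "s = 0")
    case True
    then show "coeff (resid1 k m pA pB pM) s = 0 \<and> coeff (resid2 k m pA pB pM) s = 0"
      using cA[of 0] cB[of 0] cM[of 0] dA[of 0] dB[of 0] 0
      by (simp add: resid1_def resid2_def coeff_mult_0)
  next
    case False
    then have s1: "1 \<le> s" by simp
    have e: "2 * pderiv (A s) + pderiv (pderiv (B s)) + lower_terms1 k m A B \<mu> s = 0"
      "pderiv (pderiv (A s)) + 2 * ttilde_poly m * pderiv (B s) + smult (1/2) ([:0, 1:] * B s) + [:\<mu> s:] + lower_terms2 k m A B \<mu> s = 0"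
      using rec s1 identity1_iff[of s B, OF s1 0(2)] identity2_iff[of s A, OF s1 0(1)]
      by (auto simp: lame_recursion_def)
    have p1: "coeff (pCons 0 p) s = coeff p (s - 1)" for p :: "real poly poly"
      using s1 by (cases s) auto
    have p2: "coeff (pCons 0 (pCons 0 p)) s = (if s = 1 then 0 else coeff p (s - 2))" for p :: "real poly poly"
      using s1 by (auto simp: coeff_pCons split: nat.split)
    have le: "s - 1 \<le> N" "s - 2 \<le> N" using s by auto
    have mB: "coeff (pM * pB) s = (\<Sum>j=1..<s. smult (\<mu> j) (B (s - j)))"
    proof -
      have "coeff (pM * pB) s = (\<Sum>i=1..<s. coeff pM i * coeff pB (s - i)) + coeff pM s * coeff pB (s - s)"
        unfolding coeff_mult using s1 cM[of 0] by (intro sum_atMost_1) auto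
      also have "(\<Sum>i=1..<s. coeff pM i * coeff pB (s - i)) = (\<Sum>j=1..<s. smult (\<mu> j) (B (s - j)))"
        using s by (intro sum.cong refl) (simp add: cM cB)
      finally show ?thesis using cB[of 0] 0 by simp
    qed
    have mA: "coeff (pM * pA) s = (\<Sum>j=1..<s. smult (\<mu> j) (A (s - j))) + [:\<mu> s:]"
    proof -
      have "coeff (pM * pA) s = (\<Sum>i=1..<s. coeff pM i * coeff pA (s - i)) + coeff pM s * coeff pA (s - s)"
        unfolding coeff_mult using s1 cM[of 0] by (intro sum_atMost_1) auto
      also have "(\<Sum>i=1..<s. coeff pM i * coeff pA (s - i)) = (\<Sum>j=1..<s. smult (\<mu> j) (A (s - j)))"
        using s by (intro sum.cong refl) (simp add: cM cA)
      finally show ?thesis using cA[of 0] 0 cM[OF s] s1 by simp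
    qed
    have "coeff (resid1 k m pA pB pM) s = 2 * pderiv (A s) + pderiv (pderiv (B s)) + lower_terms1 k m A B \<mu> s"
      unfolding resid1_def lower_terms1_def prev_term_def coeff_add coeff_diff coeff_smult p2 mB
      unfolding p1 coeff_add coeff_smult cA[OF s] cB[OF s] dA[OF s] dB[OF s] cA[OF le(1)] cB[OF le(1)] dA[OF le(1)] dB[OF le(1)]
         cA[OF le(2)] cB[OF le(2)] dA[OF le(2)] dB[OF le(2)]
      by (cases "s = 1") (use s1 in \<open>simp_all add: smult_add_right algebra_simps\<close>)
    moreover have "coeff (resid2 k m pA pB pM) s
      = pderiv (pderiv (A s)) + 2 * ttilde_poly m * pderiv (B s) + smult (1/2) ([:0, 1:] * B s) + [:\<mu> s:] + lower_terms2 k m A B \<mu> s"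
      unfolding resid2_def lower_terms2_def prev_term_def coeff_add coeff_diff coeff_smult p2 mA
      unfolding p1 coeff_add coeff_smult cA[OF s] cB[OF s] dA[OF s] dB[OF s] cA[OF le(1)] cB[OF le(1)] dA[OF le(1)] dB[OF le(1)]
         cA[OF le(2)] cB[OF le(2)] dA[OF le(2)] dB[OF le(2)]
      by (cases "s = 1") (use s1 in \<open>simp_all add: smult_add_right algebra_simps\<close>)
    ultimately show "coeff (resid1 k m pA pB pM) s = 0 \<and> coeff (resid2 k m pA pB pM) s = 0" using e by simp
  qed
qed

section \<open>The rescaled variable t and the quasimode\<close>

definition scaled_sn :: "real \<Rightarrow> real \<Rightarrow> real \<Rightarrow> real" where
  "scaled_sn k \<kappa> x = sqrt (2 * \<kappa>) * jacobi_sn k (x / sqrt (2 * \<kappa>))"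

definition scaled_sn' :: "real \<Rightarrow> real \<Rightarrow> real \<Rightarrow> real" where
  "scaled_sn' k \<kappa> x = jacobi_sn' k (x / sqrt (2 * \<kappa>))"

context
  fixes k \<kappa> :: real
  assumes k: "0 < k" "k < 1" and \<kappa>: "0 < \<kappa>"
begin

lemma scaled_sn_has_derivative: "(scaled_sn k \<kappa> has_real_derivative scaled_sn' k \<kappa> x) (at x)"
proof -
  have "((\<lambda>x. x / sqrt (2 * \<kappa>)) has_real_derivative 1 / sqrt (2 * \<kappa>)) (at x)"
    by (rule DERIV_cdivide[OF DERIV_ident])
  from DERIV_cmult[OF DERIV_chain2[OF sn_has_derivative[OF k] this], of "sqrt (2 * \<kappa>)"] show ?thesis
    using \<kappa> unfolding scaled_sn_def[abs_def] scaled_sn'_def by simp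
qed

lemma scaled_sn'_squared:
  "(scaled_sn' k \<kappa> x)\<^sup>2 = 1 - (1 + k\<^sup>2) * (1/\<kappa>) * (scaled_sn k \<kappa> x)\<^sup>2 / 2 + k\<^sup>2 * (1/\<kappa>)\<^sup>2 * (scaled_sn k \<kappa> x) ^ 4 / 4"
proof -
  have "(sqrt (2 * \<kappa>))\<^sup>2 = 2 * \<kappa>" using \<kappa> by simp
  moreover have "sqrt (2 * \<kappa>) ^ 4 = ((sqrt (2 * \<kappa>))\<^sup>2)\<^sup>2" by (simp only: power_mult[symmetric]) simp
  ultimately show ?thesis
    unfolding scaled_sn'_def sn'_squared[OF k] scaled_sn_def power_mult_distrib using \<kappa>
    by (simp add: field_simps power2_eq_square power4_eq_xxxx)
qed

lemma scaled_sn'_has_derivative: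
  "(scaled_sn' k \<kappa> has_real_derivative
     - (1 + k\<^sup>2) * (1/\<kappa>) * scaled_sn k \<kappa> x / 2 + k\<^sup>2 * (1/\<kappa>)\<^sup>2 * (scaled_sn k \<kappa> x) ^ 3 / 2) (at x)"
proof -
  let ?r = "sqrt (2 * \<kappa>)"
  have r: "?r * ?r = 2 * \<kappa>" "0 < ?r" using \<kappa> by simp_all
  have alg: "(- c * s + 2 * k\<^sup>2 * s ^ 3) * (1 / r) = - c * (2 / (r * r)) * (r * s) / 2 + k\<^sup>2 * (2 / (r * r))\<^sup>2 * (r * s) ^ 3 / 2"
    if "r \<noteq> 0" for c r s :: real
    using that by (simp add: field_simps power2_eq_square power3_eq_cube)
  have \<kappa>r: "1 / \<kappa> = 2 / (?r * ?r)" using r(1) by simp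
  have "((\<lambda>x. x / ?r) has_real_derivative 1 / ?r) (at x)"
    by (rule DERIV_cdivide[OF DERIV_ident])
  from DERIV_chain2[OF sn'_has_derivative[OF k] this]
  have "(scaled_sn' k \<kappa> has_real_derivative
     (- (1 + k\<^sup>2) * jacobi_sn k (x / ?r) + 2 * k\<^sup>2 * jacobi_sn k (x / ?r) ^ 3) * (1 / ?r)) (at x)"
    unfolding scaled_sn'_def[abs_def] .
  also have "(- (1 + k\<^sup>2) * jacobi_sn k (x / ?r) + 2 * k\<^sup>2 * jacobi_sn k (x / ?r) ^ 3) * (1 / ?r)
     = - (1 + k\<^sup>2) * (1/\<kappa>) * scaled_sn k \<kappa> x / 2 + k\<^sup>2 * (1/\<kappa>)\<^sup>2 * (scaled_sn k \<kappa> x) ^ 3 / 2"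
    unfolding \<kappa>r scaled_sn_def by (rule alg) (use r(2) in simp)
  finally show ?thesis .
qed

end

text \<open>With f = D a + D' b and D'' = \<tau> D, the left side is f'' t'^2 + f' t'', the second
  x-derivative of f(t(x)). Here \<open>K\<close> is k^2, \<open>e\<close> is \<epsilon>, and
  \<open>\<sigma>\<close> is the sum of the \<mu>_s \<epsilon>^s.\<close>

lemma resid_algebra:
  fixes D D1 a a1 a2 b b1 b2 \<tau> \<sigma> e t K :: real
  shows "(D * (a2 + t / 2 * b + 2 * \<tau> * b1 + \<tau> * a) + D1 * (2 * a1 + \<tau> * b + b2)) * (1 - (1 + K) * e * t\<^sup>2 / 2 + K * e\<^sup>2 * t ^ 4 / 4)
      + (D * (a1 + \<tau> * b) + D1 * (a + b1)) * (- (1 + K) * e * t / 2 + K * e\<^sup>2 * t ^ 3 / 2)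
    = (\<tau> - \<sigma>) * (D * a + D1 * b)
      + (D * (a2 + 2 * \<tau> * b1 + t / 2 * b + \<sigma> * a
        - (1 + K) * e * t / 2 * (t * a2 + a1 + t\<^sup>2 / 2 * b + \<tau> * (t * a + 2 * t * b1 + b))
        + K * e\<^sup>2 * t ^ 3 / 4 * (t * a2 + 2 * a1 + t\<^sup>2 / 2 * b + \<tau> * (t * a + 2 * t * b1 + 2 * b)))
       + D1 * (2 * a1 + b2 - (1 + K) * e * t / 2 * (2 * t * a1 + a + t * b2 + b1 + \<tau> * t * b)
        + K * e\<^sup>2 * t ^ 3 / 4 * (2 * t * a1 + 2 * a + t * b2 + 2 * b1 + \<tau> * t * b)
        + \<sigma> * b))"
  by (simp add: field_simps power2_eq_square power3_eq_cube power4_eq_xxxx)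

text \<open>This is h / (2 \<kappa>) for the truncated expansion of h, so the factor 2 before the
  \<mu>-sum has disappeared.\<close>

definition trunc_level :: "nat \<Rightarrow> (nat \<Rightarrow> real) \<Rightarrow> nat \<Rightarrow> real \<Rightarrow> real" where
  "trunc_level m \<mu> N \<kappa> = real m + 1/2 + (\<Sum>s=1..N. \<mu> s * (1/\<kappa>) ^ s)"

text \<open>\<open>C\<close> and \<open>d\<close> are parameters so that one choice can serve all
  \<kappa>. The last clause makes the Wronskian with the shooting solution start from zero.\<close>

definition is_quasimode where
  "is_quasimode k m \<mu> N \<kappa> W W' R C d \<longleftrightarrow>
    (\<forall>x. (W has_real_derivative W' x) (at x)) \<and>
    (\<forall>x. (W' has_real_derivative ((scaled_sn k \<kappa> x)\<^sup>2 / 4 - trunc_level m \<mu> N \<kappa>) * W x + R x) (at x)) \<and>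
    (\<forall>x. \<bar>W x - pcf m (scaled_sn k \<kappa> x)\<bar> \<le> (1/\<kappa>) * (C * (1 + \<bar>scaled_sn k \<kappa> x\<bar>) ^ d) * exp (- (scaled_sn k \<kappa> x)\<^sup>2 / 4)) \<and>
    (\<forall>x. \<bar>R x\<bar> \<le> (1/\<kappa>) ^ Suc N * (C * (1 + \<bar>scaled_sn k \<kappa> x\<bar>) ^ d) * exp (- (scaled_sn k \<kappa> x)\<^sup>2 / 4)) \<and>
    pcf m 0 * W' 0 = W 0 * pcf' m 0"

text \<open>Apart from the Gaussian factor, the residual is a polynomial in \<epsilon> and t. Its
  coefficients up to order N vanish by the recursion, so \<epsilon>^(N+1) factors out.\<close>

lemma quasimode:
  assumes k: "0 < k" "k < 1" and rec: "lame_recursion k m A B \<mu>"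
  shows "\<exists>C d. 0 \<le> C \<and> (\<forall>\<kappa>\<ge>1. \<exists>W W' R. is_quasimode k m \<mu> N \<kappa> W W' R C d)"
proof -
  define pA where "pA = (\<Sum>s\<le>N. monom (A s) s)"
  define pB where "pB = (\<Sum>s\<le>N. monom (B s) s)"
  define pM where "pM = (\<Sum>s\<le>N. monom (if s = 0 then 0 else [:\<mu> s:]) s)"
  define H where "H = hermite m"
  define H1 where "H1 = pderiv (hermite m) - smult (1/2) ([:0, 1:] * hermite m)"
  \<comment> \<open>\<open>G\<close> is W - D_m(t) and \<open>E\<close> the residual, both divided
    by exp (- t^2 / 4). \<open>G\<close> has no term of order 0 because \<open>A 0 = 1\<close> and
    \<open>B 0 = 0\<close>.\<close>
  define G where "G = smult H (pA - 1) + smult H1 pB"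
  define E where "E = smult H (resid2 k m pA pB pM) + smult H1 (resid1 k m pA pB pM)"
  have par: "even_poly (A s)" "odd_poly (B s)" for s
    using rec by (cases "s = 0"; auto simp: lame_recursion_def even_poly_def odd_poly_def)+
  have 0: "A 0 = 1" "B 0 = 0" using rec by (simp_all add: lame_recursion_def)
  have "coeff G s = 0" if "s < 1" for s
    using that 0 by (simp add: G_def pA_def pB_def coeff_sum)
  from bivariate_small[of 1 G, OF this] obtain C1 d1 where C1: "0 \<le> C1"
    "\<And>e t. 0 \<le> e \<Longrightarrow> e \<le> 1 \<Longrightarrow> \<bar>poly (poly G [:e:]) t\<bar> \<le> e ^ 1 * (C1 * (1 + \<bar>t\<bar>) ^ d1)" by blast
  have "coeff E s = 0" if "s < Suc N" for s
    using that resid_coeff_0[OF rec _ pA_def pB_def pM_def, of s] by (simp add: E_def)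
  from bivariate_small[of "Suc N" E, OF this] obtain C2 d2 where C2: "0 \<le> C2"
    "\<And>e t. 0 \<le> e \<Longrightarrow> e \<le> 1 \<Longrightarrow> \<bar>poly (poly E [:e:]) t\<bar> \<le> e ^ Suc N * (C2 * (1 + \<bar>t\<bar>) ^ d2)" by blast
  define C where "C = C1 + C2"
  define d where "d = max d1 d2"
  have C: "C1 * (1 + \<bar>t\<bar>) ^ d1 \<le> C * (1 + \<bar>t\<bar>) ^ d" "C2 * (1 + \<bar>t\<bar>) ^ d2 \<le> C * (1 + \<bar>t\<bar>) ^ d" for t
  proof -
    have "C1 * (1 + \<bar>t\<bar>) ^ d1 + C2 * (1 + \<bar>t\<bar>) ^ d2 \<le> C * (1 + \<bar>t\<bar>) ^ d"
      unfolding C_def d_def by (rule growth_combine[OF C1(1) C2(1)]) simp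
    moreover have "0 \<le> C1 * (1 + \<bar>t\<bar>) ^ d1" "0 \<le> C2 * (1 + \<bar>t\<bar>) ^ d2"
      using C1(1) C2(1) by simp_all
    ultimately show "C1 * (1 + \<bar>t\<bar>) ^ d1 \<le> C * (1 + \<bar>t\<bar>) ^ d" "C2 * (1 + \<bar>t\<bar>) ^ d2 \<le> C * (1 + \<bar>t\<bar>) ^ d"
      by linarith+
  qed
  have main: "\<exists>W W' R. is_quasimode k m \<mu> N \<kappa> W W' R C d" if "1 \<le> \<kappa>" for \<kappa>
  proof -
    have \<kappa>: "0 < \<kappa>" using that by simp
    define e where "e = 1 / \<kappa>"
    have e: "0 \<le> e" "e \<le> 1" using that by (auto simp: e_def)
    define a where "a = poly pA [:e:]"
    define b where "b = poly pB [:e:]"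
    define \<sigma> where "\<sigma> = (\<Sum>s=1..N. \<mu> s * e ^ s)"
    have \<sigma>: "poly (poly pM [:e:]) t = \<sigma>" for t
    proof -
      have "poly (poly pM [:e:]) t = (\<Sum>s\<le>N. (if s = 0 then 0 else \<mu> s) * e ^ s)"
        unfolding pM_def poly_sum by (intro sum.cong) (auto simp: poly_monom)
      also have "\<dots> = \<sigma>" unfolding \<sigma>_def by (rule sum.mono_neutral_cong_right) auto
      finally show ?thesis .
    qed
    define f where "f t = pcf m t * poly a t + pcf' m t * poly b t" for t
    define f1 where "f1 t = pcf m t * (poly (pderiv a) t + ttilde m t * poly b t) + pcf' m t * (poly a t + poly (pderiv b) t)" for t
    define f2 where "f2 t = pcf m t * (poly (pderiv (pderiv a)) t + t / 2 * poly b t + 2 * ttilde m t * poly (pderiv b) t + ttilde m t * poly a t)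
      + pcf' m t * (2 * poly (pderiv a) t + ttilde m t * poly b t + poly (pderiv (pderiv b)) t)" for t
    have tt: "((\<lambda>t. ttilde m t) has_real_derivative t / 2) (at t)" for t
      unfolding ttilde_def by (auto intro!: derivative_eq_intros)
    have df: "(f has_real_derivative f1 t) (at t)" for t
      unfolding f_def[abs_def] f1_def
      by (rule derivative_eq_intros pcf_has_derivative pcf'_has_derivative poly_DERIV refl)+ (simp add: algebra_simps)
    have df1: "(f1 has_real_derivative f2 t) (at t)" for t
      unfolding f1_def[abs_def] f2_def
      by (rule derivative_eq_intros pcf_has_derivative pcf'_has_derivative poly_DERIV tt refl)+ (simp add: algebra_simps)
    let ?t = "scaled_sn k \<kappa>" and ?t1 = "scaled_sn' k \<kappa>"
    note dt = scaled_sn_has_derivative[OF k \<kappa>] and dt1 = scaled_sn'_has_derivative[OF k \<kappa>, folded e_def]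
      and sq = scaled_sn'_squared[OF k \<kappa>, folded e_def]
    define W where "W x = f (?t x)" for x
    define W' where "W' x = f1 (?t x) * ?t1 x" for x
    define \<rho> where "\<rho> t = exp (- t\<^sup>2 / 4) * poly (poly E [:e:]) t" for t
    have dW: "(W has_real_derivative W' x) (at x)" for x
      unfolding W_def[abs_def] W'_def by (rule DERIV_chain2[OF df dt])
    have key: "f2 t * (1 - (1 + k\<^sup>2) * e * t\<^sup>2 / 2 + k\<^sup>2 * e\<^sup>2 * t ^ 4 / 4)
        + f1 t * (- (1 + k\<^sup>2) * e * t / 2 + k\<^sup>2 * e\<^sup>2 * t ^ 3 / 2)
      = (t\<^sup>2 / 4 - (real m + 1/2 + \<sigma>)) * f t + \<rho> t" for t
    proof -
      have "\<rho> t = pcf m t * poly (poly (resid2 k m pA pB pM) [:e:]) t + pcf' m t * poly (poly (resid1 k m pA pB pM) [:e:]) t"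
        unfolding \<rho>_def E_def pcf_def pcf'_def H_def H1_def by (simp add: algebra_simps)
      moreover have "poly (poly (resid1 k m pA pB pM) [:e:]) t = 
        2 * poly (pderiv a) t + poly (pderiv (pderiv b)) t
        - (1 + k\<^sup>2) * e * t / 2 * (2 * t * poly (pderiv a) t + poly a t + t * poly (pderiv (pderiv b)) t + poly (pderiv b) t + ttilde m t * t * poly b t)
        + k\<^sup>2 * e\<^sup>2 * t ^ 3 / 4 * (2 * t * poly (pderiv a) t + 2 * poly a t + t * poly (pderiv (pderiv b)) t + 2 * poly (pderiv b) t + ttilde m t * t * poly b t)
        + \<sigma> * poly b t"
        unfolding resid1_def a_def b_def
        by (simp add: poly_map_pderiv \<sigma> poly_ttilde power2_eq_square power3_eq_cube algebra_simps)
      moreover have "poly (poly (resid2 k m pA pB pM) [:e:]) t = 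
        poly (pderiv (pderiv a)) t + 2 * ttilde m t * poly (pderiv b) t + t / 2 * poly b t + \<sigma> * poly a t
        - (1 + k\<^sup>2) * e * t / 2 * (t * poly (pderiv (pderiv a)) t + poly (pderiv a) t + t\<^sup>2 / 2 * poly b t
            + ttilde m t * (t * poly a t + 2 * t * poly (pderiv b) t + poly b t))
        + k\<^sup>2 * e\<^sup>2 * t ^ 3 / 4 * (t * poly (pderiv (pderiv a)) t + 2 * poly (pderiv a) t + t\<^sup>2 / 2 * poly b t
            + ttilde m t * (t * poly a t + 2 * t * poly (pderiv b) t + 2 * poly b t))"
        unfolding resid2_def a_def b_def
        by (simp add: poly_map_pderiv \<sigma> poly_ttilde power2_eq_square power3_eq_cube algebra_simps)
      moreover have "t\<^sup>2 / 4 - (real m + 1/2 + \<sigma>) = ttilde m t - \<sigma>" by (simp add: ttilde_def)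
      ultimately show ?thesis
        unfolding f_def f1_def f2_def by (simp only: resid_algebra[where \<sigma> = \<sigma>])
    qed
    have dW': "(W' has_real_derivative ((?t x)\<^sup>2 / 4 - (real m + 1/2 + \<sigma>)) * W x + \<rho> (?t x)) (at x)" for x
    proof -
      have "(W' has_real_derivative f2 (?t x) * (?t1 x)\<^sup>2
         + f1 (?t x) * (- (1 + k\<^sup>2) * e * ?t x / 2 + k\<^sup>2 * e\<^sup>2 * (?t x) ^ 3 / 2)) (at x)"
        unfolding W'_def[abs_def]
        by (rule DERIV_cong[OF DERIV_mult[OF DERIV_chain2[OF df1 dt] dt1]]) (simp only: power2_eq_square ac_simps)
      then show ?thesis unfolding sq key W_def .
    qed
    have close: "\<bar>W x - pcf m (?t x)\<bar> \<le> e * (C * (1 + \<bar>?t x\<bar>) ^ d) * exp (- (?t x)\<^sup>2 / 4)" for x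
    proof -
      let ?s = "?t x"
      have "W x - pcf m ?s = exp (- ?s\<^sup>2 / 4) * poly (poly G [:e:]) ?s"
        unfolding W_def f_def pcf_def pcf'_def G_def H_def H1_def a_def b_def by (simp add: algebra_simps)
      then have "\<bar>W x - pcf m ?s\<bar> = \<bar>poly (poly G [:e:]) ?s\<bar> * exp (- ?s\<^sup>2 / 4)" by (simp add: abs_mult)
      also have "\<dots> \<le> e * (C * (1 + \<bar>?s\<bar>) ^ d) * exp (- ?s\<^sup>2 / 4)"
        using C1(2)[OF e, of ?s] mult_left_mono[OF C(1)[of ?s] e(1)] by (intro mult_right_mono) auto
      finally show ?thesis .
    qed
    have small: "\<bar>\<rho> (?t x)\<bar> \<le> e ^ Suc N * (C * (1 + \<bar>?t x\<bar>) ^ d) * exp (- (?t x)\<^sup>2 / 4)" for x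
    proof -
      let ?s = "?t x"
      have "\<bar>\<rho> ?s\<bar> = \<bar>poly (poly E [:e:]) ?s\<bar> * exp (- ?s\<^sup>2 / 4)" by (simp add: \<rho>_def abs_mult)
      also have "\<dots> \<le> e ^ Suc N * (C * (1 + \<bar>?s\<bar>) ^ d) * exp (- ?s\<^sup>2 / 4)"
        using C2(2)[OF e, of ?s] mult_left_mono[OF C(2)[of ?s], of "e ^ Suc N"] e(1) by (intro mult_right_mono) auto
      finally show ?thesis .
    qed
    have t0: "?t 0 = 0" "?t1 0 = 1" by (simp_all add: scaled_sn_def scaled_sn'_def sn_0[OF k] sn'_0[OF k])
    have "poly (poly (\<Sum>s\<le>N. monom (A s) s) [:e:]) t = (\<Sum>s\<le>N. poly (A s) t * e ^ s)"
       "poly (poly (\<Sum>s\<le>N. monom (B s) s) [:e:]) t = (\<Sum>s\<le>N. poly (B s) t * e ^ s)" for t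
      by (simp_all add: poly_sum poly_monom)
    then have "even_poly a" "odd_poly b" 
      using par by (simp_all add: a_def b_def pA_def pB_def even_poly_def odd_poly_def sum_negf[symmetric])
    have odd0: "poly p 0 = 0" if "odd_poly p" for p using that unfolding odd_poly_def by (metis add.inverse_neutral equal_neg_zero)
    have a0: "poly (pderiv a) 0 = 0" "poly b 0 = 0" 
      using odd0 parity_pderiv(1) \<open>even_poly a\<close> \<open>odd_poly b\<close> by blast+
    \<comment> \<open>Since a' and b vanish at 0, the Wronskian of W with D_m at the centre is
      D_m(0) D_m'(0) times b'(0); by parity one of the first two factors is zero.\<close>
    have "pcf m 0 = 0 \<or> pcf' m 0 = 0"
    proof (cases "even m")
      case True
      then have "even_poly (hermite m)" by (simp add: even_poly_def hermite_parity)
      then show ?thesis using odd0[OF parity_pderiv(1)] by (simp add: pcf'_def)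
    next
      case False
      then have "odd_poly (hermite m)" by (simp add: odd_poly_def hermite_parity)
      then show ?thesis using odd0 by (simp add: pcf_def)
    qed
    then have "pcf m 0 * W' 0 = W 0 * pcf' m 0"
      unfolding W_def W'_def t0 f_def f1_def by (auto simp: a0)
    then show ?thesis
      using dW dW' close small unfolding is_quasimode_def trunc_level_def e_def \<sigma>_def
      by (intro exI[of _ W] exI[of _ W'] exI[of _ "\<lambda>x. \<rho> (?t x)"]) simp
  qed
  have "0 \<le> C" using C1(1) C2(1) by (simp add: C_def)
  with main show ?thesis by blast
qed

section \<open>Shooting from the centre\<close>

lemma deriv_nonpos_at_first_zero:
  fixes y :: "real \<Rightarrow> real"
  assumes "(y has_real_derivative D) (at c)" "a < c" "y c = 0" "\<And>x. a \<le> x \<Longrightarrow> x < c \<Longrightarrow> 0 < y x"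
  shows "D \<le> 0"
proof (rule ccontr)
  assume "\<not> D \<le> 0"
  then have "0 < D" by simp
  then obtain d where d: "d > 0" "\<And>h. 0 < h \<Longrightarrow> h < d \<Longrightarrow> y (c - h) < y c"
    using has_real_derivative_pos_inc_left[OF assms(1)] by auto
  define h where "h = min (d / 2) (c - a)"
  have "0 < h" "h < d" "a \<le> c - h" using d(1) assms(2) by (auto simp: h_def)
  then show False using d(2)[of h] assms(4)[of "c - h"] assms(3) by simp
qed

text \<open>With \<open>F = y W' - W y'\<close> one has \<open>F' = y R + (l - l\<^sub>0) y W\<close> and \<open>(y / W)' = - F / W\<^sup>2\<close>.
  As \<open>W\<close> decays, a definite sign of \<open>F\<close> drives \<open>y / W\<close> far away from its value at \<open>T\<close>.\<close>

locale shooting =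
  fixes y y' W W' Q R :: "real \<Rightarrow> real" and l l0 \<delta> T S X c E :: real
  assumes dy: "\<And>x. T \<le> x \<Longrightarrow> x \<le> X \<Longrightarrow> (y has_real_derivative y' x) (at x)"
    and dy': "\<And>x. T \<le> x \<Longrightarrow> x \<le> X \<Longrightarrow> (y' has_real_derivative (Q x - l) * y x) (at x)"
    and dW: "\<And>x. T \<le> x \<Longrightarrow> x \<le> S \<Longrightarrow> (W has_real_derivative W' x) (at x)"
    and dW': "\<And>x. T \<le> x \<Longrightarrow> x \<le> S \<Longrightarrow> (W' has_real_derivative (Q x - l0) * W x + R x) (at x)"
    and TS: "T \<le> S - 1" and SX: "S < X"
    and Q: "\<And>x. T \<le> x \<Longrightarrow> x \<le> X \<Longrightarrow> l \<le> Q x"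
    and W_pos: "\<And>x. T \<le> x \<Longrightarrow> x \<le> S \<Longrightarrow> 0 < W x"
    and R_le: "\<And>x. T \<le> x \<Longrightarrow> x \<le> S \<Longrightarrow> \<bar>R x\<bar> \<le> \<delta> * W x"
    and y_T: "0 < y T"
    and c: "0 < c" and E: "\<And>x. S - 1 \<le> x \<Longrightarrow> x \<le> S \<Longrightarrow> E \<le> 1 / (W x)\<^sup>2"
begin

definition "F x = y x * W' x - W x * y' x"

lemma dF: "T \<le> x \<Longrightarrow> x \<le> S \<Longrightarrow> (F has_real_derivative y x * (R x + (l - l0) * W x)) (at x)"
  unfolding F_def using dy[of x] dy'[of x] dW[of x] dW'[of x] SX
  by (auto intro!: derivative_eq_intros simp: algebra_simps)

lemma dquot: "T \<le> x \<Longrightarrow> x \<le> S \<Longrightarrow> ((\<lambda>x. y x / W x) has_real_derivative - F x / (W x)\<^sup>2) (at x)"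
  unfolding F_def using DERIV_divide[OF dy[of x] dW[of x]] W_pos[of x] SX
  by (simp add: power2_eq_square algebra_simps)

lemma cont_y: "continuous_on {T..S} y"
  by (rule continuous_at_imp_continuous_on, rule ballI, rule DERIV_isCont, rule dy) (use SX in auto)

text \<open>As long as y \<ge> 0, F increases because |R| \<le> \<delta> W, so F stays above
  \<open>c\<close>. If y were positive up to \<open>S\<close>, the quotient y / W would fall by c E
  on the last unit interval, more than its initial value. At the first zero F = - W y' > 0 makes the
  slope negative, and convexity carries both signs to \<open>X\<close>.\<close>

lemma overshoot:
  assumes l: "l = l0 + \<delta>" and F_T: "c \<le> F T" and big: "y T < W T * (c * E)"
  shows "y X < 0 \<and> y' X < 0"
proof -
  have F_ge: "c \<le> F x" if "T \<le> x" "x \<le> S" "\<And>u. T \<le> u \<Longrightarrow> u \<le> x \<Longrightarrow> 0 \<le> y u" for x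
  proof -
    have "F T \<le> F x"
    proof (rule DERIV_nonneg_imp_nondecreasing[OF that(1)])
      fix u assume u: "T \<le> u" "u \<le> x"
      then have "0 \<le> y u * (R u + (l - l0) * W u)"
        using that(2) by (intro mult_nonneg_nonneg that(3)) (use R_le[of u] l in auto)
      then show "\<exists>D. (F has_real_derivative D) (at u) \<and> 0 \<le> D" using dF[of u] u that(2) by auto
    qed
    then show ?thesis using F_T by simp
  qed
  have "\<exists>x\<in>{T..S}. y x \<le> 0"
  proof (rule ccontr)
    assume "\<not> (\<exists>x\<in>{T..S}. y x \<le> 0)"
    then have pos: "0 < y x" if "T \<le> x" "x \<le> S" for x using that by force
    have Fc: "c \<le> F x" if "T \<le> x" "x \<le> S" for x using that pos by (intro F_ge) (auto intro: less_imp_le)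
    have "y (S - 1) / W (S - 1) \<le> y T / W T"
    proof (rule DERIV_nonpos_imp_nonincreasing[OF TS])
      fix u assume "T \<le> u" "u \<le> S - 1"
      then show "\<exists>D. ((\<lambda>x. y x / W x) has_real_derivative D) (at u) \<and> D \<le> 0"
        using dquot[of u] Fc[of u] c by (intro exI[of _ "- F u / (W u)\<^sup>2"]) auto
    qed
    moreover obtain z where z: "S - 1 < z" "z < S" "y S / W S - y (S - 1) / W (S - 1) = (S - (S - 1)) * (- F z / (W z)\<^sup>2)"
      using MVT2[of "S - 1" S "\<lambda>x. y x / W x" "\<lambda>x. - F x / (W x)\<^sup>2"] dquot TS by auto
    moreover have "c * E \<le> F z / (W z)\<^sup>2"
    proof -
      have "c * E \<le> c * (1 / (W z)\<^sup>2)" using E[of z] z c by (intro mult_left_mono) auto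
      also have "\<dots> \<le> F z * (1 / (W z)\<^sup>2)" using Fc[of z] z TS by (intro mult_right_mono) auto
      finally show ?thesis by simp
    qed
    ultimately have "y S / W S \<le> y T / W T - c * E" by simp
    also have "\<dots> < 0" using big W_pos[of T] TS by (simp add: field_simps)
    finally show False using pos[of S] W_pos[of S] TS by (simp add: field_simps)
  qed
  then obtain x where x: "x \<in> {T..S}" "y x \<le> 0" by blast
  obtain x0 where x0: "T < x0" "x0 \<le> x" "y x0 = 0" "\<And>u. T \<le> u \<Longrightarrow> u < x0 \<Longrightarrow> 0 < y u"
    by (rule first_nonpos[OF cont_y y_T x]) blast
  have S: "x0 \<le> S" using x(1) x0(2) by simp
  have "0 \<le> y u" if "T \<le> u" "u \<le> x0" for u
    using x0(3,4) that by (cases "u = x0") (auto intro: less_imp_le)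
  then have "c \<le> F x0" using x0(1) S by (intro F_ge) auto
  then have "0 < W x0 * - y' x0" using x0(3) c by (simp add: F_def)
  then have neg: "y' x0 < 0" using W_pos[of x0] x0(1) S by (simp add: zero_less_mult_iff mult_less_0_iff)
  have "0 < - y X \<and> 0 < - y' X"
    by (rule convex_growth[where y = "\<lambda>x. - y x" and y' = "\<lambda>x. - y' x" and p = "\<lambda>x. Q x - l" and a = x0])
      (use dy dy' Q x0 S SX neg in \<open>auto intro!: derivative_eq_intros\<close>)
  then show ?thesis by simp
qed

text \<open>Now F stays below \<open>- c\<close>, so at a first zero y' would be positive, although
  y came down from positive values. Hence y / W rises by c E. The assumption involves
  \<open>W S\<close>, not \<open>W T\<close>, because y itself has to exceed \<open>y T\<close> at
  \<open>S\<close>; the mean value theorem then gives a point of positive slope from which convexity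
  takes over.\<close>

lemma undershoot:
  assumes l: "l = l0 - \<delta>" and F_T: "F T \<le> - c" and big: "y T < W S * (c * E)"
  shows "0 < y X \<and> 0 < y' X"
proof -
  have F_le: "F x \<le> - c" if "T \<le> x" "x \<le> S" "\<And>u. T \<le> u \<Longrightarrow> u \<le> x \<Longrightarrow> 0 \<le> y u" for x
  proof -
    have "F x \<le> F T"
    proof (rule DERIV_nonpos_imp_nonincreasing[OF that(1)])
      fix u assume u: "T \<le> u" "u \<le> x"
      then have "y u * (R u + (l - l0) * W u) \<le> 0"
        using that(2) by (intro mult_nonneg_nonpos that(3)) (use R_le[of u] l in auto)
      then show "\<exists>D. (F has_real_derivative D) (at u) \<and> D \<le> 0" using dF[of u] u that(2) by auto
    qed
    then show ?thesis using F_T by simp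
  qed
  have pos: "0 < y x" if x: "x \<in> {T..S}" for x
  proof (rule ccontr)
    assume "\<not> 0 < y x"
    then have "y x \<le> 0" by simp
    obtain x0 where x0: "T < x0" "x0 \<le> x" "y x0 = 0" "\<And>u. T \<le> u \<Longrightarrow> u < x0 \<Longrightarrow> 0 < y u"
      by (rule first_nonpos[OF cont_y y_T x \<open>y x \<le> 0\<close>]) blast
    have S: "x0 \<le> S" using x x0(2) by simp
    have "0 \<le> y u" if "T \<le> u" "u \<le> x0" for u
      using x0(3,4) that by (cases "u = x0") (auto intro: less_imp_le)
    then have "F x0 \<le> - c" using x0(1) S by (intro F_le) auto
    then have "0 < W x0 * y' x0" using x0(3) c by (simp add: F_def)
    then have "0 < y' x0" using W_pos[of x0] x0(1) S by (simp add: zero_less_mult_iff)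
    moreover have "y' x0 \<le> 0"
      using deriv_nonpos_at_first_zero[OF dy x0(1,3,4)] x0(1) S SX by simp
    ultimately show False by simp
  qed
  have Fc: "F x \<le> - c" if "T \<le> x" "x \<le> S" for x using that pos by (intro F_le) (auto intro: less_imp_le)
  have "y T / W T \<le> y (S - 1) / W (S - 1)"
  proof (rule DERIV_nonneg_imp_nondecreasing[OF TS])
    fix u assume "T \<le> u" "u \<le> S - 1"
    then show "\<exists>D. ((\<lambda>x. y x / W x) has_real_derivative D) (at u) \<and> 0 \<le> D"
      using dquot[of u] Fc[of u] c by (intro exI[of _ "- F u / (W u)\<^sup>2"]) (auto intro: divide_nonpos_nonneg)
  qed
  moreover have "0 < y T / W T" using y_T W_pos[of T] TS by simp
  moreover obtain z where z: "S - 1 < z" "z < S" "y S / W S - y (S - 1) / W (S - 1) = (S - (S - 1)) * (- F z / (W z)\<^sup>2)"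
    using MVT2[of "S - 1" S "\<lambda>x. y x / W x" "\<lambda>x. - F x / (W x)\<^sup>2"] dquot TS by auto
  moreover have "c * E \<le> - F z / (W z)\<^sup>2"
  proof -
    have "c * E \<le> c * (1 / (W z)\<^sup>2)" using E[of z] z c by (intro mult_left_mono) auto
    also have "\<dots> \<le> - F z * (1 / (W z)\<^sup>2)" using Fc[of z] z TS by (intro mult_right_mono) auto
    finally show ?thesis by simp
  qed
  ultimately have "c * E \<le> y S / W S" by simp
  then have "W S * (c * E) \<le> y S" using W_pos[of S] TS by (simp add: field_simps)
  then have "y T < y S" using big by simp
  moreover obtain z where z: "T < z" "z < S" "y S - y T = (S - T) * y' z"
    using MVT2[of T S y y'] dy SX TS by auto
  ultimately have "0 < (S - T) * y' z" by simp
  then have z': "0 < y' z" using TS by (simp add: zero_less_mult_iff)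
  show ?thesis
    by (rule convex_growth[where p = "\<lambda>x. Q x - l" and a = z])
      (use dy dy' Q z z' pos[of z] SX in auto)
qed

end

section \<open>Elementary bounds for t(x)\<close>

context
  fixes k \<kappa> :: real
  assumes k: "0 < k" "k < 1" and \<kappa>: "0 < \<kappa>"
begin

lemma scaled_sn_0: "scaled_sn k \<kappa> 0 = 0"
  by (simp add: scaled_sn_def sn_0[OF k])

lemma scaled_sn_minus: "scaled_sn k \<kappa> (- x) = - scaled_sn k \<kappa> x"
  by (simp add: scaled_sn_def sn_minus[OF k])

lemma isCont_scaled_sn: "isCont (scaled_sn k \<kappa>) x"
  by (rule DERIV_isCont[OF scaled_sn_has_derivative[OF k \<kappa>]])

lemma scaled_sn_lipschitz: "\<bar>scaled_sn k \<kappa> x - scaled_sn k \<kappa> y\<bar> \<le> \<bar>x - y\<bar>"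
proof -
  have *: "\<bar>scaled_sn k \<kappa> x - scaled_sn k \<kappa> y\<bar> \<le> \<bar>x - y\<bar>" if xy: "x < y" for x y
  proof -
    obtain z where "scaled_sn k \<kappa> y - scaled_sn k \<kappa> x = (y - x) * scaled_sn' k \<kappa> z"
      using MVT2[OF xy, of "scaled_sn k \<kappa>" "scaled_sn' k \<kappa>"] scaled_sn_has_derivative[OF k \<kappa>] by blast
    then have "\<bar>scaled_sn k \<kappa> y - scaled_sn k \<kappa> x\<bar> = \<bar>y - x\<bar> * \<bar>scaled_sn' k \<kappa> z\<bar>"
      by (simp add: abs_mult)
    also have "\<dots> \<le> \<bar>y - x\<bar> * 1"
      unfolding scaled_sn'_def by (intro mult_left_mono abs_sn'_le_1[OF k]) simp
    finally show ?thesis by (simp add: abs_minus_commute)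
  qed
  show ?thesis using *[of x y] *[of y x] by (cases x y rule: linorder_cases) (auto simp: abs_minus_commute)
qed

lemma scaled_sn_mono:
  assumes "0 \<le> x" "x \<le> y" "y \<le> sqrt (2 * \<kappa>) * ellK k"
  shows "scaled_sn k \<kappa> x \<le> scaled_sn k \<kappa> y"
  unfolding scaled_sn_def using \<kappa> assms
  by (intro mult_left_mono sn_mono[OF k]) (auto simp: field_simps divide_right_mono)

lemma scaled_sn_end: "scaled_sn k \<kappa> (sqrt (2 * \<kappa>) * ellK k) = sqrt (2 * \<kappa>)"
  using \<kappa> by (simp add: scaled_sn_def sn_ellK[OF k])

end

text \<open>Since sn has derivative 1 at 0, t(x) tends to x uniformly on bounded intervals, and
  there the equation tends to that of D_m.\<close>

lemma scaled_sn_near_id: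
  assumes k: "0 < k" "k < 1" and e: "0 < e"
  shows "eventually (\<lambda>\<kappa>. \<forall>x. \<bar>x\<bar> \<le> T \<longrightarrow> \<bar>scaled_sn k \<kappa> x - x\<bar> \<le> e) at_top"
proof -
  define h where "h = e / (\<bar>T\<bar> + 1)"
  have h: "0 < h" using e by (simp add: h_def)
  have "(jacobi_sn k has_real_derivative 1) (at 0)"
    using sn_has_derivative[OF k, of 0] sn'_0[OF k] by simp
  then have "((\<lambda>z. jacobi_sn k z / z) \<longlongrightarrow> 1) (at 0)"
    by (simp add: has_field_derivative_iff sn_0[OF k])
  from tendstoD[OF this h] obtain r where r: "0 < r" "\<And>z. z \<noteq> 0 \<Longrightarrow> \<bar>z\<bar> < r \<Longrightarrow> \<bar>jacobi_sn k z / z - 1\<bar> < h"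
    unfolding eventually_at dist_real_def by auto
  have sn: "\<bar>jacobi_sn k z - z\<bar> \<le> h * \<bar>z\<bar>" if "\<bar>z\<bar> < r" for z
  proof (cases "z = 0")
    case False
    have "jacobi_sn k z - z = (jacobi_sn k z / z - 1) * z" using False by (simp add: field_simps)
    then have "\<bar>jacobi_sn k z - z\<bar> = \<bar>jacobi_sn k z / z - 1\<bar> * \<bar>z\<bar>" by (simp only: abs_mult)
    also have "\<dots> \<le> h * \<bar>z\<bar>" using r(2)[OF False that] by (intro mult_right_mono) auto
    finally show ?thesis .
  qed (simp add: sn_0[OF k])
  have "filterlim (\<lambda>\<kappa>. sqrt (2 * \<kappa>)) at_top at_top"
    by real_asymp
  then have "eventually (\<lambda>\<kappa>. \<bar>T\<bar> / r < sqrt (2 * \<kappa>)) at_top"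
    by (simp add: filterlim_at_top_dense)
  moreover have "eventually (\<lambda>\<kappa>::real. 0 < \<kappa>) at_top" by (rule eventually_gt_at_top)
  ultimately show ?thesis
  proof eventually_elim
    case (elim \<kappa>)
    have s: "0 < sqrt (2 * \<kappa>)" using elim(2) by simp
    show ?case
    proof (intro allI impI)
      fix x :: real assume x: "\<bar>x\<bar> \<le> T"
      let ?z = "x / sqrt (2 * \<kappa>)"
      have "\<bar>x\<bar> < r * sqrt (2 * \<kappa>)" using x elim(1) r(1) by (simp add: field_simps)
      then have "\<bar>?z\<bar> < r" using s by (simp add: field_simps)
      note sn[OF this]
      then have "sqrt (2 * \<kappa>) * \<bar>jacobi_sn k ?z - ?z\<bar> \<le> sqrt (2 * \<kappa>) * (h * \<bar>?z\<bar>)"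
        using s by (intro mult_left_mono) auto
      also have "sqrt (2 * \<kappa>) * \<bar>jacobi_sn k ?z - ?z\<bar> = \<bar>sqrt (2 * \<kappa>) * (jacobi_sn k ?z - ?z)\<bar>"
        using s by (simp add: abs_mult)
      also have "sqrt (2 * \<kappa>) * (jacobi_sn k ?z - ?z) = scaled_sn k \<kappa> x - x"
        using s by (simp add: scaled_sn_def right_diff_distrib)
      also have "sqrt (2 * \<kappa>) * (h * \<bar>?z\<bar>) = h * \<bar>x\<bar>" using s by simp
      also have "h * \<bar>x\<bar> \<le> h * (\<bar>T\<bar> + 1)" using h x by (intro mult_left_mono) auto
      also have "\<dots> = e" by (simp add: h_def)
      finally show "\<bar>scaled_sn k \<kappa> x - x\<bar> \<le> e" .
    qed
  qed
qed

section \<open>Dependence of solutions on the coefficients\<close>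

lemma continuous_bounded_Icc:
  fixes f :: "real \<Rightarrow> real"
  assumes "\<And>x. isCont f x"
  obtains B where "0 \<le> B" "\<And>x. a \<le> x \<Longrightarrow> x \<le> b \<Longrightarrow> \<bar>f x\<bar> \<le> B"
proof -
  have "compact (f ` {a..b})"
    using assms by (intro compact_continuous_image continuous_at_imp_continuous_on) auto
  then obtain B where B: "\<And>x. x \<in> {a..b} \<Longrightarrow> \<bar>f x\<bar> \<le> B"
    using compact_imp_bounded bounded_iff by (metis image_eqI real_norm_def)
  have "\<bar>f x\<bar> \<le> \<bar>B\<bar>" if "a \<le> x" "x \<le> b" for x using B[of x] that by auto
  then show thesis using that[of "\<bar>B\<bar>"] by simp
qed

lemma abs_le_of_squares:
  fixes d e r :: real
  assumes "d\<^sup>2 + e\<^sup>2 \<le> r\<^sup>2 * exp (2 * c)" "0 \<le> r"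
  shows "\<bar>d\<bar> \<le> r * exp c" "\<bar>e\<bar> \<le> r * exp c"
proof -
  have "exp (2 * c) = (exp c)\<^sup>2" by (simp add: power2_eq_square exp_add[symmetric])
  then have "d\<^sup>2 + e\<^sup>2 \<le> (r * exp c)\<^sup>2" using assms(1) by (simp add: power_mult_distrib)
  then have "d\<^sup>2 \<le> (r * exp c)\<^sup>2" "e\<^sup>2 \<le> (r * exp c)\<^sup>2"
    using zero_le_power2[of d] zero_le_power2[of e] by linarith+
  moreover have "0 \<le> r * exp c" using assms(2) by simp
  ultimately show "\<bar>d\<bar> \<le> r * exp c" "\<bar>e\<bar> \<le> r * exp c"
    by (auto simp: abs_le_square_iff[symmetric])
qed

lemma lipschitz_at_imp_isCont:
  fixes f :: "real \<Rightarrow> real"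
  assumes "\<And>l. \<bar>l - l0\<bar> \<le> 1 \<Longrightarrow> \<bar>f l - f l0\<bar> \<le> \<bar>l - l0\<bar> * C"
  shows "isCont f l0"
proof -
  have "((\<lambda>l. \<bar>l - l0\<bar> * C) \<longlongrightarrow> \<bar>l0 - l0\<bar> * C) (at l0)" by (intro tendsto_intros)
  then have "((\<lambda>l. \<bar>l - l0\<bar> * C) \<longlongrightarrow> 0) (at l0)" by simp
  then have "((\<lambda>l. f l - f l0) \<longlongrightarrow> 0) (at l0)"
  proof (rule Lim_null_comparison[rotated])
    show "eventually (\<lambda>l. norm (f l - f l0) \<le> \<bar>l - l0\<bar> * C) (at l0)"
      unfolding eventually_at dist_real_def using assms by (intro exI[of _ 1]) auto
  qed
  then show ?thesis unfolding isCont_def by (simp add: LIM_zero_iff)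
qed

text \<open>The difference of the solutions at \<open>l\<close> and \<open>l0\<close> has zero
  initial data and forcing - (l - l0) times the solution at \<open>l0\<close>, so Gronwall's
  estimate gives a local Lipschitz bound.\<close>

lemma solution_continuous_in_parameter:
  fixes Y Y' :: "real \<Rightarrow> real \<Rightarrow> real" and q :: "real \<Rightarrow> real"
  assumes q: "\<And>x. isCont q x"
    and Y: "\<And>l x. (Y l has_real_derivative Y' l x) (at x)" "\<And>l x. (Y' l has_real_derivative (q x - l) * Y l x) (at x)"
    and init: "\<And>l. Y l 0 = a" "\<And>l. Y' l 0 = b" and X: "0 \<le> X"
  shows "isCont (\<lambda>l. Y l X) l0" "isCont (\<lambda>l. Y' l X) l0"
proof -
  obtain B where B: "0 \<le> B" "\<And>x. 0 \<le> x \<Longrightarrow> x \<le> X \<Longrightarrow> \<bar>Y l0 x\<bar> \<le> B"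
    using continuous_bounded_Icc[of "Y l0" 0 X] DERIV_isCont[OF Y(1)] by blast
  obtain Mq where Mq: "0 \<le> Mq" "\<And>x. 0 \<le> x \<Longrightarrow> x \<le> X \<Longrightarrow> \<bar>q x\<bar> \<le> Mq"
    using continuous_bounded_Icc[of q 0 X] q by blast
  define M where "M = Mq + \<bar>l0\<bar> + 1"
  define C where "C = B * exp ((M + 2) * X / 2)"
  have *: "\<bar>Y l X - Y l0 X\<bar> \<le> \<bar>l - l0\<bar> * C \<and> \<bar>Y' l X - Y' l0 X\<bar> \<le> \<bar>l - l0\<bar> * C" if l: "\<bar>l - l0\<bar> \<le> 1" for l
  proof -
    have "(Y l X - Y l0 X)\<^sup>2 + (Y' l X - Y' l0 X)\<^sup>2
       \<le> ((Y l 0 - Y l0 0)\<^sup>2 + (Y' l 0 - Y' l0 0)\<^sup>2 + (\<bar>l - l0\<bar> * B)\<^sup>2) * exp ((M + 2) * (X - 0))"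
    proof (rule gronwall_second_order[where p = "\<lambda>x. q x - l" and r = "\<lambda>x. - (l - l0) * Y l0 x" and a = 0 and b = X])
      fix x assume x: "0 \<le> x" "x \<le> X"
      show "((\<lambda>x. Y l x - Y l0 x) has_real_derivative Y' l x - Y' l0 x) (at x)"
        by (intro DERIV_diff Y)
      show "((\<lambda>x. Y' l x - Y' l0 x) has_real_derivative (q x - l) * (Y l x - Y l0 x) + - (l - l0) * Y l0 x) (at x)"
        using DERIV_diff[OF Y(2)[of l x] Y(2)[of l0 x]] by (simp add: algebra_simps)
      show "\<bar>q x - l\<bar> \<le> M" using Mq(2)[OF x] l by (auto simp: M_def)
      show "\<bar>- (l - l0) * Y l0 x\<bar> \<le> \<bar>l - l0\<bar> * B"
        using B(2)[OF x] by (simp add: abs_mult abs_minus_commute mult_left_mono)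
    qed (use X in auto)
    also have "\<dots> = (\<bar>l - l0\<bar> * B)\<^sup>2 * exp (2 * ((M + 2) * X / 2))" by (simp add: init)
    finally show ?thesis
      using abs_le_of_squares[of "Y l X - Y l0 X" "Y' l X - Y' l0 X" "\<bar>l - l0\<bar> * B" "(M + 2) * X / 2"] B(1)
      by (simp add: C_def mult.assoc)
  qed
  show "isCont (\<lambda>l. Y l X) l0" by (rule lipschitz_at_imp_isCont[where C = C]) (use * in blast)
  show "isCont (\<lambda>l. Y' l X) l0" by (rule lipschitz_at_imp_isCont[where C = C]) (use * in blast)
qed

text \<open>D_m solves the equation with q = x^2 / 4 and l = m + 1/2, hence the difference is driven
  by a forcing of size at most 2 h B. One \<open>h\<close> serves all \<open>q\<close> and
  \<open>l\<close>, so it can be fixed before \<kappa>.\<close>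

lemma solution_near_pcf:
  assumes T: "0 < T" and e: "0 < e"
  shows "\<exists>h>0. \<forall>q l y y'. (\<forall>x. (y has_real_derivative y' x) (at x)) \<longrightarrow>
     (\<forall>x. (y' has_real_derivative (q x - l) * y x) (at x)) \<longrightarrow> y 0 = pcf m 0 \<longrightarrow> y' 0 = pcf' m 0 \<longrightarrow>
     (\<forall>x. \<bar>x\<bar> \<le> T \<longrightarrow> \<bar>q x - x\<^sup>2 / 4\<bar> \<le> h) \<longrightarrow> \<bar>l - (real m + 1/2)\<bar> \<le> h \<longrightarrow>
     (\<forall>x. \<bar>x\<bar> \<le> T \<longrightarrow> \<bar>y x - pcf m x\<bar> < e \<and> \<bar>y' x - pcf' m x\<bar> < e)"
proof -
  obtain B where B: "0 \<le> B" "\<And>x. - T \<le> x \<Longrightarrow> x \<le> T \<Longrightarrow> \<bar>pcf m x\<bar> \<le> B"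
    using continuous_bounded_Icc[of "pcf m" "- T" T] DERIV_isCont[OF pcf_has_derivative] by blast
  define M where "M = T\<^sup>2 / 4 + real m + 1/2 + 2"
  \<comment> \<open>The choice makes Gronwall's bound 2 h B exp ((M + 2) T / 2) smaller than
    \<open>e\<close>; \<open>B + 1\<close> avoids dividing by zero. The bound 1 on \<open>h\<close>
    justifies the summand 2 in \<open>M\<close>.\<close>
  define h where "h = min 1 (e * exp (- ((M + 2) * T / 2)) / (4 * (B + 1)))"
  have h: "0 < h" "h \<le> 1" using e B(1) by (auto simp: h_def)
  have alg: "2 * (e * (1 / g) / (4 * (B + 1))) * B * g = e * (B / (2 * (B + 1)))" if "g \<noteq> 0" "B + 1 \<noteq> 0" for g
    using that by (simp add: divide_simps)
  have hB: "2 * h * B * exp ((M + 2) * T / 2) < e"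
  proof -
    have "2 * h * B * exp ((M + 2) * T / 2) \<le> 2 * (e * exp (- ((M + 2) * T / 2)) / (4 * (B + 1))) * B * exp ((M + 2) * T / 2)"
      using B(1) by (intro mult_right_mono mult_left_mono) (auto simp: h_def)
    also have "\<dots> = e * (B / (2 * (B + 1)))"
      unfolding exp_minus inverse_eq_divide by (rule alg) (use B(1) in auto)
    also have "\<dots> < e * 1" using e B(1) by (intro mult_strict_left_mono) (auto simp: field_simps)
    finally show ?thesis by simp
  qed
  have "\<bar>y x - pcf m x\<bar> < e \<and> \<bar>y' x - pcf' m x\<bar> < e"
    if y: "\<And>x. (y has_real_derivative y' x) (at x)" "\<And>x. (y' has_real_derivative (q x - l) * y x) (at x)"
      and init: "y 0 = pcf m 0" "y' 0 = pcf' m 0" and q: "\<And>x. \<bar>x\<bar> \<le> T \<Longrightarrow> \<bar>q x - x\<^sup>2 / 4\<bar> \<le> h" 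
      and l: "\<bar>l - (real m + 1/2)\<bar> \<le> h" and x: "\<bar>x\<bar> \<le> T" for q l y y' x
  proof -
    \<comment> \<open>Gronwall's estimate runs to the right only; the sign \<open>s\<close> reflects
      negative x.\<close>
    define s :: real where "s = (if 0 \<le> x then 1 else - 1)"
    have s: "s * s = 1" "\<bar>s\<bar> = 1" "s * \<bar>x\<bar> = x" by (auto simp: s_def)
    have D: "((\<lambda>u. s * u) has_real_derivative s) (at u)" for u by (auto intro!: derivative_eq_intros)
    have "(y (s * \<bar>x\<bar>) - pcf m (s * \<bar>x\<bar>))\<^sup>2 + (s * (y' (s * \<bar>x\<bar>) - pcf' m (s * \<bar>x\<bar>)))\<^sup>2
       \<le> ((y (s * 0) - pcf m (s * 0))\<^sup>2 + (s * (y' (s * 0) - pcf' m (s * 0)))\<^sup>2 + (2 * h * B)\<^sup>2) * exp ((M + 2) * (\<bar>x\<bar> - 0))"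
    proof (rule gronwall_second_order[where p = "\<lambda>u. q (s * u) - l" and b = T
          and r = "\<lambda>u. (q (s * u) - l - ttilde m (s * u)) * pcf m (s * u)"])
      fix u assume u: "0 \<le> u" "u \<le> T"
      have su: "\<bar>s * u\<bar> \<le> T" "- T \<le> s * u" "s * u \<le> T" using u by (auto simp: s_def)
      show "((\<lambda>u. y (s * u) - pcf m (s * u)) has_real_derivative s * (y' (s * u) - pcf' m (s * u))) (at u)"
        using DERIV_diff[OF DERIV_chain2[OF y(1)[of "s * u"] D] DERIV_chain2[OF pcf_has_derivative[of m "s * u"] D]]
        by (simp add: algebra_simps)
      have "((\<lambda>u. s * (y' (s * u) - pcf' m (s * u))) has_real_derivative
          s * (((q (s * u) - l) * y (s * u)) * s - (ttilde m (s * u) * pcf m (s * u)) * s)) (at u)"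
        by (rule DERIV_cmult[OF DERIV_diff[OF DERIV_chain2[OF y(2)[of "s * u"] D] DERIV_chain2[OF pcf'_has_derivative[of m "s * u"] D]]])
      also have "s * (((q (s * u) - l) * y (s * u)) * s - (ttilde m (s * u) * pcf m (s * u)) * s)
         = (s * s) * ((q (s * u) - l) * (y (s * u) - pcf m (s * u)) + (q (s * u) - l - ttilde m (s * u)) * pcf m (s * u))"
        by (simp add: algebra_simps)
      finally show "((\<lambda>u. s * (y' (s * u) - pcf' m (s * u))) has_real_derivative
         (q (s * u) - l) * (y (s * u) - pcf m (s * u)) + (q (s * u) - l - ttilde m (s * u)) * pcf m (s * u)) (at u)"
        by (simp add: s)
      have "(s * u)\<^sup>2 \<le> T\<^sup>2" using su(1) by (metis abs_ge_zero power2_abs power_mono)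
      then show "\<bar>q (s * u) - l\<bar> \<le> M" using q[OF su(1)] l h(2) unfolding M_def
        using zero_le_power2[of "s * u"] by linarith
      have "\<bar>q (s * u) - l - ttilde m (s * u)\<bar> \<le> 2 * h"
        using q[OF su(1)] l unfolding ttilde_def by linarith
      then show "\<bar>(q (s * u) - l - ttilde m (s * u)) * pcf m (s * u)\<bar> \<le> 2 * h * B"
        unfolding abs_mult using B su h(1) by (intro mult_mono) auto
    qed (use x in auto)
    also have "\<dots> = (2 * h * B)\<^sup>2 * exp ((M + 2) * \<bar>x\<bar>)" by (simp add: init)
    also have "\<dots> \<le> (2 * h * B)\<^sup>2 * exp (2 * ((M + 2) * T / 2))"
      using x by (intro mult_left_mono) (auto simp: M_def mult_left_mono)
    finally have "\<bar>y x - pcf m x\<bar> \<le> 2 * h * B * exp ((M + 2) * T / 2)" "\<bar>s * (y' x - pcf' m x)\<bar> \<le> 2 * h * B * exp ((M + 2) * T / 2)"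
      using abs_le_of_squares[of "y x - pcf m x" "s * (y' x - pcf' m x)" "2 * h * B" "(M + 2) * T / 2"] B(1) h(1)
      unfolding s(3) by auto
    then show ?thesis using hB by (auto simp: abs_mult s)
  qed
  then show ?thesis using h(1) by (intro exI[of _ h]) blast
qed

text \<open>Gronwall's estimate is applied backwards from \<open>b\<close>, with zero data and zero
  forcing.\<close>

lemma no_double_zero:
  fixes y y' p :: "real \<Rightarrow> real"
  assumes y: "\<And>x. a \<le> x \<Longrightarrow> x \<le> b \<Longrightarrow> (y has_real_derivative y' x) (at x)"
      "\<And>x. a \<le> x \<Longrightarrow> x \<le> b \<Longrightarrow> (y' has_real_derivative p x * y x) (at x)"
    and p: "\<And>x. a \<le> x \<Longrightarrow> x \<le> b \<Longrightarrow> \<bar>p x\<bar> \<le> M"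
    and "a \<le> b" "y b = 0" "y' b = 0"
  shows "y a = 0"
proof -
  have D: "(uminus has_real_derivative - 1) (at u)" for u :: real by (auto intro!: derivative_eq_intros)
  have "(y (- (- a)))\<^sup>2 + (- y' (- (- a)))\<^sup>2 \<le> ((y (- (- b)))\<^sup>2 + (- y' (- (- b)))\<^sup>2 + 0\<^sup>2) * exp ((M + 2) * (- a - (- b)))"
  proof (rule gronwall_second_order[where d = "\<lambda>u. y (- u)" and e = "\<lambda>u. - y' (- u)" and p = "\<lambda>u. p (- u)" and r = "\<lambda>_. 0" and b = "- a"])
    fix u assume u: "- b \<le> u" "u \<le> - a"
    show "((\<lambda>u. y (- u)) has_real_derivative - y' (- u)) (at u)"
      using DERIV_chain2[OF y(1)[of "- u"] D] u by simp
    show "((\<lambda>u. - y' (- u)) has_real_derivative p (- u) * y (- u) + 0) (at u)"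
      using DERIV_minus[OF DERIV_chain2[OF y(2)[of "- u"] D]] u by simp
    show "\<bar>p (- u)\<bar> \<le> M" using p[of "- u"] u by simp
  qed (use assms(4) in auto)
  then have "(y a)\<^sup>2 + (y' a)\<^sup>2 \<le> 0" using assms(5,6) by simp
  then have "(y a)\<^sup>2 \<le> 0" using zero_le_power2[of "y' a"] by linarith
  then show ?thesis by simp
qed

text \<open>At a first zero the slope is nonpositive, and nonzero because a double zero would
  propagate back to \<open>T\<close>. From there value and slope stay negative up to
  \<open>X\<close>, against either boundary condition.\<close>

lemma no_zero_in_tail:
  fixes y y' p :: "real \<Rightarrow> real"
  assumes y: "\<And>x. T \<le> x \<Longrightarrow> x \<le> X \<Longrightarrow> (y has_real_derivative y' x) (at x)"
      "\<And>x. T \<le> x \<Longrightarrow> x \<le> X \<Longrightarrow> (y' has_real_derivative p x * y x) (at x)"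
    and p: "\<And>x. T \<le> x \<Longrightarrow> x \<le> X \<Longrightarrow> 0 \<le> p x \<and> p x \<le> M"
    and y_T: "0 < y T" and bc: "y X = 0 \<or> y' X = 0" and x: "T \<le> x" "x < X"
  shows "0 < y x"
proof (rule ccontr)
  assume "\<not> 0 < y x"
  then have nx: "y x \<le> 0" by simp
  have xT: "x \<in> {T..X}" using x by simp
  have "continuous_on {T..X} y"
    by (rule continuous_at_imp_continuous_on, rule ballI, rule DERIV_isCont, rule y(1)) auto
  then obtain c where c: "T < c" "c \<le> x" "y c = 0" "\<And>u. T \<le> u \<Longrightarrow> u < c \<Longrightarrow> 0 < y u"
    by (rule first_nonpos[OF _ y_T xT nx]) blast
  have cX: "c < X" using c(2) x(2) by simp
  have "y' c \<le> 0"
    using deriv_nonpos_at_first_zero[OF y(1) c(1,3,4)] c(1) cX by simp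
  moreover have "y' c \<noteq> 0"
  proof
    assume y'c: "y' c = 0"
    have "y T = 0"
      by (rule no_double_zero[where y = y and y' = y' and p = p and b = c and M = M])
        (use y p c y'c cX in \<open>auto simp: abs_of_nonneg\<close>)
    then show False using y_T by simp
  qed
  ultimately have "y' c < 0" by simp
  have "0 < - y X \<and> 0 < - y' X"
    by (rule convex_growth[where y = "\<lambda>x. - y x" and y' = "\<lambda>x. - y' x" and p = p and a = c])
      (use y p c cX \<open>y' c < 0\<close> in \<open>auto intro!: derivative_eq_intros\<close>)
  then show False using bc by auto
qed

text \<open>The Wronskian starts at zero with derivative y R + (l - l0) y W, close to s \<delta>
  D^2. The unit interval from \<open>T1\<close> to \<open>T\<close>, where D \<ge> c, contributes
  \<delta> c^2, and the accumulated errors cost at most half of it.\<close>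

lemma wronskian_lower_bound:
  fixes y y' W W' Q R D :: "real \<Rightarrow> real" and T1 T :: real
  defines "T \<equiv> T1 + 1"
  assumes dy: "\<And>x. (y has_real_derivative y' x) (at x)" "\<And>x. (y' has_real_derivative (Q x - l) * y x) (at x)"
    and dW: "\<And>x. (W has_real_derivative W' x) (at x)" "\<And>x. (W' has_real_derivative (Q x - l0) * W x + R x) (at x)"
    and s: "s = 1 \<or> s = - 1" "l - l0 = s * \<delta>" "0 < \<delta>"
    and T1: "0 < T1" and B: "0 \<le> B" and e: "0 \<le> e" "e \<le> 1" "2 * (e * (3 * B + 2) * T) \<le> c\<^sup>2" and c: "0 < c"
    and close: "\<And>x. 0 \<le> x \<Longrightarrow> x \<le> T \<Longrightarrow> \<bar>y x - D x\<bar> \<le> e \<and> \<bar>W x - D x\<bar> \<le> e \<and> \<bar>D x\<bar> \<le> B \<and> \<bar>R x\<bar> \<le> \<delta> * e"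
    and D: "\<And>x. T1 \<le> x \<Longrightarrow> x \<le> T \<Longrightarrow> c \<le> D x"
    and init: "y 0 * W' 0 - W 0 * y' 0 = 0"
  shows "\<delta> * c\<^sup>2 / 2 \<le> s * (y T * W' T - W T * y' T)"
proof -
  \<comment> \<open>The linear term compensates the errors: y R costs at most (B + 1) \<delta> e,
    and replacing y W by D^2 at most (2 B + 1) \<delta> e, together (3 B + 2) \<delta> e per unit
    length.\<close>
  define g where "g x = s * (y x * W' x - W x * y' x) + \<delta> * (e * (3 * B + 2)) * x" for x
  define g' where "g' x = s * (y x * (R x + (l - l0) * W x)) + \<delta> * (e * (3 * B + 2))" for x
  have dg: "(g has_real_derivative g' x) (at x)" for x
    unfolding g_def g'_def using dy[of x] dW[of x]
    by (auto intro!: derivative_eq_intros simp: algebra_simps)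
  have low: "\<delta> * (D x)\<^sup>2 \<le> g' x" if x: "0 \<le> x" "x \<le> T" for x
  proof -
    note cl = close[OF x]
    have y: "\<bar>y x\<bar> \<le> B + 1" and W: "\<bar>W x\<bar> \<le> B + 1" using cl e(2) by linarith+
    have "\<bar>s * (y x * R x)\<bar> = \<bar>y x\<bar> * \<bar>R x\<bar>" using s(1) by (auto simp: abs_mult)
    also have "\<dots> \<le> (B + 1) * (\<delta> * e)" using y cl B by (intro mult_mono) auto
    finally have 1: "- ((B + 1) * (\<delta> * e)) \<le> s * (y x * R x)" by linarith
    have "\<bar>(y x - D x) * W x\<bar> \<le> e * (B + 1)" "\<bar>D x * (W x - D x)\<bar> \<le> B * e"
      unfolding abs_mult using cl W e(1) B by (auto intro!: mult_mono)
    then have "- (e * (2 * B + 1)) \<le> (y x - D x) * W x + D x * (W x - D x)" by (simp add: algebra_simps)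
    then have "(D x)\<^sup>2 - e * (2 * B + 1) \<le> y x * W x" by (simp add: algebra_simps power2_eq_square)
    then have "\<delta> * ((D x)\<^sup>2 - e * (2 * B + 1)) \<le> \<delta> * (y x * W x)" using s(3) by (intro mult_left_mono) auto
    also have "\<delta> * (y x * W x) = s * (y x * ((l - l0) * W x))" using s(1,2) by auto
    finally have "\<delta> * ((D x)\<^sup>2 - e * (2 * B + 1)) \<le> s * (y x * ((l - l0) * W x))" .
    with 1 show ?thesis unfolding g'_def by (simp add: algebra_simps)
  qed
  have "g 0 \<le> g T1"
  proof (rule DERIV_nonneg_imp_nondecreasing[of 0 T1 g])
    fix x assume x: "0 \<le> x" "x \<le> T1"
    have "0 \<le> \<delta> * (D x)\<^sup>2" using s(3) by simp
    then show "\<exists>D. (g has_real_derivative D) (at x) \<and> 0 \<le> D" using dg[of x] low[of x] x by (auto simp: T_def)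
  qed (use T1 in simp)
  moreover have "g 0 = 0" using init by (simp add: g_def)
  moreover obtain z where z: "T1 < z" "z < T" "g T - g T1 = (T - T1) * g' z"
    using MVT2[of T1 T g g'] dg by (auto simp: T_def)
  moreover have "\<delta> * c\<^sup>2 \<le> g' z"
  proof -
    have "c\<^sup>2 \<le> (D z)\<^sup>2" using D[of z] z c by (intro power_mono) auto
    then have "\<delta> * c\<^sup>2 \<le> \<delta> * (D z)\<^sup>2" using s(3) by (intro mult_left_mono) auto
    also have "\<dots> \<le> g' z" using low[of z] z T1 by simp
    finally show ?thesis .
  qed
  ultimately have "\<delta> * c\<^sup>2 \<le> g T" by (simp add: T_def)
  moreover have "\<delta> * (2 * (e * (3 * B + 2) * T)) \<le> \<delta> * c\<^sup>2" using e(3) s(3) by (intro mult_left_mono) auto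
  ultimately show ?thesis unfolding g_def by (simp add: algebra_simps)
qed

text \<open>The initial data have the parity of m and the coefficient is even, so uniqueness applies
  to the reflected solution. A condition at \<open>X\<close> thus implies the one at
  \<open>- X\<close>, and the zeros lie symmetrically.\<close>

lemma solution_parity:
  fixes y y' q :: "real \<Rightarrow> real"
  assumes y: "\<And>x. (y has_real_derivative y' x) (at x)" "\<And>x. (y' has_real_derivative q x * y x) (at x)"
    and q: "\<And>x. isCont q x" "\<And>x. q (- x) = q x" and init: "y 0 = pcf m 0" "y' 0 = pcf' m 0"
  shows "y (- x) = (- 1) ^ m * y x" "y' (- x) = - ((- 1) ^ m * y' x)"
proof -
  have pcf0: "pcf m 0 = (- 1) ^ m * pcf m 0" using pcf_minus[of m 0] by simp
  have pcf'0: "- pcf' m 0 = (- 1) ^ m * pcf' m 0"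
  proof -
    have "((\<lambda>t. pcf m (- t)) has_real_derivative pcf' m (- 0) * - 1) (at 0)"
      by (rule DERIV_chain2[OF pcf_has_derivative]) (auto intro!: derivative_eq_intros)
    moreover have "((\<lambda>t. (- 1) ^ m * pcf m t) has_real_derivative (- 1) ^ m * pcf' m 0) (at 0)"
      by (rule DERIV_cmult[OF pcf_has_derivative])
    ultimately show ?thesis unfolding pcf_minus using DERIV_unique by fastforce
  qed
  have D: "(uminus has_real_derivative - 1) (at u)" for u :: real by (auto intro!: derivative_eq_intros)
  have eq: "y (- x) = (- 1) ^ m * y x" if "0 \<le> x" for x
  proof -
    obtain M where M: "0 \<le> M" "\<And>u. 0 \<le> u \<Longrightarrow> u \<le> x \<Longrightarrow> \<bar>q u\<bar> \<le> M" using continuous_bounded_Icc[of q 0 x] q(1) by blast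
    have "(y (- x) - (- 1) ^ m * y x)\<^sup>2 + (- y' (- x) - (- 1) ^ m * y' x)\<^sup>2
       \<le> ((y (- 0) - (- 1) ^ m * y 0)\<^sup>2 + (- y' (- 0) - (- 1) ^ m * y' 0)\<^sup>2 + 0\<^sup>2) * exp ((M + 2) * (x - 0))"
    proof (rule gronwall_second_order[where p = q and r = "\<lambda>_. 0" and b = x])
      fix u
      show "((\<lambda>x. y (- x) - (- 1) ^ m * y x) has_real_derivative - y' (- u) - (- 1) ^ m * y' u) (at u)"
        using DERIV_diff[OF DERIV_chain2[OF y(1)[of "- u"] D] DERIV_cmult[OF y(1)[of u], of "(- 1) ^ m"]] by simp
      show "((\<lambda>x. - y' (- x) - (- 1) ^ m * y' x) has_real_derivative q u * (y (- u) - (- 1) ^ m * y u) + 0) (at u)"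
        using DERIV_diff[OF DERIV_minus[OF DERIV_chain2[OF y(2)[of "- u"] D]] DERIV_cmult[OF y(2)[of u], of "(- 1) ^ m"]] q(2)[of u]
        by (simp add: algebra_simps)
    qed (use M that in auto)
    then have "(y (- x) - (- 1) ^ m * y x)\<^sup>2 + (- y' (- x) - (- 1) ^ m * y' x)\<^sup>2 \<le> 0"
      using pcf0 pcf'0 by (simp add: init)
    then have "(y (- x) - (- 1) ^ m * y x)\<^sup>2 \<le> 0" using zero_le_power2[of "- y' (- x) - (- 1) ^ m * y' x"] by linarith
    then show ?thesis by simp
  qed
  have sq: "(- 1) ^ m * ((- 1) ^ m * a) = a" for a :: real by (simp add: mult.assoc[symmetric] power_mult_distrib[symmetric])
  have all: "y (- x) = (- 1) ^ m * y x" for x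
  proof (cases "0 \<le> x")
    case False
    then show ?thesis using eq[of "- x"] sq[of "y x"] by (metis add.inverse_inverse neg_0_le_iff_le linear sq)
  qed (rule eq)
  then show "y (- x) = (- 1) ^ m * y x" .
  have "((\<lambda>x. y (- x)) has_real_derivative y' (- x) * - 1) (at x)"
    by (rule DERIV_chain2[OF y(1) D])
  moreover have "((\<lambda>x. (- 1) ^ m * y x) has_real_derivative (- 1) ^ m * y' x) (at x)"
    by (rule DERIV_cmult[OF y(1)])
  ultimately have "y' (- x) * - 1 = (- 1) ^ m * y' x" unfolding all using DERIV_unique by blast
  then show "y' (- x) = - ((- 1) ^ m * y' x)" by simp
qed

text \<open>These are the two demands on the point t = L = ln \<kappa>. In the second, exp ((L -
  1)^2 / 2) comes from 1 / W^2 just before that point and exp (- L^2 / 4) from W at it; the product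
  grows about like exp (L^2 / 4), beyond all powers of \<kappa>.\<close>

lemma eventually_log_growth:
  fixes C K Y :: real
  shows "eventually (\<lambda>\<kappa>. C * (1 + ln \<kappa>) ^ d \<le> \<kappa> / 4) at_top"
    and "0 < K \<Longrightarrow> eventually (\<lambda>\<kappa>. Y < K * ((1 / \<kappa>) ^ n * exp ((ln \<kappa> - 1)\<^sup>2 / 2 - (ln \<kappa>)\<^sup>2 / 4))) at_top"
proof -
  have "((\<lambda>\<kappa>::real. C * ((1 + ln \<kappa>) ^ d / \<kappa>)) \<longlongrightarrow> C * 0) at_top"
    by (intro tendsto_mult tendsto_const) real_asymp
  then have "eventually (\<lambda>\<kappa>. C * ((1 + ln \<kappa>) ^ d / \<kappa>) < 1/4) at_top"
    by (rule order_tendstoD) simp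
  then show "eventually (\<lambda>\<kappa>. C * (1 + ln \<kappa>) ^ d \<le> \<kappa> / 4) at_top"
    using eventually_gt_at_top[of 0] by eventually_elim (simp add: field_simps)
  assume K: "0 < K"
  have "filterlim (\<lambda>\<kappa>::real. (1 / \<kappa>) ^ n * exp ((ln \<kappa> - 1)\<^sup>2 / 2 - (ln \<kappa>)\<^sup>2 / 4)) at_top at_top"
    by real_asymp
  then have "eventually (\<lambda>\<kappa>. Y / K < (1 / \<kappa>) ^ n * exp ((ln \<kappa> - 1)\<^sup>2 / 2 - (ln \<kappa>)\<^sup>2 / 4)) at_top"
    by (simp add: filterlim_at_top_dense)
  then show "eventually (\<lambda>\<kappa>. Y < K * ((1 / \<kappa>) ^ n * exp ((ln \<kappa> - 1)\<^sup>2 / 2 - (ln \<kappa>)\<^sup>2 / 4))) at_top"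
    by eventually_elim (use K in \<open>simp add: field_simps\<close>)
qed

section \<open>Eigenvalues near the truncated expansion\<close>

definition rescaled_eigenpair :: "real \<Rightarrow> nat \<Rightarrow> bool \<Rightarrow> real \<Rightarrow> real \<Rightarrow> (real \<Rightarrow> real) \<Rightarrow> (real \<Rightarrow> real) \<Rightarrow> bool" where
  "rescaled_eigenpair k m dirichlet \<kappa> l y y' \<longleftrightarrow>
     (let X = sqrt (2 * \<kappa>) * ellK k in
      (\<forall>x. (y has_real_derivative y' x) (at x)) \<and>
      (\<forall>x. (y' has_real_derivative ((scaled_sn k \<kappa> x)\<^sup>2 / 4 - l) * y x) (at x)) \<and>
      (\<exists>x\<in>{-X<..<X}. y x \<noteq> 0) \<and>
      (if dirichlet then y X = 0 \<and> y (- X) = 0 else y' X = 0 \<and> y' (- X) = 0) \<and>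
      finite {x \<in> {-X<..<X}. y x = 0} \<and> card {x \<in> {-X<..<X}. y x = 0} = m)"

text \<open>The bound m + 2 puts \<open>T1\<close> beyond the turning point of the equation for
  every l within 1 of m + 1/2.\<close>

lemma pcf_eventually_positive:
  obtains T1 where "1 \<le> T1" "real m + 2 \<le> T1\<^sup>2 / 4" "\<And>t. T1 \<le> t \<Longrightarrow> 1 \<le> poly (hermite m) t"
proof -
  have "0 < lead_coeff (hermite m)" using degree_hermite[of m] by auto
  then obtain n where n: "\<And>t. n \<le> t \<Longrightarrow> lead_coeff (hermite m) \<le> poly (hermite m) t"
    using poly_pinfty_gt_lc by blast
  define T1 where "T1 = max n (real m + 4)"
  have "(real m + 4)\<^sup>2 \<le> T1\<^sup>2" by (intro power_mono) (auto simp: T1_def)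
  moreover have "4 * (real m + 2) \<le> (real m + 4)\<^sup>2" by (simp add: power2_eq_square algebra_simps)
  ultimately have "4 * (real m + 2) \<le> T1\<^sup>2" by (rule order_trans[rotated])
  then have "real m + 2 \<le> T1\<^sup>2 / 4" by simp
  then show thesis using that[of T1] n degree_hermite[of m] by (auto simp: T1_def)
qed

text \<open>All tolerances (\<open>T\<close>, \<open>e\<close>, \<open>h\<close>,
  \<open>\<theta>\<close>) depend on k, m and n only and are fixed before \<kappa> is sent to
  infinity.\<close>

lemma eigenvalue_near:
  assumes k: "0 < k" "k < 1" and rec: "lame_recursion k m A B \<mu>"
  shows "eventually (\<lambda>\<kappa>. \<forall>dirichlet. \<exists>l y y'. \<bar>l - trunc_level m \<mu> (Suc n) \<kappa>\<bar> \<le> (1/\<kappa>) ^ Suc n \<and>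
           rescaled_eigenpair k m dirichlet \<kappa> l y y') at_top"
proof -
  obtain T1 where T1: "1 \<le> T1" "real m + 2 \<le> T1\<^sup>2 / 4" "\<And>t. T1 \<le> t \<Longrightarrow> 1 \<le> poly (hermite m) t"
    using pcf_eventually_positive by blast
  \<comment> \<open>The margin 1 is used twice: t(T) \<ge> T1 as soon as |t(x) - x| \<le> 1 on the
    bounded part, and the interval from \<open>T1\<close> to \<open>T\<close> is the one that feeds
    the Wronskian.\<close>
  define T where "T = T1 + 1"
  have T: "0 < T" using T1(1) by (simp add: T_def)
  define D where "D = pcf m"
  have D_ge: "exp (- t\<^sup>2 / 4) \<le> D t" if "T1 \<le> t" for t
    using T1(3)[OF that] by (simp add: D_def pcf_def)
  have D_pos: "0 < D t" if "T1 \<le> t" for t using D_ge[OF that] exp_gt_zero[of "- t\<^sup>2 / 4"] by linarith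
  have D_minus: "D (- t) = (- 1) ^ m * D t" for t by (simp add: D_def pcf_minus)
  have D_cont: "isCont D x" for x unfolding D_def by (rule DERIV_isCont[OF pcf_has_derivative])
  obtain B0 where B0: "0 \<le> B0" "\<And>x. - T \<le> x \<Longrightarrow> x \<le> T \<Longrightarrow> \<bar>D x\<bar> \<le> B0"
    using continuous_bounded_Icc[of D "- T" T] D_cont by blast
  define c0 where "c0 = exp (- T\<^sup>2 / 4)"
  have c0: "0 < c0" by (simp add: c0_def)
  have c0_le: "c0 \<le> D x" if "T1 \<le> x" "x \<le> T" for x
  proof -
    have "x\<^sup>2 \<le> T\<^sup>2" using that T1(1) by (intro power_mono) auto
    then have "c0 \<le> exp (- x\<^sup>2 / 4)" by (simp add: c0_def)
    then show ?thesis using D_ge[OF that(1)] by linarith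
  qed
  define Z where "Z = {x \<in> {-T..T}. D x = 0}"
  have Z: "Z = {t. poly (hermite m) t = 0}"
  proof -
    have "- T \<le> t \<and> t \<le> T" if "poly (hermite m) t = 0" for t
    proof -
      have "D t = 0" using that by (simp add: D_def pcf_def)
      then have "D (- t) = 0" by (simp add: D_minus)
      have "\<not> T1 \<le> t" "\<not> T1 \<le> - t" using D_pos[of t] D_pos[of "- t"] \<open>D t = 0\<close> \<open>D (- t) = 0\<close> by auto
      then show ?thesis by (simp add: T_def)
    qed
    then show ?thesis by (auto simp: Z_def D_def pcf_def)
  qed
  have Z_card: "finite Z" "card Z = m" using hermite_zeros[of m] Z by auto
  have D_T: "D T \<noteq> 0" "D (- T) \<noteq> 0" using D_pos[of T] D_minus[of T] unfolding T_def by simp_all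
  obtain e0 where e0: "e0 > 0" "\<And>g g'. (\<And>x. x \<in> {-T..T} \<Longrightarrow> (g has_real_derivative g' x) (at x) \<and> \<bar>g x - D x\<bar> < e0 \<and> \<bar>g' x - pcf' m x\<bar> < e0) \<Longrightarrow>
     finite {x \<in> {-T..T}. g x = 0} \<and> card {x \<in> {-T..T}. g x = 0} = m"
  proof -
    have "\<exists>e>0. \<forall>g g'. (\<forall>x\<in>{-T..T}. (g has_real_derivative g' x) (at x) \<and> \<bar>g x - D x\<bar> < e \<and> \<bar>g' x - pcf' m x\<bar> < e) \<longrightarrow>
      finite {x \<in> {-T..T}. g x = 0} \<and> card {x \<in> {-T..T}. g x = 0} = card Z"
      unfolding Z_def
    proof (rule zero_count_stable)
      show "(D has_real_derivative pcf' m x) (at x)" for x unfolding D_def by (rule pcf_has_derivative)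
      show "isCont (pcf' m) x" for x by (rule DERIV_isCont[OF pcf'_has_derivative])
      show "finite {x \<in> {-T..T}. D x = 0}" using Z_card(1) by (simp add: Z_def)
      show "pcf' m x \<noteq> 0" if "x \<in> {x \<in> {-T..T}. D x = 0}" for x
        using that pcf_simple_zero[of m x] by (simp add: D_def)
    qed (use T D_T in auto)
    then show thesis using that unfolding Z_card(2) by blast
  qed
  \<comment> \<open>In turn: \<open>e0\<close> preserves the number of zeros, 1 keeps the bounds
    simple, \<open>c0 / 2\<close> keeps the solution positive at \<open>T\<close>, and the last
    entry is the error budget of \<open>wronskian_lower_bound\<close>.\<close>
  define e where "e = min (min e0 1) (min (c0 / 2) (c0\<^sup>2 / (2 * ((3 * B0 + 2) * T))))"
  have den: "0 < 2 * ((3 * B0 + 2) * T)" using B0(1) T by simp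
  have e: "0 < e" "e \<le> e0" "e \<le> 1" "e \<le> c0 / 2" "e \<le> c0\<^sup>2 / (2 * ((3 * B0 + 2) * T))"
  proof -
    have "0 < c0\<^sup>2 / (2 * ((3 * B0 + 2) * T))" using c0 den by simp
    then show "0 < e" "e \<le> e0" "e \<le> 1" "e \<le> c0 / 2" "e \<le> c0\<^sup>2 / (2 * ((3 * B0 + 2) * T))"
      using e0(1) c0 unfolding e_def by linarith+
  qed
  have e_c0: "2 * (e * (3 * B0 + 2) * T) \<le> c0\<^sup>2"
    using e(5) den by (simp add: field_simps)
  from solution_near_pcf[OF T e(1), of m] obtain h where h: "h > 0" and near_pcf: "\<forall>q l y y'. (\<forall>x. (y has_real_derivative y' x) (at x)) \<longrightarrow>
     (\<forall>x. (y' has_real_derivative (q x - l) * y x) (at x)) \<longrightarrow> y 0 = pcf m 0 \<longrightarrow> y' 0 = pcf' m 0 \<longrightarrow>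
     (\<forall>x. \<bar>x\<bar> \<le> T \<longrightarrow> \<bar>q x - x\<^sup>2 / 4\<bar> \<le> h) \<longrightarrow> \<bar>l - (real m + 1/2)\<bar> \<le> h \<longrightarrow>
     (\<forall>x. \<bar>x\<bar> \<le> T \<longrightarrow> \<bar>y x - pcf m x\<bar> < e \<and> \<bar>y' x - pcf' m x\<bar> < e)"
    by (elim exE conjE) (rule that)
  obtain C d where C: "0 \<le> C" and quasi: "\<And>\<kappa>. 1 \<le> \<kappa> \<Longrightarrow> \<exists>W W' R. is_quasimode k m \<mu> (Suc n) \<kappa> W W' R C d"
    using quasimode[OF k rec, of "Suc n"] by auto
  obtain CH dH where CH: "0 \<le> CH" "\<And>t. \<bar>poly (hermite m) t\<bar> \<le> CH * (1 + \<bar>t\<bar>) ^ dH"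
    using poly_growth by blast
  have "uniformly_continuous_on {-T..T} D"
    by (intro compact_uniformly_continuous continuous_at_imp_continuous_on compact_Icc) (use D_cont in auto)
  then obtain \<theta>0 where \<theta>0: "\<theta>0 > 0" "\<And>x x'. x \<in> {-T..T} \<Longrightarrow> x' \<in> {-T..T} \<Longrightarrow> \<bar>x' - x\<bar> < \<theta>0 \<Longrightarrow> \<bar>D x' - D x\<bar> < e / 2"
    unfolding uniformly_continuous_on_def dist_real_def using e(1) by (meson half_gt_zero)
  \<comment> \<open>\<open>h / T\<close> serves |t^2 - x^2| / 4 \<le> \<theta> T \<le> h; half of
    \<open>\<theta>0\<close> makes D(t(x)) close to D(x).\<close>
  define \<theta> where "\<theta> = min (\<theta>0 / 2) (min 1 (h / T))"
  have \<theta>: "0 < \<theta>" "\<theta> < \<theta>0" "\<theta> \<le> 1" "\<theta> * T \<le> h"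
  proof -
    have "0 < h / T" using h T by simp
    then show "0 < \<theta>" "\<theta> < \<theta>0" "\<theta> \<le> 1" using \<theta>0(1) unfolding \<theta>_def by linarith+
    have "\<theta> \<le> h / T" unfolding \<theta>_def by linarith
    then show "\<theta> * T \<le> h" using T by (simp add: field_simps)
  qed
  \<comment> \<open>One constant for both inequalities \<open>big\<close> below:
    \<open>c0\<^sup>2 / 2\<close> stems from \<open>c\<close>, another 1/2 from the lower bound for
    W, and the extra \<open>c0 \<le> 1\<close> equals exp (- T^2 / 4).\<close>
  define K where "K = c0 * c0\<^sup>2 / 4"
  have K: "0 < K" using c0 by (simp add: K_def)
  have "((\<lambda>\<kappa>. trunc_level m \<mu> (Suc n) \<kappa>) \<longlongrightarrow> real m + 1/2 + (\<Sum>s=1..Suc n. \<mu> s * 0)) at_top"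
    unfolding trunc_level_def
  proof (intro tendsto_add tendsto_sum tendsto_mult tendsto_const)
    fix s assume "s \<in> {1..Suc n}"
    then have "0 < s" by simp
    then show "((\<lambda>\<kappa>::real. (1 / \<kappa>) ^ s) \<longlongrightarrow> 0) at_top" by real_asymp
  qed
  then have "((\<lambda>\<kappa>. trunc_level m \<mu> (Suc n) \<kappa>) \<longlongrightarrow> real m + 1/2) at_top" by simp
  then have ev1: "eventually (\<lambda>\<kappa>. \<bar>trunc_level m \<mu> (Suc n) \<kappa> - (real m + 1/2)\<bar> < min h 1 / 2) at_top"
    using h by (auto dest!: tendstoD[where e = "min h 1 / 2"] simp: dist_real_def)
  have "((\<lambda>\<kappa>::real. (1 / \<kappa>) ^ Suc n) \<longlongrightarrow> 0) at_top" by real_asymp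
  then have ev2: "eventually (\<lambda>\<kappa>::real. (1 / \<kappa>) ^ Suc n < min h 1 / 2) at_top"
    using h by (intro order_tendstoD(2)[of _ 0]) auto
  have "((\<lambda>\<kappa>::real. (1 / \<kappa>) * (C * (1 + T) ^ d)) \<longlongrightarrow> 0) at_top" by real_asymp
  then have ev3: "eventually (\<lambda>\<kappa>::real. (1 / \<kappa>) * (C * (1 + T) ^ d) < e / 2) at_top"
    using e(1) by (intro order_tendstoD(2)[of _ 0]) auto
  have ev4: "eventually (\<lambda>\<kappa>::real. ln \<kappa> < sqrt (2 * \<kappa>)) at_top" by real_asymp
  have ev5: "eventually (\<lambda>\<kappa>::real. T + 1 < ln \<kappa>) at_top"
    using ln_at_top filterlim_at_top_dense by blast
  show ?thesis
    using scaled_sn_near_id[OF k \<theta>(1), of T] ev1 ev2 ev3 ev4 ev5 eventually_ge_at_top[of 4]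
      eventually_log_growth(1)[of C d] eventually_log_growth(1)[of CH dH] eventually_log_growth(2)[OF K, where Y = "B0 + 1" and n = "n + 3"]
  proof eventually_elim
    case (elim \<kappa>)
    have \<kappa>: "0 < \<kappa>" "1 \<le> \<kappa>" using elim(7) by auto
    let ?t = "scaled_sn k \<kappa>"
    define X where "X = sqrt (2 * \<kappa>) * ellK k"
    have X: "0 < X" using \<kappa> ellK_pos[OF k] by (simp add: X_def)
    define L where "L = ln \<kappa>"
    define \<delta> where "\<delta> = (1 / \<kappa>) ^ Suc n"
    have \<delta>: "0 < \<delta>" using \<kappa> by (simp add: \<delta>_def)
    define l0 where "l0 = trunc_level m \<mu> (Suc n) \<kappa>"
    note t0 = scaled_sn_0[OF k \<kappa>(1)] and tm = scaled_sn_minus[OF k \<kappa>(1)] and lip = scaled_sn_lipschitz[OF k \<kappa>(1)]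
    have t_le: "?t x \<le> x" if "0 \<le> x" for x using lip[of x 0] t0 that by auto
    have t_abs: "\<bar>?t x\<bar> \<le> \<bar>x\<bar>" for x using lip[of x 0] t0 by simp
    have near: "\<bar>?t x - x\<bar> \<le> \<theta>" if "\<bar>x\<bar> \<le> T" for x using elim(1) that by blast
    have mono: "?t x \<le> ?t y" if "0 \<le> x" "x \<le> y" "y \<le> X" for x y
      using scaled_sn_mono[OF k \<kappa>(1)] that unfolding X_def by blast
    have L: "T + 1 < L" "L < ?t X" using elim(5,6) scaled_sn_end[OF k \<kappa>(1)] by (simp_all add: L_def X_def)
    \<comment> \<open>\<open>S\<close> is the point where t reaches ln \<kappa>, the end of the
      range in which the quasimode is used.\<close>
    then obtain S where S: "0 \<le> S" "S \<le> X" "?t S = L"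
      using IVT[of ?t 0 L X] isCont_scaled_sn[OF k \<kappa>(1)] t0 T X by auto
    have SX: "S < X" using S L(2) by (cases "S = X") auto
    have TS: "T \<le> S - 1" using t_le[OF S(1)] S(3) L(1) by simp
    have tT: "T1 \<le> ?t T" using near[of T] T \<theta>(3) unfolding T_def by (simp add: abs_le_iff)
    have t_ge: "T1 \<le> ?t x" if "T \<le> x" "x \<le> X" for x using mono[of T x] that T tT by simp
    have q_near: "\<bar>(?t x)\<^sup>2 / 4 - x\<^sup>2 / 4\<bar> \<le> h" if "\<bar>x\<bar> \<le> T" for x
    proof -
      have "(?t x)\<^sup>2 / 4 - x\<^sup>2 / 4 = (?t x - x) * ((?t x + x) / 4)" by (simp add: power2_eq_square algebra_simps)
      then have "\<bar>(?t x)\<^sup>2 / 4 - x\<^sup>2 / 4\<bar> = \<bar>?t x - x\<bar> * \<bar>(?t x + x) / 4\<bar>" by (simp only: abs_mult)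
      also have "\<dots> \<le> \<theta> * T" using near[OF that] t_abs[of x] that \<theta>(1) by (intro mult_mono) auto
      finally show ?thesis using \<theta>(4) by simp
    qed
    obtain W W' R where W: "\<And>x. (W has_real_derivative W' x) (at x)"
       "\<And>x. (W' has_real_derivative ((?t x)\<^sup>2 / 4 - l0) * W x + R x) (at x)"
       "\<And>x. \<bar>W x - D (?t x)\<bar> \<le> (1/\<kappa>) * (C * (1 + \<bar>?t x\<bar>) ^ d) * exp (- (?t x)\<^sup>2 / 4)"
       "\<And>x. \<bar>R x\<bar> \<le> (1/\<kappa>) ^ Suc (Suc n) * (C * (1 + \<bar>?t x\<bar>) ^ d) * exp (- (?t x)\<^sup>2 / 4)"
       "pcf m 0 * W' 0 = W 0 * pcf' m 0"
      using quasi[OF \<kappa>(2)] unfolding is_quasimode_def l0_def D_def by blast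
    have small: "(1/\<kappa>) * (C * (1 + \<bar>?t x\<bar>) ^ d) < e / 2" if "\<bar>x\<bar> \<le> T" for x
    proof -
      have "(1/\<kappa>) * (C * (1 + \<bar>?t x\<bar>) ^ d) \<le> (1/\<kappa>) * (C * (1 + T) ^ d)"
        using t_abs[of x] that \<kappa> C by (intro mult_left_mono power_mono) auto
      then show ?thesis using elim(4) by linarith
    qed
    have W_near: "\<bar>W x - D x\<bar> \<le> e" if "0 \<le> x" "x \<le> T" for x
    proof -
      have x: "\<bar>x\<bar> \<le> T" using that by simp
      have "\<bar>W x - D (?t x)\<bar> \<le> (1/\<kappa>) * (C * (1 + \<bar>?t x\<bar>) ^ d) * exp (- (?t x)\<^sup>2 / 4)" by (rule W(3))
      also have "\<dots> \<le> (1/\<kappa>) * (C * (1 + \<bar>?t x\<bar>) ^ d) * 1" using \<kappa> C by (intro mult_left_mono) auto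
      finally have "\<bar>W x - D (?t x)\<bar> < e / 2" using small[OF x] by linarith
      moreover have "\<bar>D (?t x) - D x\<bar> < e / 2"
        using near[OF x] \<theta>(2) t_abs[of x] x by (intro \<theta>0(2)) (auto simp: abs_le_iff)
      ultimately show ?thesis by linarith
    qed
    have R_near: "\<bar>R x\<bar> \<le> \<delta> * e" if "0 \<le> x" "x \<le> T" for x
    proof -
      have "\<bar>R x\<bar> \<le> (1/\<kappa>) ^ Suc (Suc n) * (C * (1 + \<bar>?t x\<bar>) ^ d) * exp (- (?t x)\<^sup>2 / 4)" by (rule W(4))
      also have "\<dots> \<le> (1/\<kappa>) ^ Suc (Suc n) * (C * (1 + \<bar>?t x\<bar>) ^ d) * 1" using \<kappa> C by (intro mult_left_mono) auto
      also have "\<dots> = \<delta> * ((1/\<kappa>) * (C * (1 + \<bar>?t x\<bar>) ^ d))" by (simp add: \<delta>_def)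
      also have "\<dots> \<le> \<delta> * e"
      proof (rule mult_left_mono)
        have "\<bar>x\<bar> \<le> T" using that by simp
        then show "(1/\<kappa>) * (C * (1 + \<bar>?t x\<bar>) ^ d) \<le> e" using small[of x] e(1) by linarith
      qed (use \<delta> in simp)
      finally show ?thesis .
    qed
    have t_le_L: "?t x \<le> L" if "T \<le> x" "x \<le> S" for x using mono[of x S] that S T by simp
    have growth: "C * (1 + \<bar>?t x\<bar>) ^ d \<le> \<kappa> / 4" "CH * (1 + \<bar>?t x\<bar>) ^ dH \<le> \<kappa> / 4" if "T \<le> x" "x \<le> S" for x
    proof -
      have "0 \<le> ?t x" using t_ge[of x] that S(2) T1(1) by simp
      then have le: "1 + \<bar>?t x\<bar> \<le> 1 + ln \<kappa>" using t_le_L[OF that] by (simp add: L_def)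
      have "C * (1 + \<bar>?t x\<bar>) ^ d \<le> C * (1 + ln \<kappa>) ^ d" "CH * (1 + \<bar>?t x\<bar>) ^ dH \<le> CH * (1 + ln \<kappa>) ^ dH"
        using le C CH(1) by (intro mult_left_mono power_mono; simp)+
      then show "C * (1 + \<bar>?t x\<bar>) ^ d \<le> \<kappa> / 4" "CH * (1 + \<bar>?t x\<bar>) ^ dH \<le> \<kappa> / 4" using elim(8,9) by linarith+
    qed
    have W_diff: "\<bar>W x - D (?t x)\<bar> \<le> 1/4 * exp (- (?t x)\<^sup>2 / 4)" if "T \<le> x" "x \<le> S" for x
    proof -
      have "(1/\<kappa>) * (C * (1 + \<bar>?t x\<bar>) ^ d) \<le> (1/\<kappa>) * (\<kappa> / 4)" using growth(1)[OF that] \<kappa> by (intro mult_left_mono) auto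
      then have "(1/\<kappa>) * (C * (1 + \<bar>?t x\<bar>) ^ d) \<le> 1/4" using \<kappa> by simp
      then have "(1/\<kappa>) * (C * (1 + \<bar>?t x\<bar>) ^ d) * exp (- (?t x)\<^sup>2 / 4) \<le> 1/4 * exp (- (?t x)\<^sup>2 / 4)" by (intro mult_right_mono) auto
      then show ?thesis using W(3)[of x] by linarith
    qed
    have W_low: "1/2 * exp (- (?t x)\<^sup>2 / 4) \<le> W x" if "T \<le> x" "x \<le> S" for x
      using W_diff[OF that] D_ge[OF t_ge[of x]] that S(2) exp_gt_zero[of "- (?t x)\<^sup>2 / 4"] by linarith
    have W_pos: "0 < W x" if "T \<le> x" "x \<le> S" for x
      using W_low[OF that] exp_gt_zero[of "- (?t x)\<^sup>2 / 4"] by linarith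
    have W_up: "W x \<le> \<kappa> * exp (- (?t x)\<^sup>2 / 4)" if "T \<le> x" "x \<le> S" for x
    proof -
      have "D (?t x) \<le> \<kappa> / 4 * exp (- (?t x)\<^sup>2 / 4)"
        unfolding D_def pcf_def mult.commute[of "exp _"]
        using CH(2)[of "?t x"] growth(2)[OF that] by (intro mult_right_mono) auto
      then have "W x \<le> (\<kappa> / 4 + 1/4) * exp (- (?t x)\<^sup>2 / 4)" using W_diff[OF that] unfolding distrib_right by linarith
      also have "\<dots> \<le> \<kappa> * exp (- (?t x)\<^sup>2 / 4)" using \<kappa> by (intro mult_right_mono) auto
      finally show ?thesis .
    qed
    have R_le: "\<bar>R x\<bar> \<le> \<delta> * W x" if "T \<le> x" "x \<le> S" for x
    proof -
      let ?E = "exp (- (?t x)\<^sup>2 / 4)"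
      have "\<bar>R x\<bar> \<le> (1/\<kappa>) ^ Suc (Suc n) * (C * (1 + \<bar>?t x\<bar>) ^ d) * ?E" by (rule W(4))
      also have "\<dots> \<le> (1/\<kappa>) ^ Suc (Suc n) * (\<kappa> / 4) * ?E"
        using growth(1)[OF that] \<kappa> by (intro mult_right_mono mult_left_mono) auto
      also have "\<dots> = \<delta> * (1/4 * ?E)" using \<kappa> by (simp add: \<delta>_def field_simps)
      also have "\<dots> \<le> \<delta> * W x" 
        using W_low[OF that] \<delta> exp_gt_zero[of "- (?t x)\<^sup>2 / 4"] by (intro mult_left_mono) linarith+
      finally show ?thesis .
    qed
    \<comment> \<open>As t is 1-Lipschitz, t \<ge> L - 1 on the last unit interval before
      \<open>S\<close>, where W \<le> \<kappa> exp (- t^2 / 4). The two powers of \<kappa> lost here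
      and the n + 1 in \<open>\<delta>\<close> add up to the exponent n + 3.\<close>
    define E where "E = exp ((L - 1)\<^sup>2 / 2) / \<kappa>\<^sup>2"
    have E: "E \<le> 1 / (W x)\<^sup>2" if "S - 1 \<le> x" "x \<le> S" for x
    proof -
      have Tx: "T \<le> x" using TS that by simp
      have "L - 1 \<le> ?t x" using lip[of S x] S(3) that by (auto simp: abs_le_iff)
      then have "(L - 1)\<^sup>2 \<le> (?t x)\<^sup>2" using L(1) T by (intro power_mono) auto
      then have "W x \<le> \<kappa> * exp (- (L - 1)\<^sup>2 / 4)"
        using W_up[OF Tx that(2)] \<kappa> by (elim order_trans) (intro mult_left_mono; simp)
      then have "(W x)\<^sup>2 \<le> (\<kappa> * exp (- (L - 1)\<^sup>2 / 4))\<^sup>2" using W_pos[OF Tx that(2)] by (intro power_mono) auto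
      also have "\<dots> = \<kappa>\<^sup>2 * exp (- ((L - 1)\<^sup>2 / 2))" by (simp add: power_mult_distrib power2_eq_square[of "exp _"] exp_add[symmetric])
      finally have "1 / (\<kappa>\<^sup>2 * exp (- ((L - 1)\<^sup>2 / 2))) \<le> 1 / (W x)\<^sup>2"
        using W_pos[OF Tx that(2)] \<kappa> by (intro divide_left_mono mult_pos_pos zero_less_power exp_gt_zero) auto
      then show ?thesis by (simp add: E_def exp_minus field_simps)
    qed
    define c where "c = \<delta> * c0\<^sup>2 / 2"
    have c: "0 < c" using \<delta> c0 by (simp add: c_def)
    have cE: "c * E = c0\<^sup>2 / 2 * ((1 / \<kappa>) ^ (n + 3) * exp ((L - 1)\<^sup>2 / 2))"
      using \<kappa> by (simp add: c_def E_def \<delta>_def power_add power3_eq_cube power2_eq_square field_simps)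
    \<comment> \<open>\<open>B0 + 1\<close> bounds the solution at \<open>T\<close>. The factors
      before \<open>c * E\<close> are lower bounds for W at \<open>S\<close> (undershoot) and at
      \<open>T\<close> (overshoot).\<close>
    have big: "B0 + 1 < 1/2 * exp (- L\<^sup>2 / 4) * (c * E)" "B0 + 1 < 1/2 * exp (- T\<^sup>2 / 4) * (c * E)"
    proof -
      let ?P = "(1 / \<kappa>) ^ (n + 3) * exp ((L - 1)\<^sup>2 / 2)"
      have P: "0 \<le> ?P" using \<kappa> by simp
      have "exp ((L - 1)\<^sup>2 / 2 - L\<^sup>2 / 4) = exp ((L - 1)\<^sup>2 / 2) * exp (- L\<^sup>2 / 4)"
        by (simp add: exp_add[symmetric])
      then have b: "B0 + 1 < c0 * exp (- L\<^sup>2 / 4) * (c0\<^sup>2 / 4 * ?P)"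
        using elim(10) unfolding K_def L_def[symmetric] by (simp add: mult_ac)
      have "c0 * exp (- L\<^sup>2 / 4) * (c0\<^sup>2 / 4 * ?P) \<le> 1 * exp (- L\<^sup>2 / 4) * (c0\<^sup>2 / 4 * ?P)"
        using P by (intro mult_right_mono) (auto simp: c0_def)
      with b show "B0 + 1 < 1/2 * exp (- L\<^sup>2 / 4) * (c * E)" unfolding cE by (simp add: mult_ac)
      have "c0 * exp (- L\<^sup>2 / 4) * (c0\<^sup>2 / 4 * ?P) \<le> c0 * 1 * (c0\<^sup>2 / 4 * ?P)"
        using P c0 by (intro mult_right_mono mult_left_mono) auto
      with b show "B0 + 1 < 1/2 * exp (- T\<^sup>2 / 4) * (c * E)" unfolding cE c0_def[symmetric] by (simp add: mult_ac)
    qed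
    have q_cont: "isCont (\<lambda>x. (?t x)\<^sup>2 / 4 - l) x" "isCont (\<lambda>x. (?t x)\<^sup>2 / 4) x" for l x
      using isCont_scaled_sn[OF k \<kappa>(1)] by (auto intro!: continuous_intros)
    have "\<forall>l. \<exists>y v. (\<forall>x. (y has_real_derivative v x) (at x)) \<and> (\<forall>x. (v has_real_derivative ((?t x)\<^sup>2 / 4 - l) * y x) (at x))
       \<and> y 0 = pcf m 0 \<and> v 0 = pcf' m 0"
      using linear_ode_exists[OF q_cont(1)] by blast
    then obtain Y Y' where Y: "\<And>l x. (Y l has_real_derivative Y' l x) (at x)"
       "\<And>l x. (Y' l has_real_derivative ((?t x)\<^sup>2 / 4 - l) * Y l x) (at x)"
       "\<And>l. Y l 0 = pcf m 0" "\<And>l. Y' l 0 = pcf' m 0" by metis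
    have l_h: "\<bar>l - (real m + 1/2)\<bar> \<le> min h 1" if "\<bar>l - l0\<bar> \<le> \<delta>" for l
      using elim(2,3) that unfolding \<delta>_def l0_def by linarith
    have Y_near: "\<bar>Y l x - D x\<bar> < e \<and> \<bar>Y' l x - pcf' m x\<bar> < e" if "\<bar>l - l0\<bar> \<le> \<delta>" "\<bar>x\<bar> \<le> T" for l x
      using near_pcf[THEN spec[of _ "\<lambda>x. (?t x)\<^sup>2 / 4"], THEN spec[of _ l], THEN spec[of _ "Y l"], THEN spec[of _ "Y' l"]]
        Y q_near l_h[OF that(1)] that(2) by (simp add: D_def)
    have Y_T: "0 < Y l T" "Y l T \<le> B0 + 1" if "\<bar>l - l0\<bar> \<le> \<delta>" for l
      using Y_near[OF that, of T] c0_le[of T] e(3,4) B0(2)[of T] T c0 by (auto simp: T_def abs_less_iff abs_le_iff)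
    have l_le: "l \<le> (?t x)\<^sup>2 / 4" if "\<bar>l - l0\<bar> \<le> \<delta>" "T \<le> x" "x \<le> X" for l x
    proof -
      have "T1\<^sup>2 \<le> (?t x)\<^sup>2" using t_ge[OF that(2,3)] T1(1) by (intro power_mono) auto
      then show ?thesis using l_h[OF that(1)] T1(2) by (auto simp: abs_le_iff)
    qed
    have F_bound: "c \<le> s * (Y l T * W' T - W T * Y' l T)" if s: "s = 1 \<or> s = - 1" "l - l0 = s * \<delta>" for l s
      unfolding c_def T_def
    proof (rule wronskian_lower_bound[where y = "Y l" and y' = "Y' l" and W = W and W' = W' and D = D and B = B0 and e = e
          and R = R and Q = "\<lambda>x. (?t x)\<^sup>2 / 4" and l = l and ?l0.0 = l0])
      have l: "\<bar>l - l0\<bar> \<le> \<delta>" using s \<delta> by auto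
      show "\<bar>Y l x - D x\<bar> \<le> e \<and> \<bar>W x - D x\<bar> \<le> e \<and> \<bar>D x\<bar> \<le> B0 \<and> \<bar>R x\<bar> \<le> \<delta> * e" if "0 \<le> x" "x \<le> T1 + 1" for x
        using Y_near[OF l, of x] W_near[of x] B0(2)[of x] R_near[of x] that by (auto simp: T_def)
      show "Y l 0 * W' 0 - W 0 * Y' l 0 = 0" using W(5) by (simp add: Y)
    qed (use Y W s \<delta> T1(1) B0(1) e e_c0 c0 c0_le in \<open>auto simp: T_def\<close>)
    have shoot: "shooting (Y l) (Y' l) W W' (\<lambda>x. (?t x)\<^sup>2 / 4) R l l0 \<delta> T S X c E" if l: "\<bar>l - l0\<bar> \<le> \<delta>" for l
      by unfold_locales (use Y W TS SX l_le[OF l] W_pos R_le Y_T(1)[OF l] c E in auto)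
    have dl: "\<bar>l0 + \<delta> - l0\<bar> \<le> \<delta>" "\<bar>l0 - \<delta> - l0\<bar> \<le> \<delta>" using \<delta> by auto
    have over: "Y (l0 + \<delta>) X < 0 \<and> Y' (l0 + \<delta>) X < 0"
    proof (rule shooting.overshoot[OF shoot[OF dl(1)] refl])
      show "c \<le> shooting.F (Y (l0 + \<delta>)) (Y' (l0 + \<delta>)) W W' T"
        unfolding shooting.F_def[OF shoot[OF dl(1)]] using F_bound[of 1 "l0 + \<delta>"] by simp
      have "1/2 * exp (- T\<^sup>2 / 4) \<le> 1/2 * exp (- (?t T)\<^sup>2 / 4)"
        using t_abs[of T] T by (simp add: abs_le_square_iff[symmetric])
      also have "\<dots> \<le> W T" using W_low[of T] TS by simp
      finally have "1/2 * exp (- T\<^sup>2 / 4) * (c * E) \<le> W T * (c * E)"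
        using c \<kappa> by (intro mult_right_mono) (auto simp: E_def)
      then show "Y (l0 + \<delta>) T < W T * (c * E)" using big(2) Y_T(2)[OF dl(1)] by linarith
    qed
    have under: "0 < Y (l0 - \<delta>) X \<and> 0 < Y' (l0 - \<delta>) X"
    proof (rule shooting.undershoot[OF shoot[OF dl(2)] refl])
      show "shooting.F (Y (l0 - \<delta>)) (Y' (l0 - \<delta>)) W W' T \<le> - c"
        unfolding shooting.F_def[OF shoot[OF dl(2)]] using F_bound[of "- 1" "l0 - \<delta>"] by simp
      have "1/2 * exp (- L\<^sup>2 / 4) \<le> W S" using W_low[of S] TS S(3) by simp
      then have "1/2 * exp (- L\<^sup>2 / 4) * (c * E) \<le> W S * (c * E)"
        using c \<kappa> by (intro mult_right_mono) (auto simp: E_def)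
      then show "Y (l0 - \<delta>) T < W S * (c * E)" using big(1) Y_T(2)[OF dl(2)] by linarith
    qed
    have eigen: "rescaled_eigenpair k m dirichlet \<kappa> l (Y l) (Y' l)"
      if l: "\<bar>l - l0\<bar> \<le> \<delta>" and bc: "if dirichlet then Y l X = 0 else Y' l X = 0" for l dirichlet
    proof -
      have par: "Y l (- x) = (- 1) ^ m * Y l x" "Y' l (- x) = - ((- 1) ^ m * Y' l x)" for x
        using solution_parity[where q = "\<lambda>x. (?t x)\<^sup>2 / 4 - l", OF Y(1) Y(2) q_cont(1) _ Y(3) Y(4)] by (auto simp: tm)
      obtain M where M: "\<And>x. T \<le> x \<Longrightarrow> x \<le> X \<Longrightarrow> \<bar>(?t x)\<^sup>2 / 4 - l\<bar> \<le> M"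
        using continuous_bounded_Icc[of "\<lambda>x. (?t x)\<^sup>2 / 4 - l" T X] q_cont(1) by blast
      have tail: "0 < Y l x" if "T \<le> x" "x < X" for x
      proof (rule no_zero_in_tail[where y = "Y l" and y' = "Y' l" and p = "\<lambda>x. (?t x)\<^sup>2 / 4 - l" and T = T and X = X and M = M])
        show "0 \<le> (?t u)\<^sup>2 / 4 - l \<and> (?t u)\<^sup>2 / 4 - l \<le> M" if "T \<le> u" "u \<le> X" for u
          using l_le[OF l that] M[OF that] by (auto simp: abs_le_iff)
      qed (use Y Y_T(1)[OF l] bc that in \<open>auto split: if_splits\<close>)
      have TX: "T < X" using TS SX by simp
      have cnt: "finite {x \<in> {-T..T}. Y l x = 0} \<and> card {x \<in> {-T..T}. Y l x = 0} = m"
        by (rule e0(2)[where g' = "Y' l"]) (use Y(1) Y_near[OF l] e(2) in \<open>force simp: abs_le_iff\<close>)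
      \<comment> \<open>Beyond \<open>T\<close> there are no zeros by \<open>tail\<close>, below
        \<open>- T\<close> none by parity; those in between were counted by comparison with
        D_m.\<close>
      have same: "{x \<in> {-X<..<X}. Y l x = 0} = {x \<in> {-T..T}. Y l x = 0}"
      proof (intro equalityI subsetI)
        fix x assume x: "x \<in> {x \<in> {-X<..<X}. Y l x = 0}"
        have "\<not> T < x" using tail[of x] x by auto
        moreover have "\<not> x < - T" using tail[of "- x"] x par(1)[of x] by auto
        ultimately show "x \<in> {x \<in> {-T..T}. Y l x = 0}" using x by auto
      qed (use TX in auto)
      have "Y l T \<noteq> 0" "T \<in> {-X<..<X}" using Y_T(1)[OF l] TX T by auto
      then show ?thesis
        unfolding rescaled_eigenpair_def Let_def X_def[symmetric] same using Y(1,2) bc par cnt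
        by (auto split: if_splits)
    qed
    have cont: "isCont (\<lambda>l. Y l X) l" "isCont (\<lambda>l. Y' l X) l" for l
      using solution_continuous_in_parameter[of "\<lambda>x. (?t x)\<^sup>2 / 4" Y Y' "pcf m 0" "pcf' m 0" X l, OF q_cont(2) Y] X by auto
    have "\<exists>l. \<bar>l - l0\<bar> \<le> \<delta> \<and> (if dirichlet then Y l X = 0 else Y' l X = 0)" for dirichlet
    proof -
      have "\<exists>l\<ge>l0 - \<delta>. l \<le> l0 + \<delta> \<and> Y l X = 0" "\<exists>l\<ge>l0 - \<delta>. l \<le> l0 + \<delta> \<and> Y' l X = 0"
        using over under \<delta> cont by (intro IVT2; auto)+
      moreover have "\<bar>l - l0\<bar> \<le> \<delta>" if "l0 - \<delta> \<le> l" "l \<le> l0 + \<delta>" for l using that by auto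
      ultimately show ?thesis by (cases dirichlet) (simp_all, blast+)
    qed
    then show ?case using eigen unfolding \<delta>_def l0_def by meson
  qed
qed

section \<open>Lame eigenvalues\<close>

text \<open>The Boolean selects the boundary condition, so that both expansions come out of one
  proof.\<close>

definition lame_eigen :: "real \<Rightarrow> real \<Rightarrow> bool \<Rightarrow> real \<Rightarrow> nat \<Rightarrow> bool" where
  "lame_eigen k \<nu> dirichlet h m \<longleftrightarrow> (\<exists>w w'. lame_solution k \<nu> h w w' \<and>
     (if dirichlet then w (- ellK k) = 0 \<and> w (ellK k) = 0 else w' (- ellK k) = 0 \<and> w' (ellK k) = 0) \<and> has_zeros k w m)"

text \<open>By Sturm's comparison a larger h forces strictly more zeros under the same boundary
  condition. With existence from the shooting argument, this turns the \<open>THE\<close> of the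
  eigenvalues into the value found.\<close>

lemma lame_eigen_not_less:
  assumes "0 < k" "k < 1" "lame_eigen k \<nu> bc h1 m" "lame_eigen k \<nu> bc h2 m"
  shows "\<not> h1 < h2"
proof
  assume h: "h1 < h2"
  let ?q = "\<lambda>z. \<nu> * (\<nu> + 1) * k\<^sup>2 * (jacobi_sn k z)\<^sup>2"
  let ?K = "ellK k"
  have deriv: "(w has_real_derivative w' z) (at z within {- ?K..?K})"
    "(w' has_real_derivative (?q z - h) * w z) (at z within {- ?K..?K})"
    if "lame_solution k \<nu> h w w'" "z \<in> {- ?K..?K}" for h w w' z
  proof -
    from that obtain w'' where w: "(w has_real_derivative w' z) (at z within {- ?K..?K})"
      "(w' has_real_derivative w'') (at z within {- ?K..?K})" "w'' + (h - ?q z) * w z = 0"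
      unfolding lame_solution_def by blast
    have "w'' = (?q z - h) * w z" using w(3) by (simp add: algebra_simps)
    then show "(w has_real_derivative w' z) (at z within {- ?K..?K})"
      "(w' has_real_derivative (?q z - h) * w z) (at z within {- ?K..?K})" using w by auto
  qed
  obtain u u' where u: "lame_solution k \<nu> h1 u u'" "has_zeros k u m"
    "if bc then u (- ?K) = 0 \<and> u ?K = 0 else u' (- ?K) = 0 \<and> u' ?K = 0"
    using assms(3) unfolding lame_eigen_def by blast
  obtain v v' where v: "lame_solution k \<nu> h2 v v'" "has_zeros k v m"
    "if bc then v (- ?K) = 0 \<and> v ?K = 0 else v' (- ?K) = 0 \<and> v' ?K = 0"
    using assms(4) unfolding lame_eigen_def by blast
  have "card {z \<in> {- ?K<..<?K}. u z = 0} < card {z \<in> {- ?K<..<?K}. v z = 0}"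
  proof (rule sturm_more_zeros[where u' = u' and v' = v' and q = ?q and ?h1.0 = h1 and ?h2.0 = h2])
    show "- ?K < ?K" using ellK_pos[OF assms(1,2)] by simp
    show "finite {z \<in> {- ?K<..<?K}. u z = 0}" "finite {z \<in> {- ?K<..<?K}. v z = 0}"
      using u(2) v(2) by (auto simp: has_zeros_def)
    show "u (- ?K) = 0 \<or> u' (- ?K) = 0 \<and> v' (- ?K) = 0" "u ?K = 0 \<or> u' ?K = 0 \<and> v' ?K = 0"
      using u(3) v(3) by (auto split: if_splits)
  qed (use deriv[OF u(1)] deriv[OF v(1)] h in auto)
  then show False using u(2) v(2) by (simp add: has_zeros_def)
qed

lemma lame_eigen_the:
  assumes "0 < k" "k < 1" "lame_eigen k \<nu> bc h m"
  shows "(THE h. lame_eigen k \<nu> bc h m) = h"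
proof (rule the_equality)
  fix h' assume h': "lame_eigen k \<nu> bc h' m"
  show "h' = h"
    using lame_eigen_not_less[OF assms(1,2) assms(3) h'] lame_eigen_not_less[OF assms(1,2) h' assms(3)] by simp
qed (rule assms(3))

lemma lame_a_eq_the: "lame_a k \<nu> m = (THE h. lame_eigen k \<nu> False h m)"
  by (simp add: lame_a_def lame_eigen_def)

lemma lame_b_eq_the: "lame_b k \<nu> (m + 1) = (THE h. lame_eigen k \<nu> True h m)"
  by (simp add: lame_b_def lame_eigen_def)

text \<open>The substitution w(z) = y(sqrt (2 \<kappa>) z) multiplies the equation by 2 \<kappa>;
  the potential becomes \<kappa>^2 sn^2, and \<kappa>^2 = \<nu> (\<nu> + 1) k^2 by the definition of
  \<kappa>.\<close>

lemma rescaled_eigenpair_imp_lame_eigen: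
  assumes k: "0 < k" "k < 1" and \<nu>: "0 < \<nu>" and pair: "rescaled_eigenpair k m bc (lame_kappa k \<nu>) l y y'"
  shows "lame_eigen k \<nu> bc (2 * lame_kappa k \<nu> * l) m"
proof -
  define \<kappa> where "\<kappa> = lame_kappa k \<nu>"
  have \<kappa>: "0 < \<kappa>" using k \<nu> by (simp add: \<kappa>_def lame_kappa_def)
  have \<kappa>2: "\<kappa>\<^sup>2 = \<nu> * (\<nu> + 1) * k\<^sup>2" using \<nu> by (simp add: \<kappa>_def lame_kappa_def power_mult_distrib)
  define r where "r = sqrt (2 * \<kappa>)"
  have r: "0 < r" "r * r = 2 * \<kappa>" using \<kappa> by (simp_all add: r_def)
  let ?K = "ellK k"
  define w where "w z = y (r * z)" for z
  define w' where "w' z = r * y' (r * z)" for z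
  have dy: "\<And>x. (y has_real_derivative y' x) (at x)"
      "\<And>x. (y' has_real_derivative ((scaled_sn k \<kappa> x)\<^sup>2 / 4 - l) * y x) (at x)"
    and nz: "\<exists>x\<in>{- (r * ?K)<..<r * ?K}. y x \<noteq> 0"
    and bc: "if bc then y (r * ?K) = 0 \<and> y (- (r * ?K)) = 0 else y' (r * ?K) = 0 \<and> y' (- (r * ?K)) = 0"
    and cnt: "finite {x \<in> {- (r * ?K)<..<r * ?K}. y x = 0}" "card {x \<in> {- (r * ?K)<..<r * ?K}. y x = 0} = m"
    using pair[folded \<kappa>_def, unfolded rescaled_eigenpair_def Let_def r_def[symmetric]] by blast+
  have dr: "((\<lambda>z. r * z) has_real_derivative r) (at z)" for z by (auto intro!: derivative_eq_intros)
  have dw: "(w has_real_derivative w' z) (at z)" for z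
    unfolding w_def[abs_def] w'_def using DERIV_chain2[OF dy(1) dr, of z] by (simp add: mult.commute)
  have dw': "(w' has_real_derivative r * ((((scaled_sn k \<kappa> (r * z))\<^sup>2 / 4 - l) * y (r * z)) * r)) (at z)" for z
    unfolding w'_def[abs_def] by (intro DERIV_cmult DERIV_chain2[OF dy(2) dr])
  have sc: "scaled_sn k \<kappa> (r * z) = r * jacobi_sn k z" for z
    using r(1) by (simp add: scaled_sn_def r_def[symmetric])
  have eq: "r * ((((scaled_sn k \<kappa> (r * z))\<^sup>2 / 4 - l) * y (r * z)) * r)
      = (\<nu> * (\<nu> + 1) * k\<^sup>2 * (jacobi_sn k z)\<^sup>2 - 2 * \<kappa> * l) * w z" for z
  proof -
    have "r * ((((r * jacobi_sn k z)\<^sup>2 / 4 - l) * y (r * z)) * r)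
      = ((r * r)\<^sup>2 * (jacobi_sn k z)\<^sup>2 / 4 - (r * r) * l) * y (r * z)"
      by (simp add: power2_eq_square algebra_simps)
    also have "\<dots> = (\<kappa>\<^sup>2 * (jacobi_sn k z)\<^sup>2 - 2 * \<kappa> * l) * y (r * z)"
      unfolding r(2) by (simp add: power2_eq_square)
    finally show ?thesis unfolding sc \<kappa>2 w_def .
  qed
  have img: "{x \<in> {- (r * ?K)<..<r * ?K}. y x = 0} = (\<lambda>z. r * z) ` {z \<in> {- ?K<..<?K}. w z = 0}"
  proof (intro equalityI subsetI)
    fix x assume x: "x \<in> {x \<in> {- (r * ?K)<..<r * ?K}. y x = 0}"
    have "- ?K < x / r" "x / r < ?K" using x r(1) by (auto simp: field_simps)
    then show "x \<in> (\<lambda>z. r * z) ` {z \<in> {- ?K<..<?K}. w z = 0}"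
      using x r(1) by (intro image_eqI[of _ _ "x / r"]) (auto simp: w_def)
  next
    fix x assume "x \<in> (\<lambda>z. r * z) ` {z \<in> {- ?K<..<?K}. w z = 0}"
    then obtain z where z: "x = r * z" "- ?K < z" "z < ?K" "w z = 0" by auto
    have "r * - ?K < r * z" "r * z < r * ?K" using z r(1) by (intro mult_strict_left_mono; simp)+
    then show "x \<in> {x \<in> {- (r * ?K)<..<r * ?K}. y x = 0}" using z by (auto simp: w_def)
  qed
  have inj: "inj_on (\<lambda>z. r * z) S" for S using r(1) by (auto intro: inj_onI)
  have "has_zeros k w m"
    using finite_imageD[OF cnt(1)[unfolded img] inj] cnt(2)[unfolded img] unfolding has_zeros_def card_image[OF inj] by blast
  moreover have "lame_solution k \<nu> (2 * \<kappa> * l) w w'"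
    unfolding lame_solution_def
  proof (intro conjI ballI)
    fix z assume "z \<in> {- ?K..?K}"
    show "(w has_real_derivative w' z) (at z within {- ?K..?K})"
      using dw by (rule has_field_derivative_at_within)
    have "(w' has_real_derivative (\<nu> * (\<nu> + 1) * k\<^sup>2 * (jacobi_sn k z)\<^sup>2 - 2 * \<kappa> * l) * w z) (at z within {- ?K..?K})"
      using dw'[of z] unfolding eq by (rule has_field_derivative_at_within)
    then show "\<exists>w''. (w' has_real_derivative w'') (at z within {- ?K..?K}) \<and>
        w'' + (2 * \<kappa> * l - \<nu> * (\<nu> + 1) * k\<^sup>2 * (jacobi_sn k z)\<^sup>2) * w z = 0"
      by (intro exI[of _ "(\<nu> * (\<nu> + 1) * k\<^sup>2 * (jacobi_sn k z)\<^sup>2 - 2 * \<kappa> * l) * w z"] conjI) (assumption, simp add: algebra_simps)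
  next
    obtain x where x: "- (r * ?K) < x" "x < r * ?K" "y x \<noteq> 0" using nz by auto
    then have "- ?K \<le> x / r" "x / r \<le> ?K" "w (x / r) \<noteq> 0" using r(1) by (auto simp: field_simps w_def)
    then show "\<exists>z\<in>{- ?K..?K}. w z \<noteq> 0" by auto
  qed
  moreover have "if bc then w (- ?K) = 0 \<and> w ?K = 0 else w' (- ?K) = 0 \<and> w' ?K = 0"
    using bc by (cases bc) (simp_all add: w_def w'_def)
  ultimately show ?thesis unfolding lame_eigen_def \<kappa>_def by blast
qed

text \<open>The gap contributes 2 \<kappa> \<kappa>^(-n-1) = 2 \<kappa>^(-n), and the level holds
  one term more than the claim, 2 \<mu>_(n+1) \<kappa>^(-n), which explains the constant.\<close>

lemma eigenvalue_expansion_bound: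
  assumes \<kappa>: "0 < \<kappa>" and n: "1 \<le> n" and l: "\<bar>l - trunc_level m \<mu> (Suc n) \<kappa>\<bar> \<le> (1/\<kappa>) ^ Suc n"
  shows "\<bar>2 * \<kappa> * l - ((2 * real m + 1) * \<kappa> + 2 * (\<Sum>s=0..n-1. \<mu> (s + 1) / \<kappa> ^ s))\<bar>
    \<le> (2 + 2 * \<bar>\<mu> (n + 1)\<bar>) * \<bar>1 / \<kappa> ^ n\<bar>"
proof -
  have "\<kappa> * (\<Sum>s=1..Suc n. \<mu> s * (1/\<kappa>) ^ s) = (\<Sum>s=0..n. \<mu> (s + 1) / \<kappa> ^ s)"
    unfolding sum_distrib_left One_nat_def sum.shift_bounds_cl_Suc_ivl
    using \<kappa> by (intro sum.cong) (auto simp: field_simps power_divide)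
  also have "\<dots> = (\<Sum>s=0..n-1. \<mu> (s + 1) / \<kappa> ^ s) + \<mu> (n + 1) / \<kappa> ^ n"
    using n by (cases n) auto
  finally have sum: "\<kappa> * (\<Sum>s=1..Suc n. \<mu> s * (1/\<kappa>) ^ s) = \<dots>" .
  have "2 * \<kappa> * trunc_level m \<mu> (Suc n) \<kappa> = (2 * real m + 1) * \<kappa> + 2 * (\<kappa> * (\<Sum>s=1..Suc n. \<mu> s * (1/\<kappa>) ^ s))"
    by (simp add: trunc_level_def algebra_simps)
  then have "2 * \<kappa> * l - ((2 * real m + 1) * \<kappa> + 2 * (\<Sum>s=0..n-1. \<mu> (s + 1) / \<kappa> ^ s))
     = 2 * \<kappa> * (l - trunc_level m \<mu> (Suc n) \<kappa>) + 2 * (\<mu> (n + 1) / \<kappa> ^ n)"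
    unfolding sum by (simp add: algebra_simps)
  moreover have "\<bar>2 * \<kappa> * (l - trunc_level m \<mu> (Suc n) \<kappa>)\<bar> \<le> 2 * \<kappa> * (1/\<kappa>) ^ Suc n"
    unfolding abs_mult using l \<kappa> by (intro mult_mono) auto
  moreover have "2 * \<kappa> * (1/\<kappa>) ^ Suc n = 2 * (1 / \<kappa> ^ n)" using \<kappa> by (simp add: power_divide)
  moreover have "\<bar>2 * (\<mu> (n + 1) / \<kappa> ^ n)\<bar> = 2 * \<bar>\<mu> (n + 1)\<bar> * (1 / \<kappa> ^ n)" using \<kappa> by (simp add: abs_mult)
  moreover have "\<bar>1 / \<kappa> ^ n\<bar> = 1 / \<kappa> ^ n" using \<kappa> by simp
  ultimately show ?thesis unfolding distrib_right by linarith
qed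

lemma lame_eigenvalue_asymptotics:
  assumes k: "0 < k" "k < 1" and n: "1 \<le> n"
  shows "(\<lambda>\<nu>. (THE h. lame_eigen k \<nu> bc h m)
            - ((2 * real m + 1) * lame_kappa k \<nu> + 2 * (\<Sum>s=0..n-1. lame_mu k m (s + 1) / lame_kappa k \<nu> ^ s)))
          \<in> O[at_top](\<lambda>\<nu>. 1 / lame_kappa k \<nu> ^ n)"
proof -
  obtain A B \<mu> where rec: "lame_recursion k m A B \<mu>" using lame_recursion_exists by blast
  have \<mu>: "lame_mu k m (s + 1) = \<mu> (s + 1)" for s by (rule lame_mu_eq[OF rec]) simp
  have lim: "filterlim (lame_kappa k) at_top at_top"
    unfolding lame_kappa_def using k(1) by real_asymp
  show ?thesis
  proof (rule bigoI)
    show "eventually (\<lambda>\<nu>. norm ((THE h. lame_eigen k \<nu> bc h m)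
            - ((2 * real m + 1) * lame_kappa k \<nu> + 2 * (\<Sum>s=0..n-1. lame_mu k m (s + 1) / lame_kappa k \<nu> ^ s)))
         \<le> (2 + 2 * \<bar>\<mu> (n + 1)\<bar>) * norm (1 / lame_kappa k \<nu> ^ n)) at_top"
      using eventually_compose_filterlim[OF eigenvalue_near[OF k rec, of n] lim] eventually_gt_at_top[of 0]
    proof eventually_elim
      case (elim \<nu>)
      then obtain l y y' where l: "\<bar>l - trunc_level m \<mu> (Suc n) (lame_kappa k \<nu>)\<bar> \<le> (1 / lame_kappa k \<nu>) ^ Suc n"
        and pair: "rescaled_eigenpair k m bc (lame_kappa k \<nu>) l y y'" by blast
      have pos: "0 < lame_kappa k \<nu>" using k elim(2) by (simp add: lame_kappa_def)
      show ?case
        unfolding lame_eigen_the[OF k rescaled_eigenpair_imp_lame_eigen[OF k elim(2) pair]] \<mu> real_norm_def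
        by (rule eigenvalue_expansion_bound[OF pos n l])
    qed
  qed
qed

theorem mainTheorem2:
  fixes k :: real and m :: nat
  assumes "0 < k" and "k < 1"
  shows
    "(\<forall>n\<ge>1::nat.
        (\<lambda>\<nu>::real. lame_a k \<nu> m
            - ((2 * real m + 1) * lame_kappa k \<nu>
               + 2 * (\<Sum>s=0..n-1. lame_mu k m (s + 1) / lame_kappa k \<nu> ^ s)))
          \<in> O[at_top](\<lambda>\<nu>. 1 / lame_kappa k \<nu> ^ n) \<and>
        (\<lambda>\<nu>::real. lame_b k \<nu> (m + 1)
            - ((2 * real m + 1) * lame_kappa k \<nu>
               + 2 * (\<Sum>s=0..n-1. lame_mu k m (s + 1) / lame_kappa k \<nu> ^ s)))
          \<in> O[at_top](\<lambda>\<nu>. 1 / lame_kappa k \<nu> ^ n)) \<and>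
     lame_mu k m 1 = - ((k\<^sup>2 + 1) / 8) * (1 + 2 * real m + 2 * (real m)\<^sup>2) \<and>
     lame_mu k m 2 = - ((2 * real m + 1) / 32)
        * ((k\<^sup>2 - 1)\<^sup>2 * (1 + real m + (real m)\<^sup>2) - 2 * k\<^sup>2)"
proof -
  have mu1: "- (1 + k\<^sup>2) * (1 + (2 * real m + 1)\<^sup>2) / 16 = - ((k\<^sup>2 + 1) / 8) * (1 + 2 * real m + 2 * (real m)\<^sup>2)"
    by (simp add: power2_eq_square field_simps)
  have mu2: "(2 * real m + 1) * k\<^sup>2 / 16 - (2 * real m + 1) * ((2 * real m + 1)\<^sup>2 + 3) * (1 - k\<^sup>2)\<^sup>2 / 128
    = - ((2 * real m + 1) / 32) * ((k\<^sup>2 - 1)\<^sup>2 * (1 + real m + (real m)\<^sup>2) - 2 * k\<^sup>2)"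
    by (simp add: power2_eq_square field_simps)
  show ?thesis
    unfolding lame_mu_1_2 mu1 mu2
    using lame_eigenvalue_asymptotics[OF assms, where bc = False and m = m] lame_eigenvalue_asymptotics[OF assms, where bc = True and m = m]
    by (simp add: lame_a_eq_the lame_b_eq_the[unfolded Suc_eq_plus1[symmetric]])
qed

end
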